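(* Let $k\ge2$ and, for $\varepsilon>0$ small, let $u=u_\varepsilon$ be a solution of $(E_\varepsilon)$ admitting the points $\frac{a_\varepsilon^1}{\varepsilon},\dots,\frac{a_\varepsilon^k}{\varepsilon}$ of $[-\frac\pi\varepsilon,\frac\pi\varepsilon[$ as peaks. Then necessarily $$\frac{a_\varepsilon^{i+1}-a_\varepsilon^i}{\varepsilon}-\frac{2\pi}{k\varepsilon}\to0\quad\text{as }\varepsilon\to0,\qquad i=0,\dots,k.$$
   Context: Let $N\ge2$ and let $p$ satisfy $2\le p<\frac{N+2}{N-2}$ if $N\ge3$, and $p\ge2$ if $N=2$. Write $x=(x_1,x')\in\mathbb R\times\mathbb R^{N-1}$ and $u_+=\max(u,0)$. For $\varepsilon>0$, $(E_\varepsilon)$ denotes the problem $$-\Delta u+u-u_+^p=0\ \text{ in }\ \tfrac{S^1}{\varepsilon}\times\mathbb R^{N-1},$$ i.e. $u$ and $\partial u/\partial x_1$ are $\frac{2\pi}{\varepsilon}$-periodic in $x_1$, together with $u(x_1,x')\to0$ as $|x'|\to\infty$, uniformly in $x_1$. $U$ is the ground state on $\mathbb R^N$: the positive solution of $-\Delta U+U-U^p=0$ in $\mathbb R^N$ that is radial and decreasing to $0$ at infinity. Peaks: for each $\varepsilon>0$ let $a_\varepsilon^1,\dots,a_\varepsilon^k\in[-\pi,\pi[$; put $a_\varepsilon^0=a_\varepsilon^k-2\pi$, $a_\varepsilon^{k+1}=a_\varepsilon^1+2\pi$. A family of solutions $u=u_\varepsilon$ of $(E_\varepsilon)$ admits the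 points $\frac{a_\varepsilon^1}{\varepsilon},\dots,\frac{a_\varepsilon^k}{\varepsilon}$ as peaks if $\frac{a_\varepsilon^{i+1}-a_\varepsilon^i}{\varepsilon}\to+\infty$ as $\varepsilon\to0$ for $i=0,\dots,k$, and $$\Big\|u-\sum_{i=1}^kU\big(\cdot-(\tfrac{a_\varepsilon^i}{\varepsilon},0)\big)\Big\|_{L^\infty(]-\frac\pi\varepsilon,\frac\pi\varepsilon[\times\mathbb R^{N-1})}\to0\quad(\varepsilon\to0).$$ *)

theory Defs
  imports "HOL-Probability.Essential_Supremum"
begin

definition partial_deriv :: "'a::euclidean_space \<Rightarrow> ('a \<Rightarrow> real) \<Rightarrow> 'a \<Rightarrow> real" where
  "partial_deriv b f x = frechet_derivative f (at x) b"

definition C2 :: "('a::euclidean_space \<Rightarrow> real) \<Rightarrow> bool" where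
  "C2 f \<longleftrightarrow>
     f differentiable_on UNIV \<and>
     (\<forall>b\<in>Basis. partial_deriv b f differentiable_on UNIV) \<and>
     (\<forall>b\<in>Basis. \<forall>c\<in>Basis. continuous_on UNIV (partial_deriv c (partial_deriv b f)))"

definition laplacian :: "('a::euclidean_space \<Rightarrow> real) \<Rightarrow> 'a \<Rightarrow> real" where
  "laplacian f x = (\<Sum>b\<in>Basis. partial_deriv b (partial_deriv b f) x)"

text \<open>
  A point of \<open>\<real>\<^sup>N\<close> is a pair \<open>(x1, x')\<close> of type \<open>real \<times> (real ^ 'n)\<close>, with \<open>N = 1 + CARD('n)\<close>;
  the norm on this product type is the Euclidean one. A function on
  \<open>S\<^sup>1/\<epsilon> \<times> \<real>\<^sup>N\<^sup>-\<^sup>1\<close> is a function on all of \<open>\<real>\<^sup>N\<close> that is \<open>2\<pi>/\<epsilon>\<close>-periodic in \<open>x1\<close>.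
  Solutions are classical, and real powers are only applied to nonnegative bases
  (\<open>0 powr p = 0\<close>).
\<close>

definition solves_E :: "real \<Rightarrow> real \<Rightarrow> (real \<times> (real ^ 'n) \<Rightarrow> real) \<Rightarrow> bool" where
  "solves_E p \<epsilon> u \<longleftrightarrow>
     C2 u \<and>
     (\<forall>x. - laplacian u x + u x - (max (u x) 0) powr p = 0) \<and>
     (\<forall>x1 x'. u (x1 + 2 * pi / \<epsilon>, x') = u (x1, x')) \<and>
     (\<forall>x1 x'. partial_deriv (1, 0) u (x1 + 2 * pi / \<epsilon>, x') = partial_deriv (1, 0) u (x1, x')) \<and>
     uniform_limit UNIV (\<lambda>x' x1. u (x1, x')) (\<lambda>x1. 0) at_infinity"

definition ground_state :: "real \<Rightarrow> ('a::euclidean_space \<Rightarrow> real) \<Rightarrow> bool" where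
  "ground_state p U \<longleftrightarrow>
     C2 U \<and>
     (\<forall>x. U x > 0) \<and>
     (\<forall>x. - laplacian U x + U x - U x powr p = 0) \<and>
     (\<exists>\<phi>. (\<forall>x. U x = \<phi> (norm x)) \<and> strict_antimono_on {0..} \<phi> \<and> (\<phi> \<longlongrightarrow> 0) at_top)"

definition Linf_norm :: "'a::euclidean_space set \<Rightarrow> ('a \<Rightarrow> real) \<Rightarrow> ereal" where
  "Linf_norm S f = esssup (lebesgue_on S) (\<lambda>x. ereal \<bar>f x\<bar>)"

text \<open>The points \<open>a 1, \<dots>, a k\<close> together with \<open>a\<^sup>0 = a\<^sup>k - 2\<pi>\<close> and \<open>a\<^sup>k\<^sup>+\<^sup>1 = a\<^sup>1 + 2\<pi>\<close>;
  the values \<open>a i\<close> with \<open>i\<close> outside \<open>{1..k}\<close> are ignored.\<close>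

definition peak_ext :: "nat \<Rightarrow> (nat \<Rightarrow> real) \<Rightarrow> nat \<Rightarrow> real" where
  "peak_ext k a i =
     (if i = 0 then a k - 2 * pi else if i = k + 1 then a 1 + 2 * pi else a i)"

definition admits_peaks ::
    "(real \<times> (real ^ 'n) \<Rightarrow> real) \<Rightarrow> (real \<Rightarrow> real \<times> (real ^ 'n) \<Rightarrow> real) \<Rightarrow>
     nat \<Rightarrow> (real \<Rightarrow> nat \<Rightarrow> real) \<Rightarrow> bool" where
  "admits_peaks U u k a \<longleftrightarrow>
     (\<forall>\<^sub>F \<epsilon> in at_right 0. \<forall>i\<in>{1..k}. a \<epsilon> i \<in> {-pi..<pi}) \<and>
     (\<forall>i\<in>{0..k}. filterlim (\<lambda>\<epsilon>. (peak_ext k (a \<epsilon>) (i + 1) - peak_ext k (a \<epsilon>) i) / \<epsilon>) at_top (at_right 0)) \<and>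
     ((\<lambda>\<epsilon>. Linf_norm ({-pi / \<epsilon><..<pi / \<epsilon>} \<times> UNIV)
              (\<lambda>x. u \<epsilon> x - (\<Sum>i=1..k. U (x - (a \<epsilon> i / \<epsilon>, 0))))) \<longlongrightarrow> 0) (at_right 0)"

end

theory Submission
  imports Defs
begin

text \<open>
  The equation has a conserved quantity: the integral over a hyperplane \<open>x1 = t\<close> of
  \<open>u\<^sub>1\<^sup>2 - \<bar>\<nabla>'u\<bar>\<^sup>2 - u\<^sup>2 + 2/(p+1) u\<^sub>+\<^sup>p\<^sup>+\<^sup>1\<close> does not depend on \<open>t\<close>. On the midplane between two adjacent
  peaks at distance \<open>2 L\<close> it equals \<open>- 4 \<Phi>(L) (1 + o(1))\<close>, where \<open>\<Phi>(L)\<close> is the integral of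
  \<open>U\<^sup>2 + \<bar>\<nabla>'U\<bar>\<^sup>2\<close> over \<open>x1 = L\<close>. Hence the values \<open>\<Phi>(L)\<close> at the different gaps have ratios tending
  to 1, and since \<open>\<Phi>(L + \<delta>) \<le> (1 - \<kappa>) \<Phi>(L)\<close> with \<open>\<kappa> > 0\<close> depending only on \<open>\<delta>\<close>, the gaps become equal.

  The asymptotics on the midplanes only need the maximum principle. Away from the peaks,
  \<open>U + U\<^sup>3\<^sup>/\<^sup>2\<close> is a subsolution of the linear equation and \<open>U - U\<^sup>3\<^sup>/\<^sup>2\<close> absorbs the nonlinearity as a
  supersolution, so that sums of translates of these functions trap \<open>u\<close> with relative error
  \<open>o(1)\<close>; an interior gradient estimate turns this into relative \<open>C\<^sup>1\<close> closeness.
\<close>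

section \<open>Directional derivatives and the maximum principle\<close>

text \<open>The peak hypothesis bounds an absolute error, whereas the gaps are visible only where
  \<open>u\<close> is exponentially small. It is therefore used only to make \<open>u\<close> small
  away from the peaks and to compare \<open>u\<close> with \<open>U\<close> on spheres of a fixed
  radius \<open>R\<close> about them: there \<open>U\<close> has a fixed positive value, so a small
  absolute error is a small relative one, and the maximum principle carries it outwards. The
  exponent 3/2 lies strictly between 1 and 2: for small \<open>U\<close> the correction is
  negligible against \<open>U\<close>, yet dominates the nonlinearity, which is at most quadratic as
  \<open>p\<close> is at least 2, and its Laplacian exceeds it by a fixed factor. Two truncations
  have to be cheap compared with \<open>Phi L\<close>, which may be as small as exp(-2 \<mu> L), up
  to constants, if exp(-\<mu> r) bounds \<open>U\<close> from below. Beyond the transversal distance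
  \<open>K * L\<close> only plain decay of \<open>u\<close> is known, so \<open>K\<close> grows
  linearly with \<mu>. The periodic copies of the peaks are cut off to a window whose margin is a
  fixed multiple of the gap. Both constants depend on \<open>U\<close> alone and are fixed before
  \<open>\<eta>\<close>.\<close>

definition dird :: "('a::real_normed_vector \<Rightarrow> real) \<Rightarrow> 'a \<Rightarrow> ('a \<Rightarrow> real) \<Rightarrow> bool" where
  "dird f v g \<longleftrightarrow> (\<forall>x. ((\<lambda>t. f (x + t *\<^sub>R v)) has_real_derivative g x) (at 0))"

lemma dird_at:
  assumes "dird f v g"
  shows "((\<lambda>t. f (x + t *\<^sub>R v)) has_real_derivative g (x + t *\<^sub>R v)) (at t)"
proof -
  have "((\<lambda>s. f ((x + t *\<^sub>R v) + s *\<^sub>R v)) has_real_derivative g (x + t *\<^sub>R v)) (at 0)"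
    using assms by (simp add: dird_def)
  then have "((\<lambda>s. f (x + (s + t) *\<^sub>R v)) has_real_derivative g (x + t *\<^sub>R v)) (at 0)"
    by (simp add: algebra_simps)
  then show ?thesis
    using DERIV_shift[of "\<lambda>t. f (x + t *\<^sub>R v)" _ 0 t] by simp
qed

section \<open>Calculus of directional derivatives\<close>

lemma dird_const: "dird (\<lambda>x. c) v (\<lambda>x. 0)"
  by (simp add: dird_def)

lemma dird_add: "dird f v f' \<Longrightarrow> dird g v g' \<Longrightarrow> dird (\<lambda>x. f x + g x) v (\<lambda>x. f' x + g' x)"
  by (auto simp: dird_def intro!: DERIV_add)

lemma dird_diff: "dird f v f' \<Longrightarrow> dird g v g' \<Longrightarrow> dird (\<lambda>x. f x - g x) v (\<lambda>x. f' x - g' x)"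
  by (auto simp: dird_def intro!: DERIV_diff)

lemma dird_cmult: "dird f v f' \<Longrightarrow> dird (\<lambda>x. c * f x) v (\<lambda>x. c * f' x)"
  by (auto simp: dird_def intro!: DERIV_cmult)

lemma dird_mult:
  "dird f v f' \<Longrightarrow> dird g v g' \<Longrightarrow> dird (\<lambda>x. f x * g x) v (\<lambda>x. f' x * g x + f x * g' x)"
  unfolding dird_def
proof
  fix x
  assume a: "\<forall>x. ((\<lambda>t. f (x + t *\<^sub>R v)) has_real_derivative f' x) (at 0)"
    "\<forall>x. ((\<lambda>t. g (x + t *\<^sub>R v)) has_real_derivative g' x) (at 0)"
  show "((\<lambda>t. f (x + t *\<^sub>R v) * g (x + t *\<^sub>R v)) has_real_derivative f' x * g x + f x * g' x) (at 0)"
    using DERIV_mult[OF a(1)[rule_format, of x] a(2)[rule_format, of x]] by (simp add: algebra_simps)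
qed

lemma dird_compose:
  assumes "dird f v f'" "\<And>x. (g has_real_derivative g' x) (at (f x))"
  shows "dird (\<lambda>x. g (f x)) v (\<lambda>x. g' x * f' x)"
  unfolding dird_def
proof
  fix x
  have "(g has_real_derivative g' x) (at (f (x + 0 *\<^sub>R v)))"
    using assms(2) by simp
  from DERIV_chain2[where f = g and g = "\<lambda>t. f (x + t *\<^sub>R v)", OF this] show "((\<lambda>t. g (f (x + t *\<^sub>R v))) has_real_derivative g' x * f' x) (at 0)"
    using assms(1) by (simp add: dird_def)
qed

lemma dird_translate: "dird f v f' \<Longrightarrow> dird (\<lambda>x. f (x - a)) v (\<lambda>x. f' (x - a))"
  by (simp add: dird_def diff_add_eq[symmetric])

lemma dird_inner: "dird (\<lambda>x. x \<bullet> e) v (\<lambda>x. v \<bullet> e)"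
  by (auto simp: dird_def inner_left_distrib intro!: derivative_eq_intros)

lemma dird_sum:
  "finite A \<Longrightarrow> (\<And>i. i \<in> A \<Longrightarrow> dird (f i) v (g i)) \<Longrightarrow>
     dird (\<lambda>x. \<Sum>i\<in>A. f i x) v (\<lambda>x. \<Sum>i\<in>A. g i x)"
  by (induction rule: finite_induct) (simp_all add: dird_const dird_add)

lemma dird_partial_deriv:
  assumes "f differentiable_on UNIV"
  shows "dird f v (partial_deriv v f)"
  unfolding dird_def
proof
  fix x
  have d: "(f has_derivative frechet_derivative f (at x)) (at x)"
    using assms by (simp add: differentiable_on_def frechet_derivative_works)
  have "((\<lambda>t. x + t *\<^sub>R v) has_derivative (\<lambda>t. t *\<^sub>R v)) (at 0)"
    by (auto intro!: derivative_eq_intros)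
  moreover have "(f has_derivative frechet_derivative f (at x)) (at (x + 0 *\<^sub>R v))"
    using d by simp
  ultimately have "((\<lambda>t. f (x + t *\<^sub>R v)) has_derivative (\<lambda>t. frechet_derivative f (at x) (t *\<^sub>R v))) (at 0)"
    by (rule has_derivative_compose)
  moreover have "(\<lambda>t. frechet_derivative f (at x) (t *\<^sub>R v)) = (*) (partial_deriv v f x)"
    using linear_cmul[OF has_derivative_linear[OF d]] by (auto simp: partial_deriv_def)
  ultimately show "((\<lambda>t. f (x + t *\<^sub>R v)) has_real_derivative partial_deriv v f x) (at 0)"
    by (simp add: has_field_derivative_def)
qed

text \<open>Only derivatives along coordinate lines are recorded, with no continuity asked of the
  second ones: this is all that a maximum principle inspects, and it is stable under reflections and
  compositions. The pure second derivatives stay hidden in \<open>H\<close>, since only their sum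
  matters.\<close>

definition has_lap ::
    "('a::euclidean_space \<Rightarrow> real) \<Rightarrow> ('a \<Rightarrow> 'a \<Rightarrow> real) \<Rightarrow> ('a \<Rightarrow> real) \<Rightarrow> bool" where
  "has_lap f G L \<longleftrightarrow> continuous_on UNIV f \<and>
     (\<exists>H. \<forall>b\<in>Basis. dird f b (G b) \<and> dird (G b) b (H b) \<and> L = (\<lambda>x. \<Sum>b\<in>Basis. H b x))"

lemma has_lapI:
  assumes "continuous_on UNIV f" "\<And>b. b \<in> Basis \<Longrightarrow> dird f b (G b)"
    "\<And>b. b \<in> Basis \<Longrightarrow> dird (G b) b (H b)" "\<And>x. L x = (\<Sum>b\<in>Basis. H b x)"
  shows "has_lap f G L"
  unfolding has_lap_def using assms by (intro conjI exI[of _ H]) auto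

lemma has_lapE:
  assumes "has_lap f G L"
  obtains H where "continuous_on UNIV f" "\<forall>b\<in>Basis. dird f b (G b)"
    "\<forall>b\<in>Basis. dird (G b) b (H b)" "\<forall>x. L x = (\<Sum>b\<in>Basis. H b x)"
  using assms SOME_Basis unfolding has_lap_def by auto

lemma has_lap_C2:
  assumes "C2 f"
  shows "has_lap f (\<lambda>b. partial_deriv b f) (laplacian f)"
proof (rule has_lapI[where H = "\<lambda>b. partial_deriv b (partial_deriv b f)"])
  show "continuous_on UNIV f"
    using assms by (simp add: C2_def differentiable_imp_continuous_on)
  fix b :: 'a assume "b \<in> Basis"
  then show "dird f b (partial_deriv b f)" "dird (partial_deriv b f) b (partial_deriv b (partial_deriv b f))"
    using assms by (simp_all add: C2_def dird_partial_deriv)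
qed (simp add: laplacian_def)

lemma has_lap_const: "has_lap (\<lambda>x. c) (\<lambda>b x. 0) (\<lambda>x. 0)"
  by (rule has_lapI[where H = "\<lambda>b x. 0"]) (auto intro: dird_const)

lemma has_lap_add:
  assumes "has_lap f F K" "has_lap g G L"
  shows "has_lap (\<lambda>x. f x + g x) (\<lambda>b x. F b x + G b x) (\<lambda>x. K x + L x)"
proof -
  obtain H where H: "continuous_on UNIV f" "\<forall>b\<in>Basis. dird f b (F b)"
    "\<forall>b\<in>Basis. dird (F b) b (H b)" "\<forall>x. K x = (\<Sum>b\<in>Basis. H b x)"
    using has_lapE[OF assms(1)] by blast
  obtain I where I: "continuous_on UNIV g" "\<forall>b\<in>Basis. dird g b (G b)"
    "\<forall>b\<in>Basis. dird (G b) b (I b)" "\<forall>x. L x = (\<Sum>b\<in>Basis. I b x)"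
    using has_lapE[OF assms(2)] by blast
  show ?thesis
  proof (rule has_lapI[where H = "\<lambda>b x. H b x + I b x"])
    fix b :: 'a assume b: "b \<in> Basis"
    show "dird (\<lambda>x. f x + g x) b (\<lambda>x. F b x + G b x)"
      using dird_add[OF H(2)[rule_format, OF b] I(2)[rule_format, OF b]] .
    show "dird (\<lambda>x. F b x + G b x) b (\<lambda>x. H b x + I b x)"
      using dird_add[OF H(3)[rule_format, OF b] I(3)[rule_format, OF b]] .
  next
    show "continuous_on UNIV (\<lambda>x. f x + g x)"
      using H(1) I(1) by (rule continuous_on_add)
    show "K x + L x = (\<Sum>b\<in>Basis. H b x + I b x)" for x
      using H(4) I(4) by (simp add: sum.distrib)
  qed
qed

lemma has_lap_cmult:
  assumes "has_lap f F K"
  shows "has_lap (\<lambda>x. c * f x) (\<lambda>b x. c * F b x) (\<lambda>x. c * K x)"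
proof -
  obtain H where H: "continuous_on UNIV f" "\<forall>b\<in>Basis. dird f b (F b)"
    "\<forall>b\<in>Basis. dird (F b) b (H b)" "\<forall>x. K x = (\<Sum>b\<in>Basis. H b x)"
    using has_lapE[OF assms(1)] by blast
  show ?thesis
  proof (rule has_lapI[where H = "\<lambda>b x. c * H b x"])
    fix b :: 'a assume b: "b \<in> Basis"
    show "dird (\<lambda>x. c * f x) b (\<lambda>x. c * F b x)"
      using dird_cmult[OF H(2)[rule_format, OF b]] .
    show "dird (\<lambda>x. c * F b x) b (\<lambda>x. c * H b x)"
      using dird_cmult[OF H(3)[rule_format, OF b]] .
  next
    show "continuous_on UNIV (\<lambda>x. c * f x)"
      using H(1) by (rule continuous_on_mult_left)
    show "c * K x = (\<Sum>b\<in>Basis. c * H b x)" for x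
      using H(4) by (simp add: sum_distrib_left)
  qed
qed

lemma has_lap_diff:
  assumes "has_lap f F K" "has_lap g G L"
  shows "has_lap (\<lambda>x. f x - g x) (\<lambda>b x. F b x - G b x) (\<lambda>x. K x - L x)"
  using has_lap_add[OF assms(1) has_lap_cmult[OF assms(2), of "-1"]] by simp

lemma has_lap_sum:
  assumes "finite A" "\<And>i. i \<in> A \<Longrightarrow> has_lap (f i) (F i) (K i)"
  shows "has_lap (\<lambda>x. \<Sum>i\<in>A. f i x) (\<lambda>b x. \<Sum>i\<in>A. F i b x) (\<lambda>x. \<Sum>i\<in>A. K i x)"
  using assms by (induction rule: finite_induct) (simp_all add: has_lap_const has_lap_add)

lemma has_lap_translate:
  assumes "has_lap f F K"
  shows "has_lap (\<lambda>x. f (x - a)) (\<lambda>b x. F b (x - a)) (\<lambda>x. K (x - a))"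
proof -
  obtain H where H: "continuous_on UNIV f" "\<forall>b\<in>Basis. dird f b (F b)"
    "\<forall>b\<in>Basis. dird (F b) b (H b)" "\<forall>x. K x = (\<Sum>b\<in>Basis. H b x)"
    using has_lapE[OF assms(1)] by blast
  show ?thesis
  proof (rule has_lapI[where H = "\<lambda>b x. H b (x - a)"])
    fix b :: 'a assume b: "b \<in> Basis"
    show "dird (\<lambda>x. f (x - a)) b (\<lambda>x. F b (x - a))"
      using dird_translate[OF H(2)[rule_format, OF b]] .
    show "dird (\<lambda>x. F b (x - a)) b (\<lambda>x. H b (x - a))"
      using dird_translate[OF H(3)[rule_format, OF b]] .
  next
    show "continuous_on UNIV (\<lambda>x. f (x - a))"
      by (rule continuous_on_compose2[OF H(1)]) (auto intro: continuous_on_diff continuous_on_id continuous_on_const)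
    show "K (x - a) = (\<Sum>b\<in>Basis. H b (x - a))" for x
      using H(4) by simp
  qed
qed

text \<open>Asking for derivatives of \<open>g\<close> only at values of \<open>f\<close> admits
  fractional powers of the positive function \<open>U\<close>.\<close>

lemma has_lap_compose:
  assumes "has_lap f F K"
    and g: "\<And>x. (g has_real_derivative g1 (f x)) (at (f x))"
    and g1: "\<And>x. (g1 has_real_derivative g2 (f x)) (at (f x))"
  shows "has_lap (\<lambda>x. g (f x)) (\<lambda>b x. g1 (f x) * F b x)
    (\<lambda>x. g1 (f x) * K x + g2 (f x) * (\<Sum>b\<in>Basis. (F b x)\<^sup>2))"
proof -
  obtain H where H: "continuous_on UNIV f" "\<forall>b\<in>Basis. dird f b (F b)"
    "\<forall>b\<in>Basis. dird (F b) b (H b)" "\<forall>x. K x = (\<Sum>b\<in>Basis. H b x)"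
    using has_lapE[OF assms(1)] by blast
  show ?thesis
  proof (rule has_lapI[where H = "\<lambda>b x. g2 (f x) * F b x * F b x + g1 (f x) * H b x"])
    fix b :: 'a assume b: "b \<in> Basis"
    show "dird (\<lambda>x. g (f x)) b (\<lambda>x. g1 (f x) * F b x)"
      using dird_compose[where g' = "\<lambda>x. g1 (f x)", OF H(2)[rule_format, OF b] g] .
    show "dird (\<lambda>x. g1 (f x) * F b x) b (\<lambda>x. g2 (f x) * F b x * F b x + g1 (f x) * H b x)"
      using dird_mult[OF dird_compose[where g' = "\<lambda>x. g2 (f x)", OF H(2)[rule_format, OF b] g1]
          H(3)[rule_format, OF b]] .
  next
    have "continuous_on (range f) g"
      using g by (metis (no_types, lifting) DERIV_isCont continuous_at_imp_continuous_on imageE)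
    then show "continuous_on UNIV (\<lambda>x. g (f x))"
      by (rule continuous_on_compose2[OF _ H(1)]) auto
    show "g1 (f x) * K x + g2 (f x) * (\<Sum>b\<in>Basis. (F b x)\<^sup>2) =
        (\<Sum>b\<in>Basis. g2 (f x) * F b x * F b x + g1 (f x) * H b x)" for x
      by (simp add: H(4) sum.distrib sum_distrib_left power2_eq_square mult.assoc)
  qed
qed

lemma has_lap_inner: "has_lap (\<lambda>x. x \<bullet> e) (\<lambda>b x. b \<bullet> e) (\<lambda>x. 0)"
  by (rule has_lapI[where H = "\<lambda>b x. 0"]) (auto intro!: continuous_intros dird_inner dird_const)

text \<open>For a unit vector \<open>e\<close> and l = 1/2 or -1/2 these are the solutions of
  \<Delta>h = h / 4 that serve as decay and wall barriers.\<close>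

lemma has_lap_exp_inner:
  "has_lap (\<lambda>x. exp (l * (x \<bullet> e))) (\<lambda>b x. l * exp (l * (x \<bullet> e)) * (b \<bullet> e))
     (\<lambda>x. l\<^sup>2 * (norm e)\<^sup>2 * exp (l * (x \<bullet> e)))"
proof -
  have "(\<Sum>b\<in>Basis. (b \<bullet> e)\<^sup>2) = (norm e)\<^sup>2"
    using euclidean_inner[of e e] by (simp add: power2_norm_eq_inner) (simp add: power2_eq_square inner_commute)
  moreover have "((\<lambda>s. exp (l * s)) has_real_derivative l * exp (l * s)) (at s)"
    "((\<lambda>s. l * exp (l * s)) has_real_derivative l\<^sup>2 * exp (l * s)) (at s)" for s
    by (auto intro!: derivative_eq_intros simp: power2_eq_square)
  note has_lap_compose[where g = "\<lambda>s. exp (l * s)", OF has_lap_inner[of e] this]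
  ultimately show ?thesis by (simp add: mult.assoc mult.commute[of "exp _"])
qed

lemma has_lap_norm_sq:
  fixes z :: "'a::euclidean_space"
  shows "has_lap (\<lambda>x. (norm (x - z))\<^sup>2) (\<lambda>b x. 2 * ((x - z) \<bullet> b)) (\<lambda>x. 2 * DIM('a))"
proof (rule has_lapI[where H = "\<lambda>b x. 2"])
  show "dird (\<lambda>x. (norm (x - z))\<^sup>2) b (\<lambda>x. 2 * ((x - z) \<bullet> b))" for b
  proof -
    have "(\<lambda>t. (norm (x + t *\<^sub>R b - z))\<^sup>2) = (\<lambda>t. (norm (x - z))\<^sup>2 + 2 * t * ((x - z) \<bullet> b) + t\<^sup>2 * (norm b)\<^sup>2)" for x
      unfolding power2_norm_eq_inner
      by (simp add: algebra_simps inner_commute power2_eq_square fun_eq_iff)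
    then show ?thesis by (auto simp: dird_def intro!: derivative_eq_intros)
  qed
  show "dird (\<lambda>x. 2 * ((x - z) \<bullet> b)) b (\<lambda>x. 2)" if "b \<in> Basis" for b
    using dird_cmult[OF dird_translate[OF dird_inner[of b b], of z], of 2] that by (simp add: inner_same_Basis)
qed (auto intro!: continuous_on_power continuous_on_norm continuous_on_diff continuous_on_id continuous_on_const)

text \<open>If \<open>h x\<close> were positive, the first derivative, which vanishes at the
  maximum, would be positive just beyond it and \<open>f\<close> would rise above
  \<open>f x\<close>; this works without continuity of \<open>h\<close>.\<close>

lemma second_derivative_nonpos:
  fixes f :: "'a::real_normed_vector \<Rightarrow> real"
  assumes "dird f v g" "dird g v h" "d > 0" "\<And>t. \<bar>t\<bar> < d \<Longrightarrow> f (x + t *\<^sub>R v) \<le> f x"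
  shows "h x \<le> 0"
proof (rule ccontr)
  assume "\<not> h x \<le> 0"
  have D: "((\<lambda>t. f (x + t *\<^sub>R v)) has_real_derivative g (x + t *\<^sub>R v)) (at t)" for t
    by (rule dird_at[OF assms(1)])
  have "g (x + 0 *\<^sub>R v) = 0"
    by (rule DERIV_local_max[OF D[of 0] \<open>d > 0\<close>]) (simp add: assms(4))
  moreover obtain c where c: "c > 0" "\<And>s. 0 < s \<Longrightarrow> s < c \<Longrightarrow> g (x + 0 *\<^sub>R v) < g (x + (0 + s) *\<^sub>R v)"
    using DERIV_pos_inc_right[OF dird_at[OF assms(2), of x 0]] \<open>\<not> h x \<le> 0\<close> by auto
  define s where "s = min c d / 2"
  have s: "0 < s" "s < c" "s < d" using c(1) \<open>d > 0\<close> by (auto simp: s_def)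
  have "f (x + 0 *\<^sub>R v) < f (x + s *\<^sub>R v)"
  proof (rule DERIV_pos_imp_increasing_open[OF s(1)])
    fix t assume "0 < t" "t < s"
    then have "g (x + t *\<^sub>R v) > 0" using c(2)[of t] s calculation by simp
    then show "\<exists>y. ((\<lambda>t. f (x + t *\<^sub>R v)) has_real_derivative y) (at t) \<and> 0 < y" using D by blast
  next
    show "continuous_on {0..s} (\<lambda>t. f (x + t *\<^sub>R v))"
      by (rule DERIV_continuous_on) (rule has_field_derivative_at_within[OF D])
  qed
  then show False using assms(4)[of s] s by simp
qed

text \<open>The third premise makes the positive maximum attained: on a bounded domain take \<open>y = x\<close>;
  otherwise use decay or periodicity.\<close>

lemma max_principle:
  fixes w :: "'a::euclidean_space \<Rightarrow> real"
  assumes lap: "has_lap w G L" and "closed S"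
    and att: "\<And>e. e > 0 \<Longrightarrow> \<exists>B. bounded B \<and> (\<forall>x\<in>S. w x \<ge> e \<longrightarrow> (\<exists>y\<in>S \<inter> B. w y = w x))"
    and pos: "\<And>x. x \<in> S \<Longrightarrow> w x > 0 \<Longrightarrow> x \<in> interior S \<and> L x > 0"
    and "x \<in> S"
  shows "w x \<le> 0"
proof (rule ccontr)
  assume neg: "\<not> w x \<le> 0"
  obtain H where *: "continuous_on UNIV w" "\<forall>b\<in>Basis. dird w b (G b)"
    "\<forall>b\<in>Basis. dird (G b) b (H b)" "\<forall>x. L x = (\<Sum>b\<in>Basis. H b x)"
    using has_lapE[OF lap] by (smt (verit, best))
  obtain B where B: "bounded B" "\<And>z. z \<in> S \<Longrightarrow> w z \<ge> w x \<Longrightarrow> \<exists>y\<in>S \<inter> B. w y = w z"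
    using att[of "w x"] neg by (metis not_le)
  \<comment> \<open>By \<open>att\<close> every value of at least \<open>w x\<close> on
    \<open>S\<close> is also taken inside \<open>B\<close>, so the maximum over this compact set is
    the maximum over \<open>S\<close>.\<close>
  define K where "K = S \<inter> closure B \<inter> {y. w x \<le> w y}"
  have "closed {y. w x \<le> w y}" by (intro closed_Collect_le * continuous_intros)
  then have "compact K"
    unfolding K_def using \<open>closed S\<close> B(1)
    by (metis Int_assoc closed_Int compact_Int_closed compact_closure inf_commute)
  moreover have "K \<noteq> {}"
    using B(2)[OF \<open>x \<in> S\<close>] closure_subset[of B] by (force simp: K_def)
  ultimately obtain z where z: "z \<in> K" "\<And>y. y \<in> K \<Longrightarrow> w y \<le> w z"
    using continuous_attains_sup[of K w] continuous_on_subset[OF *(1), of K] by (metis subset_UNIV)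
  have max: "w y \<le> w z" if "y \<in> S" for y
  proof (cases "w y \<ge> w x")
    case True
    then obtain y' where "y' \<in> S \<inter> B" "w y' = w y" using B(2)[OF \<open>y \<in> S\<close> True] by blast
    then show ?thesis using z(2)[of y'] True closure_subset[of B] by (auto simp: K_def)
  qed (use z(1) in \<open>auto simp: K_def\<close>)
  have "z \<in> S" "w x \<le> w z" using z(1) by (simp_all add: K_def)
  then have "w z > 0" using neg by linarith
  then have "z \<in> interior S" "L z > 0" using pos[OF \<open>z \<in> S\<close>] by simp_all
  obtain e where e: "e > 0" "ball z e \<subseteq> S"
    using \<open>z \<in> interior S\<close> by (meson mem_interior)
  have "L z = (\<Sum>b\<in>Basis. H b z)" using *(4) by simp
  also have "\<dots> \<le> 0"
  proof (rule sum_nonpos)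
    fix b :: 'a assume b: "b \<in> Basis"
    show "H b z \<le> 0"
    proof (rule second_derivative_nonpos[OF *(2)[rule_format, OF b] *(3)[rule_format, OF b] e(1)])
      fix t :: real assume "\<bar>t\<bar> < e"
      then have "z + t *\<^sub>R b \<in> ball z e" using b by (simp add: dist_norm)
      then show "w (z + t *\<^sub>R b) \<le> w z" using e(2) max by blast
    qed
  qed
  finally show False using \<open>L z > 0\<close> by simp
qed

section \<open>Interior gradient estimate\<close>

text \<open>\<open>r\<close> is the reflection in the hyperplane through \<open>x\<close> orthogonal
  to \<open>b\<close>. Being an isometry it preserves the Laplacian; only the derivative along
  \<open>b\<close> changes sign.\<close>

lemma has_lap_reflect:
  fixes x b :: "'a::euclidean_space"
  defines "r \<equiv> \<lambda>y. y - (2 * ((y - x) \<bullet> b)) *\<^sub>R b"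
  assumes "has_lap w G L" "b \<in> Basis"
  shows "has_lap (\<lambda>y. w (r y)) (\<lambda>c y. (if c = b then -1 else 1) * G c (r y)) (\<lambda>y. L (r y))"
proof -
  obtain H where H: "continuous_on UNIV w" "\<forall>b\<in>Basis. dird w b (G b)"
    "\<forall>b\<in>Basis. dird (G b) b (H b)" "\<forall>x. L x = (\<Sum>b\<in>Basis. H b x)"
    using has_lapE[OF assms(2)] by blast
  define s where "s = (\<lambda>c. if c = b then -1 else (1::real))"
  have D: "dird (\<lambda>y. f (r y)) c (\<lambda>y. s c * f' (r y))" if f: "dird f c f'" and "c \<in> Basis" for f f' c
    unfolding dird_def
  proof
    fix y
    have eq: "r (y + t *\<^sub>R c) = r y + (s c * t) *\<^sub>R c" for t
      using that \<open>b \<in> Basis\<close>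
      by (auto simp: r_def s_def algebra_simps inner_Basis simp flip: scaleR_2)
    have "((\<lambda>t. f (r y + t *\<^sub>R c)) has_real_derivative f' (r y)) (at (s c * 0))"
      using f by (simp add: dird_def)
    moreover have "((\<lambda>t. s c * t) has_real_derivative s c) (at 0)"
      by (auto intro!: derivative_eq_intros)
    ultimately have "((\<lambda>t. f (r y + (s c * t) *\<^sub>R c)) has_real_derivative f' (r y) * s c) (at 0)"
      by (rule DERIV_chain2)
    then show "((\<lambda>t. f (r (y + t *\<^sub>R c))) has_real_derivative s c * f' (r y)) (at 0)"
      by (simp add: eq mult.commute)
  qed
  show ?thesis
  proof (rule has_lapI[where H = "\<lambda>c y. H c (r y)"])
    show "continuous_on UNIV (\<lambda>y. w (r y))"
      by (rule continuous_on_compose2[OF H(1)]) (auto simp: r_def intro!: continuous_intros)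
    fix c :: 'a assume c: "c \<in> Basis"
    show "dird (\<lambda>y. w (r y)) c (\<lambda>y. (if c = b then -1 else 1) * G c (r y))"
      using D[OF H(2)[rule_format, OF c] c] by (simp add: s_def)
    have "dird (\<lambda>y. s c * G c (r y)) c (\<lambda>y. s c * (s c * H c (r y)))"
      by (rule dird_cmult) (rule D[OF H(3)[rule_format, OF c] c])
    then show "dird (\<lambda>y. (if c = b then -1 else 1) * G c (r y)) c (\<lambda>y. H c (r y))"
      by (simp add: s_def split: if_splits)
  qed (simp add: H(4))
qed

lemma Basis_sum_inner_sq:
  fixes b :: "'a::euclidean_space"
  assumes "b \<in> Basis"
  shows "(\<Sum>c\<in>Basis. (c \<bullet> b)\<^sup>2) = 1"
proof -
  have "(\<Sum>c\<in>Basis. (c \<bullet> b)\<^sup>2) = (\<Sum>c\<in>Basis. if c = b then 1 else 0)"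
    by (rule sum.cong) (auto simp: inner_Basis assms)
  then show ?thesis using assms by simp
qed

text \<open>The odd part of \<open>w\<close> in the direction \<open>b\<close> vanishes on the hyperplane through \<open>x\<close>; comparing it
  with a quadratic barrier on half of the cube bounds its slope at \<open>x\<close>.\<close>

lemma gradient_bound_aux:
  fixes w :: "'a::euclidean_space \<Rightarrow> real" and M K d :: real
  assumes lap: "has_lap w G L" and b: "b \<in> Basis" and d: "d > 0"
    and bd: "\<And>y. (\<And>c. c \<in> Basis \<Longrightarrow> \<bar>(y - x) \<bullet> c\<bar> \<le> d) \<Longrightarrow> \<bar>w y\<bar> \<le> M \<and> \<bar>L y\<bar> < K"
  shows "G b x \<le> DIM('a) * M / d + K * d / 2"
proof -
  define r where "r = (\<lambda>y. y - (2 * ((y - x) \<bullet> b)) *\<^sub>R b)"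
  \<comment> \<open>Chosen such that \<Delta>h is the constant \<open>- K\<close>, while the
    quadratic term of \<open>h\<close> alone reaches \<open>M\<close> on the outer faces of the
    cube.\<close>
  define A where "A = DIM('a) * M / d\<^sup>2 + K / 2"
  define h where "h = (\<lambda>y. M / d\<^sup>2 * (norm (y - x))\<^sup>2 + A * (d * ((y - x) \<bullet> b) - ((y - x) \<bullet> b)\<^sup>2))"
  define v where "v = (\<lambda>y. 1 / 2 * (w y - w (r y)))"
  define Q where "Q = (\<Inter>c\<in>Basis. {y. \<bar>(y - x) \<bullet> c\<bar> \<le> d})"
  define S where "S = {y. 0 \<le> (y - x) \<bullet> b} \<inter> Q"
  have Q: "\<bar>w y\<bar> \<le> M" "\<bar>L y\<bar> < K" if "y \<in> Q" for y
    using bd[of y] that by (auto simp: Q_def)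
  have "x \<in> Q" using d by (simp add: Q_def)
  then have M0: "0 \<le> M" and K0: "0 \<le> K" using Q[of x] by linarith+
  then have A0: "A \<ge> 0" by (simp add: A_def)
  have rQ: "r y \<in> Q" if "y \<in> Q" for y
  proof -
    have "\<bar>(r y - x) \<bullet> c\<bar> = \<bar>(y - x) \<bullet> c\<bar>" if "c \<in> Basis" for c
      using b that by (cases "c = b") (auto simp: r_def algebra_simps inner_Basis)
    then show ?thesis using that by (simp add: Q_def)
  qed
  have g: "((\<lambda>s. A * (d * s - s\<^sup>2)) has_real_derivative A * (d - 2 * s)) (at s)"
    "((\<lambda>s. A * (d - 2 * s)) has_real_derivative - 2 * A) (at s)" for s
    by (auto intro!: derivative_eq_intros simp: algebra_simps)
  have lh: "has_lap h (\<lambda>c y. M / d\<^sup>2 * (2 * ((y - x) \<bullet> c)) + A * (d - 2 * ((y - x) \<bullet> b)) * (c \<bullet> b)) (\<lambda>y. - K)"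
  proof -
    have "M / d\<^sup>2 * real (2 * DIM('a)) - 2 * A = - K" by (simp add: A_def)
    then show ?thesis
      using has_lap_add[OF has_lap_cmult[OF has_lap_norm_sq[of x], of "M / d\<^sup>2"]
          has_lap_compose[OF has_lap_translate[OF has_lap_inner[of b], of x],
            where g = "\<lambda>s. A * (d * s - s\<^sup>2)", OF g]]
      by (simp add: h_def Basis_sum_inner_sq[OF b])
  qed
  have lv: "has_lap (\<lambda>y. v y - h y) (\<lambda>c y. 1 / 2 * (G c y - (if c = b then -1 else 1) * G c (r y))
      - (M / d\<^sup>2 * (2 * ((y - x) \<bullet> c)) + A * (d - 2 * ((y - x) \<bullet> b)) * (c \<bullet> b)))
      (\<lambda>y. 1 / 2 * (L y - L (r y)) - - K)"
    unfolding v_def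
    using has_lap_diff[OF has_lap_cmult[OF has_lap_diff[OF lap has_lap_reflect[OF lap b, of x]], of "1/2"] lh]
    by (simp add: r_def)
  have small: "v y - h y \<le> 0" if "y \<in> S" for y
  proof (rule max_principle[OF lv _ _ _ that])
    show "closed S"
      unfolding S_def Q_def by (intro closed_Int closed_INT ballI closed_Collect_le continuous_intros)
    have "bounded S"
    proof -
      have "norm (y - x) \<le> DIM('a) * d" if "y \<in> S" for y
      proof -
        have "norm (y - x) \<le> (\<Sum>c\<in>Basis. \<bar>(y - x) \<bullet> c\<bar>)" by (rule norm_le_l1)
        also have "\<dots> \<le> (\<Sum>c\<in>(Basis::'a set). d)"
          by (rule sum_mono) (use that in \<open>auto simp: S_def Q_def\<close>)
        finally show ?thesis by simp
      qed
      then have "S \<subseteq> cball x (DIM('a) * d)" by (auto simp: dist_norm norm_minus_commute)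
      then show ?thesis by (rule bounded_subset[OF bounded_cball])
    qed
    then show "\<exists>B. bounded B \<and> (\<forall>x\<in>S. e \<le> v x - h x \<longrightarrow> (\<exists>y\<in>S \<inter> B. v y - h y = v x - h x))" for e
      by (intro exI[of _ S]) auto
    fix y assume y: "y \<in> S" "v y - h y > 0"
    have yQ: "y \<in> Q" "0 \<le> (y - x) \<bullet> b" "(y - x) \<bullet> b \<le> d"
      using y(1) b by (auto simp: S_def Q_def)
    have vM: "v y \<le> M" using Q(1)[OF yQ(1)] Q(1)[OF rQ[OF yQ(1)]] by (simp add: v_def)
    have h2: "M / d\<^sup>2 * (norm (y - x))\<^sup>2 \<le> h y"
    proof -
      have "0 \<le> A * (((y - x) \<bullet> b) * (d - (y - x) \<bullet> b))" using yQ A0 by simp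
      then have "0 \<le> A * (d * ((y - x) \<bullet> b) - ((y - x) \<bullet> b)\<^sup>2)"
        by (simp only: power2_eq_square right_diff_distrib mult.commute)
      then show ?thesis by (simp add: h_def)
    qed
    have "(y - x) \<bullet> b \<noteq> 0"
    proof
      assume "(y - x) \<bullet> b = 0"
      then have "v y = 0" by (simp add: v_def r_def)
      moreover have "0 \<le> M / d\<^sup>2 * (norm (y - x))\<^sup>2" using M0 by simp
      ultimately show False using y(2) h2 by linarith
    qed
    moreover have "\<bar>(y - x) \<bullet> c\<bar> < d" if "c \<in> Basis" for c
    proof (rule ccontr)
      assume "\<not> \<bar>(y - x) \<bullet> c\<bar> < d"
      then have "d \<le> norm (y - x)" using Basis_le_norm[OF that, of "y - x"] by linarith
      then have "d\<^sup>2 \<le> (norm (y - x))\<^sup>2" using d by (simp add: power_mono)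
      then have "M / d\<^sup>2 * d\<^sup>2 \<le> M / d\<^sup>2 * (norm (y - x))\<^sup>2" using M0 by (intro mult_left_mono) auto
      then show False using vM h2 y(2) d by simp
    qed
    ultimately have "y \<in> {y. 0 < (y - x) \<bullet> b} \<inter> (\<Inter>c\<in>Basis. {y. \<bar>(y - x) \<bullet> c\<bar> < d})" (is "_ \<in> ?O")
      using yQ(2) by simp
    moreover have "open ?O"
      by (intro open_Int open_INT finite_Basis ballI open_Collect_less continuous_intros)
    moreover have "?O \<subseteq> S" by (auto simp: S_def Q_def less_imp_le)
    ultimately have "y \<in> interior S" by (meson interior_maximal subset_eq)
    moreover have "1 / 2 * (L y - L (r y)) - - K > 0"
    proof -
      have "- K < L y" "L (r y) < K" using Q(2)[OF yQ(1)] Q(2)[OF rQ[OF yQ(1)]] by (simp_all add: abs_less_iff)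
      then show ?thesis by (simp add: field_simps)
    qed
    ultimately show "y \<in> interior S \<and> 1 / 2 * (L y - L (r y)) - - K > 0" ..
  qed
  \<comment> \<open>Along the ray from \<open>x\<close> in direction \<open>b\<close> the difference
    of \<open>v\<close> and \<open>h\<close> starts at 0 and stays nonpositive, so its slope
    \<open>G b x - A * d\<close> is nonpositive.\<close>
  define F where "F = (\<lambda>t. v (x + t *\<^sub>R b) - h (x + t *\<^sub>R b))"
  define E where "E = G b x - A * d"
  have "\<forall>c\<in>Basis. dird (\<lambda>y. v y - h y) c (\<lambda>y. 1 / 2 * (G c y - (if c = b then -1 else 1) * G c (r y))
      - (M / d\<^sup>2 * (2 * ((y - x) \<bullet> c)) + A * (d - 2 * ((y - x) \<bullet> b)) * (c \<bullet> b)))"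
    using has_lapE[OF lv] by blast
  note this[rule_format, OF b]
  from dird_at[OF this, of x 0] have "(F has_real_derivative E) (at 0)"
    using b by (simp add: F_def E_def r_def)
  moreover have "F 0 = 0" by (simp add: F_def v_def h_def r_def)
  moreover have "F t \<le> 0" if "0 < t" "t < d" for t
  proof -
    have "x + t *\<^sub>R b \<in> S" using that b by (auto simp: S_def Q_def inner_Basis)
    then show ?thesis using small by (simp add: F_def)
  qed
  ultimately have "E \<le> 0"
  proof -
    assume F: "(F has_real_derivative E) (at 0)" "F 0 = 0" "\<And>t. 0 < t \<Longrightarrow> t < d \<Longrightarrow> F t \<le> 0"
    show "E \<le> 0"
    proof (rule ccontr)
      assume "\<not> E \<le> 0"
      then obtain c where c: "c > 0" "\<And>s. 0 < s \<Longrightarrow> s < c \<Longrightarrow> F 0 < F (0 + s)"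
        using DERIV_pos_inc_right[OF F(1)] by auto
      define s where "s = min c d / 2"
      have "0 < s" "s < c" "s < d" using c(1) d by (auto simp: s_def)
      then show False using c(2)[of s] F(2) F(3)[of s] by simp
    qed
  qed
  then show ?thesis using d by (simp add: E_def A_def power2_eq_square algebra_simps)
qed

lemma gradient_bound:
  fixes w :: "'a::euclidean_space \<Rightarrow> real" and M K d :: real
  assumes lap: "has_lap w G L" and b: "b \<in> Basis" and d: "d > 0"
    and bd: "\<And>y. (\<And>c. c \<in> Basis \<Longrightarrow> \<bar>(y - x) \<bullet> c\<bar> \<le> d) \<Longrightarrow> \<bar>w y\<bar> \<le> M \<and> \<bar>L y\<bar> < K"
  shows "\<bar>G b x\<bar> \<le> DIM('a) * M / d + K * d / 2"
proof -
  have "-1 * G b x \<le> DIM('a) * M / d + K * d / 2"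
    by (rule gradient_bound_aux[OF has_lap_cmult[OF lap] b d]) (use bd in simp)
  moreover have "G b x \<le> DIM('a) * M / d + K * d / 2"
    by (rule gradient_bound_aux[OF lap b d bd])
  ultimately show ?thesis by simp
qed

text \<open>The cube of half-side \<open>1 / DIM('a)\<close> fits into the unit ball because the
  norm is at most the sum of the moduli of the coordinates. Taking \<open>K = 2 * M\<close> supplies
  the strict inequality for the Laplacian.\<close>

lemma gradient_bound_ball:
  fixes w :: "'a::euclidean_space \<Rightarrow> real" and M :: real
  assumes lap: "has_lap w G L" and b: "b \<in> Basis" and "M > 0"
    and bd: "\<And>y. norm (y - x) \<le> 1 \<Longrightarrow> \<bar>w y\<bar> \<le> M \<and> \<bar>L y\<bar> \<le> M"
  shows "\<bar>G b x\<bar> \<le> (DIM('a) * DIM('a) + 1) * M"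
proof -
  have D: "real DIM('a) \<ge> 1" using DIM_positive[where 'a = 'a] by linarith
  have "\<bar>G b x\<bar> \<le> DIM('a) * M / (1 / DIM('a)) + (2 * M) * (1 / DIM('a)) / 2"
  proof (rule gradient_bound[OF lap b, where M = M and d = "1 / DIM('a)" and K = "2 * M"])
    fix y assume y: "\<And>c. c \<in> Basis \<Longrightarrow> \<bar>(y - x) \<bullet> c\<bar> \<le> 1 / DIM('a)"
    have "norm (y - x) \<le> (\<Sum>c\<in>Basis. \<bar>(y - x) \<bullet> c\<bar>)" by (rule norm_le_l1)
    also have "\<dots> \<le> (\<Sum>c\<in>(Basis::'a set). 1 / DIM('a))" by (rule sum_mono) (rule y)
    also have "\<dots> = 1" by simp
    finally show "\<bar>w y\<bar> \<le> M \<and> \<bar>L y\<bar> < 2 * M" using bd[of y] \<open>M > 0\<close> by auto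
  qed (use D in simp)
  also have "\<dots> = DIM('a) * DIM('a) * M + M / DIM('a)" by simp
  also have "M / DIM('a) \<le> M" using D \<open>M > 0\<close> by (simp add: divide_le_eq)
  finally show ?thesis by (simp add: algebra_simps)
qed

section \<open>The ground state\<close>

text \<open>This is how the lower bound on \<open>p\<close> makes the nonlinearity at most quadratic
  in small quantities; the smallness estimates for \<open>u\<close> and \<open>U\<close> rest on
  it.\<close>

lemma powr_le_sq:
  fixes s p :: real
  assumes "0 \<le> s" "s \<le> 1" "2 \<le> p"
  shows "s powr p \<le> s\<^sup>2"
  using powr_mono'[of 2 p s] assms by (simp add: powr_numeral)

section \<open>The ground state: monotonicity, decay, Harnack inequality, gradient\<close>

locale ground =
  fixes p :: real and U :: "'a::euclidean_space \<Rightarrow> real"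
  assumes p2: "2 \<le> p" and gs: "ground_state p U"
begin

lemma U_lap: "has_lap U (\<lambda>b. partial_deriv b U) (\<lambda>x. U x - U x powr p)"
proof -
  have "laplacian U = (\<lambda>x. U x - U x powr p)"
  proof
    fix x show "laplacian U x = U x - U x powr p"
      using gs unfolding ground_state_def by (metis add.commute add_diff_cancel_left' diff_0_right diff_diff_eq2 uminus_add_conv_diff)
  qed
  then show ?thesis using has_lap_C2[of U] gs by (simp add: ground_state_def)
qed

lemma U_pos: "U x > 0"
  using gs by (simp add: ground_state_def)

lemma U_nonneg: "U x \<ge> 0"
  using U_pos[of x] by simp

lemma U_cont: "continuous_on A U"
  using U_lap continuous_on_subset unfolding has_lap_def by blast

lemma U_mono: "norm x \<le> norm y \<Longrightarrow> U y \<le> U x"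
proof -
  assume le: "norm x \<le> norm y"
  obtain \<phi> where f: "\<forall>x. U x = \<phi> (norm x)" "strict_antimono_on {0..} \<phi>"
    using gs unfolding ground_state_def by blast
  show ?thesis
  proof (cases "norm x = norm y")
    case False
    then have "\<phi> (norm y) < \<phi> (norm x)"
      using le f(2) by (auto simp: monotone_on_def)
    then show ?thesis using f(1) by simp
  qed (simp add: f(1))
qed

lemma U_small:
  assumes "e > 0"
  obtains R where "R > 0" "\<And>x. R \<le> norm x \<Longrightarrow> U x \<le> e"
proof -
  obtain \<phi> where f: "\<forall>x. U x = \<phi> (norm x)" "(\<phi> \<longlongrightarrow> 0) at_top"
    using gs unfolding ground_state_def by blast
  have "eventually (\<lambda>r. \<phi> r < e) at_top"
    using f(2) assms by (rule order_tendstoD(2))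
  then obtain R where "\<And>r. R \<le> r \<Longrightarrow> \<phi> r < e" by (auto simp: eventually_at_top_linorder)
  then show thesis using that[of "max R 1"] f(1) by (simp add: less_imp_le)
qed

lemma U_bounded_superlevel:
  assumes "e > 0"
  shows "\<exists>B. bounded B \<and> (\<forall>x. U x \<ge> e \<longrightarrow> x \<in> B)"
proof -
  obtain R where R: "\<And>x. R \<le> norm x \<Longrightarrow> U x \<le> e / 2"
    using U_small[of "e / 2"] assms by auto
  have "x \<in> cball 0 R" if "U x \<ge> e" for x
    using R[of x] that assms by fastforce
  then show ?thesis using bounded_cball by blast
qed

lemma U_powr_le: "U x \<le> e \<Longrightarrow> e \<le> 1 \<Longrightarrow> U x powr p \<le> e * U x"
proof -
  assume "U x \<le> e" "e \<le> 1"
  then have "U x powr p \<le> (U x)\<^sup>2" using U_nonneg p2 by (intro powr_le_sq) auto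
  also have "\<dots> \<le> e * U x" using \<open>U x \<le> e\<close> U_nonneg by (simp add: power2_eq_square mult_right_mono)
  finally show ?thesis .
qed

text \<open>Comparison with a plain exponential on a half-space whose normal \<open>v\<close> points
  to \<open>y\<close>, instead of a radial barrier outside a ball: no first-order term appears, and
  on the boundary plane \<open>U z \<le> U x\<close> by monotonicity. The rate 1/2 only has to
  satisfy (1/2)^2 < 1/2, because \<Delta>U \<ge> U / 2 once U \<le> 1/2.\<close>

lemma U_decay:
  obtains R where "R > 0"
    "\<And>x y. R \<le> norm x \<Longrightarrow> norm x \<le> norm y \<Longrightarrow> U y \<le> exp (- (norm y - norm x) / 2) * U x"
proof -
  obtain R where R: "R > 0" "\<And>x. R \<le> norm x \<Longrightarrow> U x \<le> 1 / 2"
    using U_small[of "1 / 2"] by auto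
  have main: "U y \<le> exp (- (norm y - norm x) / 2) * U x" if x: "R \<le> norm x" and xy: "norm x \<le> norm y" for x y
  proof -
    define v where "v = (1 / norm y) *\<^sub>R y"
    have ny: "norm y > 0" using x xy R(1) by linarith
    then have nv: "norm v = 1" "v \<noteq> 0" "y \<bullet> v = norm y"
      by (auto simp: v_def power2_norm_eq_inner[symmetric] power2_eq_square)
    define C where "C = U x * exp (norm x / 2)"
    define S where "S = {z. v \<bullet> z \<ge> norm x}"
    have lap: "has_lap (\<lambda>z. U z - C * exp (- (1 / 2) * (z \<bullet> v)))
        (\<lambda>b z. partial_deriv b U z - C * (- (1 / 2) * exp (- (1 / 2) * (z \<bullet> v)) * (b \<bullet> v)))
        (\<lambda>z. U z - U z powr p - C * (1 / 4 * exp (- (1 / 2) * (z \<bullet> v))))"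
      using has_lap_diff[OF U_lap has_lap_cmult[OF has_lap_exp_inner[of "- (1 / 2)" v]]] nv(1)
      by (simp add: power2_eq_square)
    have "U y - C * exp (- (1 / 2) * (y \<bullet> v)) \<le> 0"
    proof (rule max_principle[OF lap, where S = S])
      show "closed S" unfolding S_def by (rule closed_halfspace_ge)
      show "y \<in> S" using nv(3) xy by (simp add: S_def inner_commute)
      have C0: "C \<ge> 0" by (simp add: C_def U_nonneg)
      show "\<exists>B. bounded B \<and> (\<forall>z\<in>S. e \<le> U z - C * exp (- (1 / 2) * (z \<bullet> v)) \<longrightarrow>
          (\<exists>z'\<in>S \<inter> B. U z' - C * exp (- (1 / 2) * (z' \<bullet> v)) = U z - C * exp (- (1 / 2) * (z \<bullet> v))))"
        if e: "e > 0" for e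
      proof -
        obtain B where B: "bounded B" "\<And>z. U z \<ge> e \<Longrightarrow> z \<in> B"
          using U_bounded_superlevel[OF e] by blast
        have "z \<in> B" if "e \<le> U z - C * exp (- (1 / 2) * (z \<bullet> v))" for z
        proof -
          have "0 \<le> C * exp (- (1 / 2) * (z \<bullet> v))" using C0 by simp
          then show ?thesis using B(2)[of z] that by linarith
        qed
        then show ?thesis using B(1) by (intro exI[of _ B]) blast
      qed
      fix z assume z: "z \<in> S" "U z - C * exp (- (1 / 2) * (z \<bullet> v)) > 0"
      have "z \<bullet> v \<le> norm z * norm v" by (rule norm_cauchy_schwarz)
      then have zv: "norm x \<le> z \<bullet> v" "norm x \<le> norm z"
        using z(1) nv(1) by (auto simp: S_def inner_commute)
      have "z \<bullet> v \<noteq> norm x"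
      proof
        assume "z \<bullet> v = norm x"
        then have "C * exp (- (1 / 2) * (z \<bullet> v)) = U x" by (simp add: C_def mult.assoc exp_add[symmetric])
        then show False using z(2) U_mono[OF zv(2)] by simp
      qed
      then have "z \<in> interior S"
        using zv(1) unfolding S_def interior_halfspace_ge[OF nv(2)] by (simp add: inner_commute)
      moreover have "U z powr p \<le> 1 / 2 * U z"
        by (rule U_powr_le) (use R(2)[of z] x zv(2) in auto)
      ultimately show "z \<in> interior S \<and> U z - U z powr p - C * (1 / 4 * exp (- (1 / 2) * (z \<bullet> v))) > 0"
        using z(2) U_pos[of z] by simp
    qed
    then have "U y \<le> C * exp (- (1 / 2) * norm y)" using nv(3) by simp
    also have "\<dots> = exp (- (norm y - norm x) / 2) * U x"
      by (simp add: C_def mult.assoc exp_add[symmetric] mult.commute diff_divide_distrib)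
    finally show ?thesis .
  qed
  show thesis by (rule that[OF R(1) main])
qed

lemma has_lap_gauss:
  fixes z :: "'b::euclidean_space"
  shows "has_lap (\<lambda>x. exp (- m * (norm (x - z))\<^sup>2))
    (\<lambda>b x. - m * exp (- m * (norm (x - z))\<^sup>2) * (2 * ((x - z) \<bullet> b)))
    (\<lambda>x. (4 * m\<^sup>2 * (norm (x - z))\<^sup>2 - 2 * m * DIM('b)) * exp (- m * (norm (x - z))\<^sup>2))"
proof -
  have "(\<Sum>b\<in>Basis. (2 * ((x - z) \<bullet> b))\<^sup>2) = 4 * (norm (x - z))\<^sup>2" for x
    using euclidean_inner[of "x - z" "x - z"]
    by (simp add: power_mult_distrib sum_distrib_left[symmetric] power2_norm_eq_inner) (simp add: power2_eq_square)
  moreover have "((\<lambda>s. exp (- m * s)) has_real_derivative - m * exp (- m * s)) (at s)"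
    "((\<lambda>s. - m * exp (- m * s)) has_real_derivative m\<^sup>2 * exp (- m * s)) (at s)" for s
    by (auto intro!: derivative_eq_intros simp: power2_eq_square)
  note has_lap_compose[where g = "\<lambda>s. exp (- m * s)", OF has_lap_norm_sq[of z] this]
  ultimately show ?thesis by (simp add: algebra_simps)
qed

text \<open>The lower barrier is a Gaussian about \<open>z\<close> minus its value at distance 3, on
  the annulus of radii 1 and 3. The inner sphere lies in the closed ball of radius
  \<open>norm y\<close>, where \<open>U\<close> is at least \<open>U y\<close>; on the outer sphere
  the barrier is 0; the point \<open>x'\<close> of norm \<open>norm y + 1\<close> has distance 2
  from \<open>z\<close>. Monotonicity extends the bound from \<open>x'\<close> to every admissible
  \<open>x\<close>.\<close>

lemma U_harnack:
  obtains c where "0 < c" "c < 1"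
    "\<And>x y. 1 \<le> norm y \<Longrightarrow> norm x \<le> norm y + 1 \<Longrightarrow> c * U y \<le> U x"
proof -
  \<comment> \<open>With the dimension as exponent, the factor in the Laplacian of the Gaussian is
    at least 2 m^2 at distances of at least 1, hence at least 1: the barrier is a subsolution of
    \<Delta>h = h.\<close>
  define m where "m = real DIM('a)"
  have m: "m \<ge> 1" using DIM_positive[where 'a = 'a] unfolding m_def by linarith
  define c where "c = exp (- m * 4) - exp (- m * 9)"
  have c: "0 < c" "c < 1"
  proof -
    show "0 < c" using m by (simp add: c_def)
    have "exp (- m * 4) \<le> 1" "exp (- m * 9) > 0" using m by simp_all
    then show "c < 1" unfolding c_def by linarith
  qed
  have main: "c * U y \<le> U x" if y: "1 \<le> norm y" and xy: "norm x \<le> norm y + 1" for x y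
  proof -
    define e where "e = (SOME i::'a. i \<in> Basis)"
    have e: "norm e = 1" by (simp add: e_def SOME_Basis)
    define z where "z = (norm y - 1) *\<^sub>R e"
    define x' where "x' = (norm y + 1) *\<^sub>R e"
    have nz: "norm z = norm y - 1" using y e by (simp add: z_def)
    have "x' - z = 2 *\<^sub>R e" by (simp add: x'_def z_def algebra_simps scaleR_2)
    then have xz: "norm (x' - z) = 2" using e by simp
    define S where "S = cball z 3 - ball z 1"
    define h where "h = (\<lambda>q. U y * (exp (- m * (norm (q - z))\<^sup>2) - exp (- m * 9)))"
    have lap: "has_lap (\<lambda>q. h q - U q)
       (\<lambda>b q. U y * (- m * exp (- m * (norm (q - z))\<^sup>2) * (2 * ((q - z) \<bullet> b))) - partial_deriv b U q)
       (\<lambda>q. U y * ((4 * m\<^sup>2 * (norm (q - z))\<^sup>2 - 2 * m * m) * exp (- m * (norm (q - z))\<^sup>2)) - (U q - U q powr p))"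
      using has_lap_diff[OF has_lap_cmult[OF has_lap_diff[OF has_lap_gauss[of m z] has_lap_const[of "exp (- m * 9)"]], of "U y"] U_lap]
      by (simp add: h_def m_def)
    have "h x' - U x' \<le> 0"
    proof (rule max_principle[OF lap, where S = S])
      show "closed S" unfolding S_def by (intro closed_Diff closed_cball open_ball)
      show "x' \<in> S" using xz by (simp add: S_def dist_norm norm_minus_commute)
      have "bounded S" unfolding S_def by (rule bounded_subset[OF bounded_cball]) auto
      then show "\<exists>B. bounded B \<and> (\<forall>q\<in>S. e \<le> h q - U q \<longrightarrow> (\<exists>q'\<in>S \<inter> B. h q' - U q' = h q - U q))" for e
        by (intro exI[of _ S]) auto
      fix q assume q: "q \<in> S" "h q - U q > 0"
      have d: "1 \<le> norm (q - z)" "norm (q - z) \<le> 3"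
        using q(1) by (auto simp: S_def dist_norm norm_minus_commute)
      have d1: "norm (q - z) \<noteq> 1"
      proof
        assume d1: "norm (q - z) = 1"
        have "norm q \<le> norm z + norm (q - z)" by (rule norm_triangle_sub)
        then have "U y \<le> U q" using d1 nz by (intro U_mono) simp
        moreover have "h q \<le> U y * 1" unfolding h_def
        proof (rule mult_left_mono)
          have "exp (- m * (norm (q - z))\<^sup>2) \<le> 1" using m by simp
          moreover have "0 < exp (- m * 9)" by simp
          ultimately show "exp (- m * (norm (q - z))\<^sup>2) - exp (- m * 9) \<le> 1" by linarith
        qed (rule U_nonneg)
        ultimately show False using q(2) by simp
      qed
      have d3: "norm (q - z) \<noteq> 3"
      proof
        assume "norm (q - z) = 3"
        then have "h q = 0" by (simp add: h_def)
        then show False using q(2) U_pos[of q] by simp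
      qed
      have "q \<in> ball z 3 - cball z 1" using d d1 d3 by (simp add: dist_norm norm_minus_commute)
      moreover have "open (ball z 3 - cball z 1)" by (intro open_Diff open_ball closed_cball)
      moreover have "ball z 3 - cball z 1 \<subseteq> S" by (auto simp: S_def)
      ultimately have "q \<in> interior S" by (meson interior_maximal subset_eq)
      moreover have "U y * exp (- m * (norm (q - z))\<^sup>2) \<le>
          U y * ((4 * m\<^sup>2 * (norm (q - z))\<^sup>2 - 2 * m * m) * exp (- m * (norm (q - z))\<^sup>2))"
      proof (rule mult_left_mono)
        have "1 \<le> m\<^sup>2" using m by (simp add: one_le_power)
        moreover have "m\<^sup>2 * 1 \<le> m\<^sup>2 * (norm (q - z))\<^sup>2"
          using d(1) by (intro mult_left_mono) (auto simp: one_le_power)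
        ultimately have "1 \<le> 4 * m\<^sup>2 * (norm (q - z))\<^sup>2 - 2 * m * m" by (simp add: power2_eq_square)
        then show "exp (- m * (norm (q - z))\<^sup>2) \<le> (4 * m\<^sup>2 * (norm (q - z))\<^sup>2 - 2 * m * m) * exp (- m * (norm (q - z))\<^sup>2)"
          by simp
      qed (rule U_nonneg)
      moreover have "h q \<le> U y * exp (- m * (norm (q - z))\<^sup>2)"
        unfolding h_def by (rule mult_left_mono) (auto simp: U_nonneg)
      moreover have "U q powr p > 0" using U_pos[of q] by simp
      ultimately show "q \<in> interior S \<and> U y * ((4 * m\<^sup>2 * (norm (q - z))\<^sup>2 - 2 * m * m) * exp (- m * (norm (q - z))\<^sup>2)) - (U q - U q powr p) > 0"
        using q(2) by linarith
    qed
    moreover have "h x' = c * U y" by (simp add: h_def xz c_def)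
    moreover have "U x' \<le> U x" using xy y e by (intro U_mono) (simp add: x'_def)
    ultimately show ?thesis by simp
  qed
  show thesis by (rule that[OF c main])
qed

text \<open>Each unit of radius costs one Harnack factor \<open>c\<close>, whence
  \<open>m = - ln c\<close>. The truncation errors are measured against this crude bound.\<close>

lemma U_lower:
  obtains c m where "c > 0" "m > 0" "\<And>x. c * exp (- m * norm x) \<le> U x"
proof -
  obtain c where c: "0 < c" "c < 1" "\<And>x y. 1 \<le> norm y \<Longrightarrow> norm x \<le> norm y + 1 \<Longrightarrow> c * U y \<le> U x"
    using U_harnack by blast
  define e where "e = (SOME i::'a. i \<in> Basis)"
  have e: "norm e = 1" by (simp add: e_def SOME_Basis)
  have ind: "c ^ n * U e \<le> U x" if "norm x \<le> real n + 1" for n x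
    using that
  proof (induction n arbitrary: x)
    case 0
    then show ?case using U_mono[of x e] e by simp
  next
    case (Suc n)
    define y where "y = (real n + 1) *\<^sub>R e"
    have ny: "norm y = real n + 1" using e by (simp add: y_def)
    have "c * (c ^ n * U e) \<le> c * U y" using Suc.IH[of y] ny c(1) by simp
    also have "\<dots> \<le> U x" by (rule c(3)) (use ny Suc.prems in auto)
    finally show ?case by simp
  qed
  define m where "m = - ln c"
  have "c * U e * exp (- m * norm x) \<le> U x" for x
  proof -
    define n where "n = nat \<lceil>norm x\<rceil>"
    have n: "norm x \<le> real n" "real n \<le> norm x + 1" using norm_ge_zero[of x] unfolding n_def by linarith+
    have "c * exp (- m * norm x) = c powr (norm x + 1)"
      using c(1) by (simp add: m_def powr_def exp_add distrib_right)
    also have "\<dots> \<le> c powr real n" using c n by (intro powr_mono') auto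
    also have "\<dots> = c ^ n" using c(1) by (simp add: powr_realpow)
    finally have "c * exp (- m * norm x) * U e \<le> c ^ n * U e" by (intro mult_right_mono U_nonneg)
    also have "\<dots> \<le> U x" using ind n(1) by simp
    finally show ?thesis by (simp add: mult_ac)
  qed
  moreover have "c * U e > 0" "m > 0" using c U_pos by (auto simp: m_def)
  ultimately show thesis using that by blast
qed

text \<open>Harnack's inequality bounds \<open>U\<close> on the unit ball about \<open>x\<close> by
  \<open>U x / c\<close>, which makes the interior gradient estimate a relative one.\<close>

lemma U_gradient:
  obtains R C where "R > 0" "C > 0"
    "\<And>x b. b \<in> Basis \<Longrightarrow> R \<le> norm x \<Longrightarrow> \<bar>partial_deriv b U x\<bar> \<le> C * U x"
proof -
  obtain c where c: "0 < c" "c < 1" "\<And>x y. 1 \<le> norm y \<Longrightarrow> norm x \<le> norm y + 1 \<Longrightarrow> c * U y \<le> U x"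
    using U_harnack by blast
  obtain R where R: "R > 0" "\<And>x. R \<le> norm x \<Longrightarrow> U x \<le> 1"
    using U_small[of 1] by auto
  define C where "C = (DIM('a) * DIM('a) + 1) / c"
  have C0: "C > 0" using c(1) by (simp add: C_def add_nonneg_pos)
  have "\<bar>partial_deriv b U x\<bar> \<le> C * U x" if b: "b \<in> Basis" and x: "R + 2 \<le> norm x" for x b
  proof -
    have "\<bar>partial_deriv b U x\<bar> \<le> (DIM('a) * DIM('a) + 1) * (U x / c)"
    proof (rule gradient_bound_ball[OF U_lap b])
      show "U x / c > 0" using c(1) U_pos by simp
      fix y assume y: "norm (y - x) \<le> 1"
      have n: "norm x \<le> norm y + 1" "R + 1 \<le> norm y"
        using norm_triangle_sub[of x y] y x by (simp_all add: norm_minus_commute)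
      then have "c * U y \<le> U x" using R(1) by (intro c(3)) auto
      then have 1: "U y \<le> U x / c" using c(1) by (simp add: field_simps)
      have "U y powr p \<le> 1 * U y" by (rule U_powr_le) (use R(2)[of y] n in auto)
      then show "\<bar>U y\<bar> \<le> U x / c \<and> \<bar>U y - U y powr p\<bar> \<le> U x / c"
        using 1 U_nonneg[of y] powr_ge_zero[of "U y" p] by (intro conjI) linarith+
    qed
    then show ?thesis by (simp add: C_def)
  qed
  then show thesis using that[of "R + 2" C] C0 R(1) by simp
qed

text \<open>\<open>g\<close> is the radial derivative. Far out it is nonpositive and nondecreasing:
  a step orthogonal to the ray increases the norm, so the tangential second derivatives are
  nonpositive, and the radial one is at least \<Delta>U = U - U^p \<ge> 0.\<close>

lemma U_radial_gradient:
  obtains R g where "R > 0"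
    "\<And>x b. b \<in> Basis \<Longrightarrow> x \<noteq> 0 \<Longrightarrow> partial_deriv b U x = (x \<bullet> b) / norm x * g (norm x)"
    "\<And>r s. R \<le> r \<Longrightarrow> r \<le> s \<Longrightarrow> \<bar>g s\<bar> \<le> \<bar>g r\<bar>"
proof -
  define e where "e = (SOME i::'a. i \<in> Basis)"
  have eB: "e \<in> Basis" by (simp add: e_def SOME_Basis)
  then have e: "norm e = 1" by simp
  define g where "g = (\<lambda>r. partial_deriv e U (r *\<^sub>R e))"
  obtain H where H: "\<forall>b\<in>Basis. dird U b (partial_deriv b U)"
    "\<forall>b\<in>Basis. dird (partial_deriv b U) b (H b)" "\<forall>x. U x - U x powr p = (\<Sum>b\<in>Basis. H b x)"
    by (rule has_lapE[OF U_lap], rule that)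
  have ray: "((\<lambda>r. U (r *\<^sub>R e)) has_real_derivative g r) (at r)" for r
    using dird_at[OF H(1)[rule_format, OF eB], of 0 r] by (simp add: g_def)
  have rad: "U x = U (norm x *\<^sub>R e)" for x
    using U_mono[of x "norm x *\<^sub>R e"] U_mono[of "norm x *\<^sub>R e" x] e by simp
  have 1: "partial_deriv b U x = (x \<bullet> b) / norm x * g (norm x)" if b: "b \<in> Basis" and x: "x \<noteq> 0" for x b
  proof -
    have n: "norm (x + t *\<^sub>R b) = sqrt ((norm x)\<^sup>2 + 2 * t * (x \<bullet> b) + t\<^sup>2)" for t
      using b by (simp add: norm_eq_sqrt_inner algebra_simps inner_commute power2_eq_square)
    have "((\<lambda>t. (norm x)\<^sup>2 + 2 * t * (x \<bullet> b) + t\<^sup>2) has_real_derivative 2 * (x \<bullet> b)) (at 0)"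
      by (auto intro!: derivative_eq_intros)
    moreover have "(sqrt has_real_derivative inverse (norm x) / 2)
        (at ((norm x)\<^sup>2 + 2 * 0 * (x \<bullet> b) + 0\<^sup>2))"
      using DERIV_real_sqrt[of "(norm x)\<^sup>2"] x by simp
    ultimately have "((\<lambda>t. norm (x + t *\<^sub>R b)) has_real_derivative inverse (norm x) / 2 * (2 * (x \<bullet> b))) (at 0)"
      unfolding n by (rule DERIV_chain2[where f = sqrt, rotated])
    moreover have "inverse (norm x) / 2 * (2 * (x \<bullet> b)) = (x \<bullet> b) / norm x"
      using x by (simp add: field_simps)
    ultimately have "((\<lambda>t. norm (x + t *\<^sub>R b)) has_real_derivative (x \<bullet> b) / norm x) (at 0)"
      by simp
    moreover have "((\<lambda>r. U (r *\<^sub>R e)) has_real_derivative g (norm x)) (at (norm (x + 0 *\<^sub>R b)))"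
      using ray[of "norm x"] by simp
    ultimately have "((\<lambda>t. U (norm (x + t *\<^sub>R b) *\<^sub>R e)) has_real_derivative g (norm x) * ((x \<bullet> b) / norm x)) (at 0)"
      by (intro DERIV_chain2[where f = "\<lambda>r. U (r *\<^sub>R e)" and g = "\<lambda>t. norm (x + t *\<^sub>R b)"])
    then have "((\<lambda>t. U (x + t *\<^sub>R b)) has_real_derivative g (norm x) * ((x \<bullet> b) / norm x)) (at 0)"
      by (simp only: rad[symmetric])
    moreover have "((\<lambda>t. U (x + t *\<^sub>R b)) has_real_derivative partial_deriv b U x) (at 0)"
      using H(1) b by (simp add: dird_def)
    ultimately have "g (norm x) * ((x \<bullet> b) / norm x) = partial_deriv b U x"
      by (rule DERIV_unique)
    then show ?thesis by (simp add: mult.commute)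
  qed
  obtain R where R: "R > 0" "\<And>x. R \<le> norm x \<Longrightarrow> U x \<le> 1 / 2"
    using U_small[of "1 / 2"] by auto
  have g_deriv: "\<exists>d. (g has_real_derivative d) (at r) \<and> 0 \<le> d" if r: "R \<le> r" for r
  proof (intro exI conjI)
    show "(g has_real_derivative H e (r *\<^sub>R e)) (at r)"
      using dird_at[OF H(2)[rule_format, OF eB], of 0 r] by (simp add: g_def)
    have "H c (r *\<^sub>R e) \<le> 0" if c: "c \<in> Basis - {e}" for c
    proof (rule second_derivative_nonpos[OF H(1)[rule_format] H(2)[rule_format], where d = 1])
      show "U (r *\<^sub>R e + t *\<^sub>R c) \<le> U (r *\<^sub>R e)" for t
      proof (rule U_mono)
        have "orthogonal (r *\<^sub>R e) (t *\<^sub>R c)"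
          using c eB by (auto simp: orthogonal_def inner_Basis)
        then have "(norm (r *\<^sub>R e))\<^sup>2 \<le> (norm (r *\<^sub>R e + t *\<^sub>R c))\<^sup>2"
          by (simp add: norm_add_Pythagorean)
        then show "norm (r *\<^sub>R e) \<le> norm (r *\<^sub>R e + t *\<^sub>R c)"
          by (simp add: power2_le_iff_abs_le)
      qed
    qed (use c in simp_all)
    then have "(\<Sum>c\<in>Basis - {e}. H c (r *\<^sub>R e)) \<le> 0" by (rule sum_nonpos)
    moreover have "(\<Sum>c\<in>Basis. H c (r *\<^sub>R e)) = H e (r *\<^sub>R e) + (\<Sum>c\<in>Basis - {e}. H c (r *\<^sub>R e))"
      using eB by (simp add: sum.remove)
    moreover have "U (r *\<^sub>R e) powr p \<le> 1 / 2 * U (r *\<^sub>R e)"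
      by (rule U_powr_le) (use R r e in auto)
    ultimately show "0 \<le> H e (r *\<^sub>R e)" using H(3)[rule_format, of "r *\<^sub>R e"] U_pos[of "r *\<^sub>R e"] by linarith
  qed
  have 2: "g r \<le> g s" if "R \<le> r" "r \<le> s" for r s
  proof (rule DERIV_nonneg_imp_nondecreasing[OF that(2)])
    fix q assume "r \<le> q"
    then show "\<exists>d. (g has_real_derivative d) (at q) \<and> 0 \<le> d" using that(1) by (intro g_deriv) simp
  qed
  have 3: "g r \<le> 0" if "R \<le> r" for r
  proof (rule ccontr)
    assume "\<not> g r \<le> 0"
    then obtain d where d: "d > 0" "\<And>h. 0 < h \<Longrightarrow> h < d \<Longrightarrow> U (r *\<^sub>R e) < U ((r + h) *\<^sub>R e)"
      using DERIV_pos_inc_right[OF ray[of r]] by auto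
    have "U ((r + d / 2) *\<^sub>R e) \<le> U (r *\<^sub>R e)"
      by (rule U_mono) (use R(1) that d(1) e in auto)
    then show False using d(2)[of "d / 2"] d(1) by simp
  qed
  have 4: "\<bar>g s\<bar> \<le> \<bar>g r\<bar>" if "R \<le> r" "r \<le> s" for r s
    using 2[OF that] 3[of r] 3[of s] that by simp
  show thesis
  proof (rule that[of R g])
    show "R > 0" by (rule R(1))
    show "partial_deriv b U x = (x \<bullet> b) / norm x * g (norm x)" if "b \<in> Basis" "x \<noteq> 0" for x b
      using 1 that .
    show "\<bar>g s\<bar> \<le> \<bar>g r\<bar>" if "R \<le> r" "r \<le> s" for r s
      using 4 that .
  qed
qed

text \<open>With the components in \<open>B\<close> fixed, both factors of (x \<bullet> b) / |x| and
  g(|x|) shrink in modulus as the norm grows. \<open>B\<close> will consist of the directions along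
  a slice, whose coordinates do not change when the slice moves outwards.\<close>

lemma U_transversal_gradient_mono:
  obtains R where "R > 0"
    "\<And>x y B. B \<subseteq> Basis \<Longrightarrow> R \<le> norm x \<Longrightarrow> norm x \<le> norm y \<Longrightarrow> (\<And>b. b \<in> B \<Longrightarrow> x \<bullet> b = y \<bullet> b) \<Longrightarrow>
       (\<Sum>b\<in>B. (partial_deriv b U y)\<^sup>2) \<le> (\<Sum>b\<in>B. (partial_deriv b U x)\<^sup>2)"
proof -
  obtain R g where R: "R > 0"
    "\<And>x b. b \<in> Basis \<Longrightarrow> x \<noteq> 0 \<Longrightarrow> partial_deriv b U x = (x \<bullet> b) / norm x * g (norm x)"
    "\<And>r s. R \<le> r \<Longrightarrow> r \<le> s \<Longrightarrow> \<bar>g s\<bar> \<le> \<bar>g r\<bar>"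
    using U_radial_gradient by blast
  have "(\<Sum>b\<in>B. (partial_deriv b U y)\<^sup>2) \<le> (\<Sum>b\<in>B. (partial_deriv b U x)\<^sup>2)"
    if B: "B \<subseteq> Basis" and xy: "R \<le> norm x" "norm x \<le> norm y" "\<And>b. b \<in> B \<Longrightarrow> x \<bullet> b = y \<bullet> b" for x y B
  proof (rule sum_mono)
    fix b assume b: "b \<in> B"
    have "x \<noteq> 0" "y \<noteq> 0" using xy R(1) by auto
    then have eq: "partial_deriv b U x = (x \<bullet> b) / norm x * g (norm x)"
      "partial_deriv b U y = (x \<bullet> b) / norm y * g (norm y)"
      using R(2) b B xy(3)[OF b] by auto
    have "\<bar>(x \<bullet> b) / norm y\<bar> \<le> \<bar>(x \<bullet> b) / norm x\<bar>"
      using xy(1,2) R(1) \<open>x \<noteq> 0\<close> \<open>y \<noteq> 0\<close> unfolding abs_divide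
      by (intro divide_left_mono mult_pos_pos) simp_all
    then have "\<bar>(x \<bullet> b) / norm y * g (norm y)\<bar> \<le> \<bar>(x \<bullet> b) / norm x * g (norm x)\<bar>"
      unfolding abs_mult by (intro mult_mono R(3)[OF xy(1,2)]) simp_all
    then show "(partial_deriv b U y)\<^sup>2 \<le> (partial_deriv b U x)\<^sup>2"
      unfolding eq by (simp only: abs_le_square_iff)
  qed
  with that[OF R(1)] show thesis .
qed

end

section \<open>Comparison with sums of ground states\<close>

context ground
begin

definition "Uq x = U x powr (3 / 2)"

lemma Uq_pos: "Uq x > 0"
  using U_pos[of x] by (simp add: Uq_def)

lemma Uq_eq: "Uq x = U x * sqrt (U x)"
  using U_pos[of x] powr_add[of "U x" 1 "1 / 2"] by (simp add: Uq_def powr_half_sqrt)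

lemma Uq_le: "U x \<le> s\<^sup>2 \<Longrightarrow> 0 \<le> s \<Longrightarrow> Uq x \<le> s * U x"
proof -
  assume "U x \<le> s\<^sup>2" "0 \<le> s"
  then have "sqrt (U x) \<le> s" by (simp add: real_le_lsqrt U_nonneg)
  then have "U x * sqrt (U x) \<le> U x * s" using U_nonneg[of x] by (rule mult_left_mono)
  then show ?thesis by (simp add: Uq_eq mult.commute)
qed

text \<open>The form in which the correction absorbs the nonlinearity: U^p \<le> U^2 is a small
  multiple of \<open>Uq\<close>.\<close>

lemma U_sq_le_Uq: "U x \<le> s\<^sup>2 \<Longrightarrow> 0 \<le> s \<Longrightarrow> (U x)\<^sup>2 \<le> s * Uq x"
proof -
  assume "U x \<le> s\<^sup>2" "0 \<le> s"
  then have "sqrt (U x) \<le> s" by (simp add: real_le_lsqrt U_nonneg)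
  then have "Uq x * sqrt (U x) \<le> Uq x * s" using Uq_pos[of x] by (simp add: mult_left_mono)
  moreover have "Uq x * sqrt (U x) = (U x)\<^sup>2"
    using U_nonneg[of x] by (simp add: Uq_eq mult.assoc power2_eq_square)
  ultimately show ?thesis by (simp add: mult.commute)
qed

text \<open>The gradient term of the chain rule is nonnegative and is dropped; U \<le> 1/6 leaves
  the factor 3/2 * 5/6 = 5/4. Its surplus of 1/4 over the linear equation pays for the nonlinear
  terms.\<close>

lemma Uq_lap:
  obtains G L where "has_lap Uq G L" "\<And>x. U x \<le> 1 / 6 \<Longrightarrow> 5 / 4 * Uq x \<le> L x"
proof -
  have g: "((\<lambda>s. s powr (3 / 2)) has_real_derivative 3 / 2 * U x powr (1 / 2)) (at (U x))"
    "((\<lambda>s. 3 / 2 * s powr (1 / 2)) has_real_derivative 3 / 4 * U x powr (- 1 / 2)) (at (U x))" for x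
    using U_pos[of x] by (auto intro!: derivative_eq_intros simp: powr_diff field_simps)
  define L where "L = (\<lambda>x. 3 / 2 * U x powr (1 / 2) * (U x - U x powr p) +
    3 / 4 * U x powr (- 1 / 2) * (\<Sum>b\<in>Basis. (partial_deriv b U x)\<^sup>2))"
  have lap: "has_lap Uq (\<lambda>b x. 3 / 2 * U x powr (1 / 2) * partial_deriv b U x) L"
    unfolding Uq_def L_def by (rule has_lap_compose[OF U_lap, where g = "\<lambda>s. s powr (3 / 2)", OF g])
  have "5 / 4 * Uq x \<le> L x" if "U x \<le> 1 / 6" for x
  proof -
    have "U x powr p \<le> 1 / 6 * U x" by (rule U_powr_le) (use that in auto)
    then have "sqrt (U x) * (5 / 6 * U x) \<le> sqrt (U x) * (U x - U x powr p)"
      by (intro mult_left_mono) (auto simp: U_nonneg)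
    moreover have "0 \<le> 3 / 4 * U x powr (- 1 / 2) * (\<Sum>b\<in>Basis. (partial_deriv b U x)\<^sup>2)"
      by (intro mult_nonneg_nonneg sum_nonneg) auto
    moreover have "L x = 3 / 2 * (sqrt (U x) * (U x - U x powr p)) +
        3 / 4 * U x powr (- 1 / 2) * (\<Sum>b\<in>Basis. (partial_deriv b U x)\<^sup>2)"
      using U_nonneg[of x] by (simp add: L_def powr_half_sqrt mult.assoc)
    ultimately have "3 / 2 * (sqrt (U x) * (5 / 6 * U x)) \<le> L x" by linarith
    then show ?thesis by (simp add: Uq_eq mult.commute)
  qed
  then show thesis using lap that by blast
qed

text \<open>Outside the balls \<open>V\<close> satisfies \<Delta>V \<ge> V, while \<Delta>u \<le> u.
  So this comparison is linear, the nonlinearity of \<open>u\<close> has the favourable sign, and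
  two peaks suffice because further ones only raise \<open>u\<close>. The value 1/16 = (1/4)^2 is
  where U^2 \<le> Uq / 4.\<close>

lemma lower_comparison:
  fixes u :: "'a \<Rightarrow> real" and a R :: real
  assumes lap: "has_lap u G (\<lambda>x. u x - u x powr p)" and u0: "\<And>x. u x \<ge> 0"
    and R: "\<And>x. R \<le> norm x \<Longrightarrow> U x \<le> 1 / 16" and a: "a > 0"
    and bd: "\<And>x. R \<le> norm (x - z1) \<Longrightarrow> R \<le> norm (x - z2) \<Longrightarrow> norm (x - z1) = R \<or> norm (x - z2) = R \<Longrightarrow>
      a * (U (x - z1) + Uq (x - z1) + (U (x - z2) + Uq (x - z2))) \<le> u x"
    and x: "R \<le> norm (x - z1)" "R \<le> norm (x - z2)"
  shows "a * (U (x - z1) + U (x - z2)) \<le> u x"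
proof -
  obtain Gq Lq where q: "has_lap Uq Gq Lq" "\<And>x. U x \<le> 1 / 6 \<Longrightarrow> 5 / 4 * Uq x \<le> Lq x"
    using Uq_lap by blast
  define V where "V = (\<lambda>x. a * (U (x - z1) + Uq (x - z1) + (U (x - z2) + Uq (x - z2))))"
  define M where "M = (\<lambda>x. U x - U x powr p + Lq x)"
  define S where "S = - (ball z1 R \<union> ball z2 R)"
  have S: "x \<in> S \<longleftrightarrow> R \<le> norm (x - z1) \<and> R \<le> norm (x - z2)" for x
    by (auto simp: S_def dist_norm norm_minus_commute)
  have l1: "has_lap (\<lambda>x. U x + Uq x) (\<lambda>b x. partial_deriv b U x + Gq b x) M"
    unfolding M_def by (rule has_lap_add[OF U_lap q(1)])
  have lapw: "has_lap (\<lambda>x. V x - u x)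
     (\<lambda>b x. a * (partial_deriv b U (x - z1) + Gq b (x - z1) + (partial_deriv b U (x - z2) + Gq b (x - z2))) - G b x)
     (\<lambda>x. a * (M (x - z1) + M (x - z2)) - (u x - u x powr p))"
    unfolding V_def
    by (rule has_lap_diff[OF has_lap_cmult[OF has_lap_add[OF has_lap_translate[OF l1] has_lap_translate[OF l1]]] lap])
  have M: "U x + Uq x \<le> M x" if "R \<le> norm x" for x
  proof -
    have "U x \<le> (1 / 4)\<^sup>2" using R[OF that] by (simp add: power2_eq_square)
    then have "(U x)\<^sup>2 \<le> 1 / 4 * Uq x" by (rule U_sq_le_Uq) simp
    moreover have "U x powr p \<le> (U x)\<^sup>2" using R[OF that] U_nonneg[of x] p2 by (intro powr_le_sq) auto
    moreover have "5 / 4 * Uq x \<le> Lq x" using R[OF that] by (intro q(2)) simp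
    ultimately show ?thesis by (simp add: M_def)
  qed
  have "V x - u x \<le> 0"
  proof (rule max_principle[OF lapw, where S = S])
    show "closed S" unfolding S_def by (auto intro!: closed_Compl open_Un)
    show "x \<in> S" using x S by simp
    show "\<exists>B. bounded B \<and> (\<forall>x\<in>S. e \<le> V x - u x \<longrightarrow> (\<exists>y\<in>S \<inter> B. V y - u y = V x - u x))" if e: "e > 0" for e
    proof -
      \<comment> \<open>Outside both translates of \<open>B\<close> each of the four terms of the
        sum is at most \<open>d\<close>, so \<open>V\<close> stays below \<open>e\<close>
        there.\<close>
      define d where "d = min 1 (e / (8 * a))"
      have d: "d > 0" "d \<le> 1" "4 * a * d < e" using e a by (auto simp: d_def min_def field_simps)
      obtain B where B: "bounded B" "\<And>x. U x \<ge> d \<Longrightarrow> x \<in> B"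
        using U_bounded_superlevel[OF d(1)] by blast
      define B' where "B' = (+) z1 ` B \<union> (+) z2 ` B"
      have "y \<in> B'" if "e \<le> V y - u y" for y
      proof (rule ccontr)
        assume "y \<notin> B'"
        then have "y - z1 \<notin> B" "y - z2 \<notin> B" unfolding B'_def
          by (metis UnCI diff_add_cancel image_eqI add.commute)+
        then have *: "U (y - z1) \<le> d" "U (y - z2) \<le> d" using B(2) by force+
        then have "Uq (y - z1) \<le> 1 * U (y - z1)" "Uq (y - z2) \<le> 1 * U (y - z2)"
          using d(2) by (auto intro!: Uq_le[of _ 1, simplified])
        then have "U (y - z1) + Uq (y - z1) + (U (y - z2) + Uq (y - z2)) \<le> 4 * d" using * by linarith
        then have "V y \<le> a * (4 * d)" unfolding V_def using a by (intro mult_left_mono) auto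
        then show False using that d(3) u0[of y] by (simp add: mult_ac)
      qed
      moreover have "bounded B'" unfolding B'_def
        using bounded_translation[OF B(1)] by simp
      ultimately show ?thesis by (intro exI[of _ B']) blast
    qed
    fix y assume y: "y \<in> S" "V y - u y > 0"
    have n: "norm (y - z1) \<noteq> R" "norm (y - z2) \<noteq> R"
      using bd[of y] y S by (auto simp: V_def)
    then have "y \<in> - (cball z1 R \<union> cball z2 R)" using y(1) by (auto simp: S dist_norm norm_minus_commute)
    moreover have "open (- (cball z1 R \<union> cball z2 R))" by (auto intro!: open_Compl closed_Un)
    moreover have "- (cball z1 R \<union> cball z2 R) \<subseteq> S" by (auto simp: S_def)
    ultimately have "y \<in> interior S" by (meson interior_maximal subset_eq)
    moreover have "V y \<le> a * (M (y - z1) + M (y - z2))"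
      unfolding V_def using y(1) M a S by (intro mult_left_mono add_mono) auto
    moreover have "0 \<le> u y powr p" by simp
    ultimately show "y \<in> interior S \<and> a * (M (y - z1) + M (y - z2)) - (u y - u y powr p) > 0"
      using y(2) by linarith
  qed
  moreover have "a * (U (x - z1) + U (x - z2)) \<le> V x"
    unfolding V_def using a Uq_pos[of "x - z1"] Uq_pos[of "x - z2"] by (intro mult_left_mono) auto
  ultimately show ?thesis by simp
qed

text \<open>The exponential terms solve \<open>\<Delta>h = h / 4\<close> and are at least \<open>\<eta>\<close> on the walls \<open>\<bar>x \<bullet> e\<bar> = W\<close>; they
  replace the infinitely many translates of \<open>U\<close> centered outside the window.\<close>

lemma upper_comparison:
  fixes u :: "'a \<Rightarrow> real" and J :: "'a set" and s a \<eta> W R :: real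
  assumes lap: "has_lap u G (\<lambda>x. u x - u x powr p)" and u0: "\<And>x. u x \<ge> 0"
    and J: "finite J" and e: "norm e = 1" and s: "0 < s" "64 * card J * s \<le> 1"
    and R: "\<And>x. R \<le> norm x \<Longrightarrow> U x \<le> min (1 / 6) (s\<^sup>2)"
    and a: "1 \<le> a" "a \<le> 2" and \<eta>: "0 < \<eta>" "\<eta> \<le> 3 / 32"
    and S: "S = {x. \<bar>x \<bullet> e\<bar> \<le> W \<and> (\<forall>c\<in>J. R \<le> norm (x - c))}"
    and att: "\<And>d. d > 0 \<Longrightarrow> bounded {x \<in> S. d \<le> u x}"
    and small: "\<And>x. x \<in> S \<Longrightarrow> u x \<le> \<eta>"
    and bd: "\<And>x c. x \<in> S \<Longrightarrow> c \<in> J \<Longrightarrow> norm (x - c) = R \<Longrightarrow> u x \<le> a * (U (x - c) - Uq (x - c))"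
    and x: "x \<in> S"
  shows "u x \<le> a * (\<Sum>c\<in>J. U (x - c)) + \<eta> * (exp ((x \<bullet> e - W) / 2) + exp ((- (x \<bullet> e) - W) / 2))"
proof -
  obtain Gq Lq where q: "has_lap Uq Gq Lq" "\<And>x. U x \<le> 1 / 6 \<Longrightarrow> 5 / 4 * Uq x \<le> Lq x"
    using Uq_lap by blast
  define M where "M = (\<lambda>x. U x - U x powr p - Lq x)"
  define h where "h = (\<lambda>x. \<eta> * exp (- W / 2) * (exp (1 / 2 * (x \<bullet> e)) + exp (- (1 / 2) * (x \<bullet> e))))"
  define V where "V = (\<lambda>x. a * (\<Sum>c\<in>J. U (x - c) - Uq (x - c)) + h x)"
  have l1: "has_lap (\<lambda>x. U x - Uq x) (\<lambda>b x. partial_deriv b U x - Gq b x) M"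
    unfolding M_def by (rule has_lap_diff[OF U_lap q(1)])
  obtain Gh where lh: "has_lap h Gh (\<lambda>x. h x / 4)"
    using has_lap_cmult[OF has_lap_add[OF has_lap_exp_inner[of "1 / 2" e] has_lap_exp_inner[of "- (1 / 2)" e]], of "\<eta> * exp (- W / 2)"]
    by (simp add: h_def e power2_eq_square algebra_simps add_divide_distrib)
  have lapw: "has_lap (\<lambda>x. u x - V x)
     (\<lambda>b x. G b x - (a * (\<Sum>c\<in>J. partial_deriv b U (x - c) - Gq b (x - c)) + Gh b x))
     (\<lambda>x. u x - u x powr p - (a * (\<Sum>c\<in>J. M (x - c)) + h x / 4))"
    unfolding V_def
    by (intro has_lap_diff[OF lap has_lap_add[OF has_lap_cmult[OF has_lap_sum[OF J has_lap_translate[OF l1]]] lh]])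
  have h0: "h x \<ge> 0" for x using \<eta> by (simp add: h_def)
  have h_alt: "h x = \<eta> * (exp ((x \<bullet> e - W) / 2) + exp ((- (x \<bullet> e) - W) / 2))" for x
    by (simp add: h_def exp_add[symmetric] diff_divide_distrib algebra_simps)
  have Uc: "U (x - c) \<le> 1 / 6" "U (x - c) \<le> s\<^sup>2" if "x \<in> S" "c \<in> J" for x c
    using R[of "x - c"] that S by auto
  have pos: "0 \<le> U (x - c) - Uq (x - c)" if "x \<in> S" "c \<in> J" for x c
    using Uq_le[of "x - c" 1] Uc(1)[OF that] by simp
  have V_ge: "h x \<le> V x" "0 \<le> V x" if "x \<in> S" for x
  proof -
    have "0 \<le> a * (\<Sum>c\<in>J. U (x - c) - Uq (x - c))"
      using a(1) pos[OF that] by (intro mult_nonneg_nonneg sum_nonneg) auto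
    then show "h x \<le> V x" "0 \<le> V x" using h0[of x] by (simp_all add: V_def)
  qed
  have "u x - V x \<le> 0"
  proof (rule max_principle[OF lapw, where S = S])
    have "S = {x. \<bar>x \<bullet> e\<bar> \<le> W} \<inter> (\<Inter>c\<in>J. {x. R \<le> norm (x - c)})" unfolding S by auto
    then show "closed S"
      by (simp only:) (intro closed_Int closed_INT ballI closed_Collect_le continuous_intros)
    show "x \<in> S" by (rule x)
    show "\<exists>B. bounded B \<and> (\<forall>x\<in>S. d \<le> u x - V x \<longrightarrow> (\<exists>y\<in>S \<inter> B. u y - V y = u x - V x))" if d: "d > 0" for d
    proof -
      have "d \<le> u x" if "x \<in> S" "d \<le> u x - V x" for x using V_ge[OF that(1)] that(2) by linarith
      then show ?thesis using att[OF d] by (intro exI[of _ "{x \<in> S. d \<le> u x}"]) blast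
    qed
    fix y assume y: "y \<in> S" "u y - V y > 0"
    have n: "norm (y - c) \<noteq> R" if c: "c \<in> J" for c
    proof
      assume "norm (y - c) = R"
      then have "u y \<le> a * (U (y - c) - Uq (y - c))" using bd y(1) c by blast
      also have "\<dots> \<le> a * (\<Sum>c\<in>J. U (y - c) - Uq (y - c))"
        using a(1) pos[OF y(1)] c J by (intro mult_left_mono member_le_sum) auto
      also have "\<dots> \<le> V y" using h0[of y] by (simp add: V_def)
      finally show False using y(2) by simp
    qed
    have "\<bar>y \<bullet> e\<bar> \<noteq> W"
    proof
      assume W: "\<bar>y \<bullet> e\<bar> = W"
      have "1 \<le> exp ((y \<bullet> e - W) / 2) + exp ((- (y \<bullet> e) - W) / 2)"
      proof (cases "y \<bullet> e \<ge> 0")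
        case True
        then have "exp ((y \<bullet> e - W) / 2) = 1" using W by simp
        then show ?thesis by simp
      next
        case False
        then have "exp ((- (y \<bullet> e) - W) / 2) = 1" using W by simp
        then show ?thesis by simp
      qed
      then have "\<eta> \<le> h y" using \<eta>(1) by (simp add: h_alt)
      then show False using y(2) V_ge[OF y(1)] small[OF y(1)] by linarith
    qed
    then have "y \<in> {x. \<bar>x \<bullet> e\<bar> < W} \<inter> (\<Inter>c\<in>J. {x. R < norm (x - c)})" (is "_ \<in> ?O")
      using y(1) n unfolding S by force
    moreover have "open ?O" using J by (intro open_Int open_INT ballI open_Collect_less continuous_intros) auto
    moreover have "?O \<subseteq> S" unfolding S by (auto simp: less_imp_le)
    ultimately have int: "y \<in> interior S" by (meson interior_maximal subset_eq)
    \<comment> \<open>Budget at an interior point with u = V + w and w > 0. The linear part leaves a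
      surplus of a Q / 4 + 3 h / 4 + w, and u^p \<le> u^2 \<le> 16 T^2 + 4 h^2 + 2 w^2. The three
      parts are absorbed separately: the smallness of \<open>s\<close> gives 16 T^2 \<le> a Q / 4,
      and \<open>\<eta> \<le> 3 / 32\<close> gives 4 h^2 \<le> 3 h / 8 and 2 w^2 < w.\<close>
    define T Q where "T = (\<Sum>c\<in>J. U (y - c))" and "Q = (\<Sum>c\<in>J. Uq (y - c))"
    define w where "w = u y - V y"
    have T0: "0 \<le> T" unfolding T_def by (intro sum_nonneg U_nonneg)
    have "(\<Sum>c\<in>J. M (y - c)) \<le> (\<Sum>c\<in>J. U (y - c) - 5 / 4 * Uq (y - c))"
    proof (rule sum_mono)
      fix c assume c: "c \<in> J"
      show "M (y - c) \<le> U (y - c) - 5 / 4 * Uq (y - c)"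
        using q(2)[OF Uc(1)[OF y(1) c]] powr_ge_zero[of "U (y - c)" p] unfolding M_def by linarith
    qed
    then have "a * (\<Sum>c\<in>J. M (y - c)) \<le> a * (T - 5 / 4 * Q)"
      using a(1) by (intro mult_left_mono) (auto simp: T_def Q_def sum_subtractf sum_distrib_left)
    moreover have "V y = a * (T - Q) + h y" by (simp add: V_def T_def Q_def sum_subtractf)
    ultimately have 1: "a * (\<Sum>c\<in>J. M (y - c)) + h y / 4 \<le> V y - a * Q / 4 - 3 / 4 * h y"
      by (simp add: algebra_simps)
    have Q0: "0 \<le> Q" unfolding Q_def by (intro sum_nonneg) (simp add: Uq_pos less_imp_le)
    have w: "0 < w" "w \<le> 3 / 32" "u y = V y + w"
      using y V_ge[OF y(1)] small[OF y(1)] \<eta> by (auto simp: w_def)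
    \<comment> \<open>Cauchy-Schwarz over the peaks; the factor \<open>card J\<close> is the reason
      for requiring \<open>s\<close> to be small compared with its inverse.\<close>
    have T2: "T\<^sup>2 \<le> card J * (s * Q)"
    proof -
      have "T\<^sup>2 \<le> card J * (\<Sum>c\<in>J. (U (y - c))\<^sup>2)"
        using sum_squared_le_sum_of_squares[of "\<lambda>c. U (y - c)" J] J by (simp add: T_def mult.commute)
      also have "(\<Sum>c\<in>J. (U (y - c))\<^sup>2) \<le> (\<Sum>c\<in>J. s * Uq (y - c))"
        by (rule sum_mono) (use U_sq_le_Uq Uc(2)[OF y(1)] s(1) in auto)
      finally show ?thesis by (simp add: Q_def sum_distrib_left mult_left_mono)
    qed
    have "V y \<le> 2 * T + h y"
    proof -
      have "V y \<le> a * T + h y" using mult_nonneg_nonneg[OF _ Q0, of a] a(1) \<open>V y = a * (T - Q) + h y\<close>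
        by (simp add: algebra_simps)
      also have "a * T \<le> 2 * T" using T0 a(2) by (rule mult_right_mono[rotated])
      finally show ?thesis by simp
    qed
    then have "(V y)\<^sup>2 \<le> (2 * T + h y)\<^sup>2" using V_ge[OF y(1)] by (intro power_mono) auto
    also have "\<dots> \<le> 8 * T\<^sup>2 + 2 * (h y)\<^sup>2"
      using zero_le_power2[of "2 * T - h y"] by (simp add: power2_eq_square algebra_simps)
    finally have V2: "2 * (V y)\<^sup>2 \<le> 16 * T\<^sup>2 + 4 * (h y)\<^sup>2" by simp
    have "h y \<le> \<eta>" using w(1) V_ge[OF y(1)] small[OF y(1)] y(2) by linarith
    then have "(h y)\<^sup>2 \<le> 3 / 32 * h y"
      unfolding power2_eq_square using h0[of y] \<eta>(2) by (intro mult_right_mono) linarith+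
    moreover have "16 * T\<^sup>2 \<le> a * Q / 4"
    proof -
      have "16 * T\<^sup>2 \<le> (64 * card J * s) * Q / 4" using T2 by (simp add: mult_ac)
      also have "\<dots> \<le> 1 * Q / 4" using s(2) Q0 by (intro divide_right_mono mult_right_mono) auto
      also have "\<dots> \<le> a * Q / 4" using a(1) Q0 by (intro divide_right_mono mult_right_mono) auto
      finally show ?thesis .
    qed
    ultimately have 2: "2 * (V y)\<^sup>2 \<le> a * Q / 4 + 3 / 8 * h y" using V2 by linarith
    have "u y powr p \<le> (u y)\<^sup>2" using u0[of y] small[OF y(1)] \<eta>(2) p2 by (intro powr_le_sq) auto
    also have "\<dots> \<le> 2 * (V y)\<^sup>2 + 2 * w\<^sup>2"
      using zero_le_power2[of "V y - w"] by (simp add: w(3) power2_eq_square algebra_simps)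
    finally have 3: "u y powr p \<le> 2 * (V y)\<^sup>2 + 2 * w\<^sup>2" .
    have "w * w \<le> w * (3 / 32)" using w by (intro mult_left_mono) auto
    then have "w - 2 * w\<^sup>2 > 0" using w(1) by (simp add: power2_eq_square)
    then have "u y - u y powr p - (a * (\<Sum>c\<in>J. M (y - c)) + h y / 4) > 0"
      using 1 2 3 w(3) h0[of y] by linarith
    then show "y \<in> interior S \<and> u y - u y powr p - (a * (\<Sum>c\<in>J. M (y - c)) + h y / 4) > 0"
      using int by blast
  qed
  moreover have "V x \<le> a * (\<Sum>c\<in>J. U (x - c)) + h x"
  proof -
    have "(\<Sum>c\<in>J. U (x - c) - Uq (x - c)) \<le> (\<Sum>c\<in>J. U (x - c))"
      by (rule sum_mono) (use Uq_pos less_imp_le in auto)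
    then show ?thesis using a(1) by (simp add: V_def mult_left_mono)
  qed
  ultimately show ?thesis by (simp add: h_alt)
qed

end

section \<open>Solutions on the cylinder\<close>

text \<open>Supplies the attainment premise of \<open>max_principle\<close> on domains invariant
  under the period: points where \<open>f\<close> is at least \<open>e\<close> are confined in x',
  and a shift brings them to 0 \<le> x1 \<le> P.\<close>

lemma periodic_attained:
  fixes f :: "real \<times> 'b::euclidean_space \<Rightarrow> real"
  assumes P: "P > 0" and f: "\<And>x1 x' m. f (x1 + of_int m * P, x') = f (x1, x')"
    and S: "\<And>x1 x' m. (x1, x') \<in> S \<Longrightarrow> (x1 + of_int m * P, x') \<in> S"
    and \<rho>: "\<And>x1 x'. (x1, x') \<in> S \<Longrightarrow> e \<le> f (x1, x') \<Longrightarrow> norm x' \<le> \<rho>"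
  shows "\<exists>B. bounded B \<and> (\<forall>x\<in>S. e \<le> f x \<longrightarrow> (\<exists>y\<in>S \<inter> B. f y = f x))"
proof (intro exI[of _ "{0..P} \<times> cball 0 \<rho>"] conjI ballI impI)
  show "bounded ({0..P} \<times> cball (0::'b) \<rho>)"
    by (intro bounded_Times bounded_cball bounded_closed_interval)
  fix x assume x: "x \<in> S" "e \<le> f x"
  obtain x1 x' where eq: "x = (x1, x')" by (cases x)
  define m where "m = - \<lfloor>x1 / P\<rfloor>"
  have "of_int \<lfloor>x1 / P\<rfloor> * P \<le> x1" "x1 \<le> (of_int \<lfloor>x1 / P\<rfloor> + 1) * P"
    using floor_correct[of "x1 / P"] P by (simp_all add: pos_le_divide_eq[symmetric] pos_divide_le_eq[symmetric] less_imp_le)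
  then have "x1 + of_int m * P \<in> {0..P}" by (simp add: m_def algebra_simps)
  moreover have "norm x' \<le> \<rho>" using \<rho> x eq by blast
  ultimately have "(x1 + of_int m * P, x') \<in> S \<inter> {0..P} \<times> cball 0 \<rho>"
    using S[of x1 x' m] x(1) eq by simp
  then show "\<exists>y\<in>S \<inter> {0..P} \<times> cball 0 \<rho>. f y = f x" using f[of x1 m x'] eq by blast
qed

section \<open>A single solution: positivity and transversal decay\<close>

locale solution =
  fixes p \<epsilon> :: real and u :: "real \<times> (real ^ 'n) \<Rightarrow> real"
  assumes p2: "2 \<le> p" and eps: "\<epsilon> > 0" and sol: "solves_E p \<epsilon> u"
begin

definition "P = 2 * pi / \<epsilon>"

lemma P_pos: "P > 0"
  using eps by (simp add: P_def)

lemma u_periodic: "u (x1 + of_int m * P, x') = u (x1, x')"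
proof -
  have step: "u (y + P, x') = u (y, x')" for y
    using sol by (simp add: solves_E_def P_def)
  have nat: "u (y + of_nat k * P, x') = u (y, x')" for y and k :: nat
  proof (induction k)
    case (Suc k)
    have "y + of_nat (Suc k) * P = (y + of_nat k * P) + P" by (simp add: algebra_simps)
    then show ?case using Suc step by metis
  qed simp
  show ?thesis
  proof (cases "m \<ge> 0")
    case True
    then show ?thesis using nat[of x1 "nat m"] by simp
  next
    case False
    then show ?thesis using nat[of "x1 + of_int m * P" "nat (- m)"] by simp
  qed
qed

lemma u_vanishes:
  assumes "e > 0"
  obtains \<rho> where "\<And>x1 x'. \<rho> \<le> norm x' \<Longrightarrow> \<bar>u (x1, x')\<bar> < e"
proof -
  have "uniform_limit UNIV (\<lambda>x' x1. u (x1, x')) (\<lambda>x1. 0) at_infinity"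
    using sol by (simp add: solves_E_def)
  then have "\<forall>\<^sub>F x' in at_infinity. \<forall>x1\<in>UNIV. dist (u (x1, x')) 0 < e"
    using assms by (simp add: uniform_limit_iff)
  then obtain \<rho> where "\<forall>x'. \<rho> \<le> norm x' \<longrightarrow> (\<forall>x1\<in>UNIV. dist (u (x1, x')) 0 < e)"
    unfolding eventually_at_infinity by blast
  then have "\<bar>u (x1, x')\<bar> < e" if "\<rho> \<le> norm x'" for x1 x' using that by simp
  with that show thesis by blast
qed

lemma C2_u: "C2 u"
  using sol by (simp add: solves_E_def)

lemma laplacian_u_pos_part: "laplacian u x = u x - (max (u x) 0) powr p"
proof -
  have "- laplacian u x + u x - (max (u x) 0) powr p = 0" using sol unfolding solves_E_def by blast
  then show ?thesis by simp
qed

text \<open>Where \<open>u\<close> is negative the nonlinearity vanishes, so \<Delta>(-u) = -u > 0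
  there and the maximum principle applies on the whole space.\<close>

lemma u_nonneg: "u x \<ge> 0"
proof -
  have "laplacian u = (\<lambda>x. u x - (max (u x) 0) powr p)" by (rule ext) (rule laplacian_u_pos_part)
  then have lap: "has_lap u (\<lambda>b. partial_deriv b u) (\<lambda>x. u x - (max (u x) 0) powr p)"
    using has_lap_C2[OF C2_u] by simp
  have "-1 * u x \<le> 0"
  proof (rule max_principle[OF has_lap_cmult[OF lap], where S = UNIV])
    show "\<exists>B. bounded B \<and> (\<forall>x\<in>UNIV. e \<le> -1 * u x \<longrightarrow> (\<exists>y\<in>UNIV \<inter> B. -1 * u y = -1 * u x))"
      if "e > 0" for e
    proof -
      obtain \<rho> where \<rho>: "\<And>x1 x'. \<rho> \<le> norm x' \<Longrightarrow> \<bar>u (x1, x')\<bar> < e" using u_vanishes[OF \<open>e > 0\<close>] by blast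
      show ?thesis
      proof (rule periodic_attained[OF P_pos])
        fix x1 x' assume "e \<le> -1 * u (x1, x')"
        then have "\<not> \<bar>u (x1, x')\<bar> < e" by linarith
        then show "norm x' \<le> \<rho>" using \<rho>[of x' x1] by linarith
      qed (simp_all add: u_periodic)
    qed
  qed auto
  then show ?thesis by simp
qed

lemma laplacian_u: "laplacian u x = u x - u x powr p"
  using laplacian_u_pos_part[of x] u_nonneg[of x] by (simp add: max_def)

lemma u_lap: "has_lap u (\<lambda>b. partial_deriv b u) (\<lambda>x. u x - u x powr p)"
proof -
  have "laplacian u = (\<lambda>x. u x - u x powr p)" by (rule ext) (rule laplacian_u)
  then show ?thesis using has_lap_C2[OF C2_u] by simp
qed

text \<open>The half-space argument used for \<open>U\<close>, with a normal in the x'-directions: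
  the barrier is then constant in x1 and respects the period. The constants involve only
  \<open>\<eta>\<close> and \<open>R\<close>, hence are uniform in
  \<open>\<epsilon>\<close>.\<close>

lemma u_decay:
  assumes small: "\<And>x1 x'. R \<le> norm x' \<Longrightarrow> u (x1, x') \<le> \<eta>" and \<eta>: "\<eta> \<le> 1 / 2"
    and x': "R \<le> norm x'" "x' \<noteq> 0"
  shows "u (x1, x') \<le> \<eta> * exp (- (norm x' - R) / 2)"
proof -
  define v where "v = (1 / norm x') *\<^sub>R x'"
  have nv: "norm v = 1" "v \<bullet> x' = norm x'" "v \<noteq> 0"
    using x'(2) by (auto simp: v_def power2_norm_eq_inner[symmetric] power2_eq_square)
  define e where "e = (0::real, v)"
  have ne: "norm e = 1" using nv(1) by (simp add: e_def norm_Pair)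
  have xe: "x \<bullet> e = v \<bullet> snd x" for x by (simp add: e_def inner_prod_def inner_commute)
  have e0: "e \<noteq> 0" using ne by auto
  have \<eta>0: "\<eta> \<ge> 0" using small[OF x'(1)] u_nonneg by (meson order_trans)
  define h where "h = (\<lambda>x. \<eta> * exp (R / 2) * exp (- (1 / 2) * (x \<bullet> e)))"
  define S where "S = {x. e \<bullet> x \<ge> R}"
  obtain Gh where lh: "has_lap h Gh (\<lambda>x. h x / 4)"
    using has_lap_cmult[OF has_lap_exp_inner[of "- (1 / 2)" e], of "\<eta> * exp (R / 2)"]
    by (simp add: h_def ne power2_eq_square)
  have h0: "h x \<ge> 0" for x using \<eta>0 by (simp add: h_def)
  have S_norm: "R \<le> norm (snd x)" if "x \<in> S" for x
  proof -
    have "v \<bullet> snd x \<le> norm v * norm (snd x)" by (rule norm_cauchy_schwarz)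
    then show ?thesis using that nv(1) by (simp add: S_def xe inner_commute[of e])
  qed
  have "u (x1, x') - h (x1, x') \<le> 0"
  proof (rule max_principle[OF has_lap_diff[OF u_lap lh], where S = S])
    show "closed S" unfolding S_def by (rule closed_halfspace_ge)
    show "(x1, x') \<in> S" using x'(1) nv(2) by (simp add: S_def xe inner_commute[of e])
    show "\<exists>B. bounded B \<and> (\<forall>x\<in>S. d \<le> u x - h x \<longrightarrow> (\<exists>y\<in>S \<inter> B. u y - h y = u x - h x))" if "d > 0" for d
    proof -
      obtain \<rho> where \<rho>: "\<And>x1 x'. \<rho> \<le> norm x' \<Longrightarrow> \<bar>u (x1, x')\<bar> < d" using u_vanishes[OF \<open>d > 0\<close>] by blast
      show ?thesis
      proof (rule periodic_attained[OF P_pos])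
        fix x1 x' assume "d \<le> u (x1, x') - h (x1, x')"
        then have "\<not> \<bar>u (x1, x')\<bar> < d" using h0[of "(x1, x')"] by linarith
        then show "norm x' \<le> \<rho>" using \<rho>[of x' x1] by linarith
      qed (simp_all add: u_periodic S_def h_def xe inner_commute[of e])
    qed
    fix x assume x: "x \<in> S" "u x - h x > 0"
    have u\<eta>: "u x \<le> \<eta>" using small[of "snd x" "fst x"] S_norm[OF x(1)] by simp
    have "e \<bullet> x \<noteq> R"
    proof
      assume "e \<bullet> x = R"
      then have "h x = \<eta>" by (simp add: h_def inner_commute[of x e] mult.assoc exp_add[symmetric])
      then show False using x(2) u\<eta> by simp
    qed
    then have "x \<in> interior S"
      using x(1) unfolding S_def interior_halfspace_ge[OF e0] by simp
    moreover have "u x powr p \<le> (u x)\<^sup>2" using u_nonneg u\<eta> \<eta> p2 by (intro powr_le_sq) auto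
    moreover have "(u x)\<^sup>2 \<le> 1 / 2 * u x"
      unfolding power2_eq_square using u_nonneg[of x] u\<eta> \<eta> by (intro mult_right_mono) auto
    ultimately show "x \<in> interior S \<and> u x - u x powr p - h x / 4 > 0"
      using x(2) h0[of x] by auto
  qed
  moreover have "h (x1, x') = \<eta> * exp (- (norm x' - R) / 2)"
    using nv(2) by (simp add: h_def xe mult.assoc exp_add[symmetric] diff_divide_distrib)
  ultimately show ?thesis by simp
qed

end

section \<open>Integrals over hyperplanes\<close>

lemma power_le_exp:
  fixes y c :: real
  assumes "y \<ge> 0" "c > 0" "n > 0"
  shows "y ^ n \<le> (n / c) ^ n * exp (c * y)"
proof -
  have "c * y / n \<le> exp (c * y / n)"
    using exp_ge_add_one_self[of "c * y / n"] by linarith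
  then have "y \<le> (n / c) * exp (c * y / n)"
    using assms by (simp add: field_simps)
  then have "y ^ n \<le> ((n / c) * exp (c * y / n)) ^ n"
    using assms(1) by (rule power_mono)
  also have "\<dots> = (n / c) ^ n * exp (c * y / n) ^ n"
    by (rule power_mult_distrib)
  also have "exp (c * y / n) ^ n = exp (c * y)"
    using exp_of_nat_mult[of n "c * y / n"] assms(3) by simp
  finally show ?thesis .
qed

text \<open>Majorised by a series over balls: for k \<le> norm x \<le> k + 1 the function is at most
  exp(- c k), and the volume of the ball of radius k + 1, polynomial in k, is beaten by
  \<open>power_le_exp\<close>.\<close>

lemma integrable_exp_norm:
  assumes c: "c > 0"
  shows "integrable lborel (\<lambda>x::'a::euclidean_space. exp (- c * norm x))"
proof (rule integrableI_bounded)
  show "(\<lambda>x::'a. exp (- c * norm x)) \<in> borel_measurable lborel" by simp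
  define n where "n = DIM('a)"
  have n: "n > 0" by (simp add: n_def)
  define V where "V = unit_ball_vol (real n)"
  have V0: "V \<ge> 0" by (simp add: V_def)
  define a where "a = (\<lambda>k::nat. exp (- c * k) * (V * (real k + 1) ^ n))"
  have a_le: "a k \<le> (V * (n / (c / 2)) ^ n * exp (c / 2)) * exp (- c / 2) ^ k" for k
  proof -
    have "a k \<le> exp (- c * k) * (V * ((n / (c / 2)) ^ n * exp (c / 2 * (real k + 1))))"
      unfolding a_def by (intro mult_left_mono power_le_exp V0) (use n c in auto)
    also have "exp (- c * k) * (V * ((n / (c / 2)) ^ n * exp (c / 2 * (real k + 1))))
        = V * (n / (c / 2)) ^ n * (exp (- c * k) * exp (c / 2 * (real k + 1)))" by simp
    also have "exp (- c * k) * exp (c / 2 * (real k + 1)) = exp (c / 2) * exp (real k * (- c / 2))"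
      unfolding exp_add[symmetric] by (simp add: field_simps)
    also have "exp (real k * (- c / 2)) = exp (- c / 2) ^ k" by (rule exp_of_nat_mult)
    finally show ?thesis by (simp add: mult.assoc)
  qed
  have a0: "a k \<ge> 0" for k using V0 by (simp add: a_def)
  have sum_a: "summable a"
  proof (rule summable_comparison_test')
    show "summable (\<lambda>k. (V * (n / (c / 2)) ^ n * exp (c / 2)) * exp (- c / 2) ^ k)"
      by (intro summable_mult summable_geometric) (use c in simp)
    show "norm (a k) \<le> (V * (n / (c / 2)) ^ n * exp (c / 2)) * exp (- c / 2) ^ k" for k
      using a_le[of k] a0[of k] by simp
  qed
  have "(\<integral>\<^sup>+ x. ennreal (norm (exp (- c * norm (x::'a)))) \<partial>lborel)
      \<le> (\<integral>\<^sup>+ x. (\<Sum>k. ennreal (exp (- c * real k)) * indicator (cball 0 (real k + 1)) (x::'a)) \<partial>lborel)"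
  proof (rule nn_integral_mono)
    fix x :: 'a
    define k where "k = nat \<lfloor>norm x\<rfloor>"
    have k: "real k \<le> norm x" "norm x \<le> real k + 1"
      using norm_ge_zero[of x] unfolding k_def by linarith+
    have "ennreal (norm (exp (- c * norm x))) \<le> ennreal (exp (- c * real k)) * indicator (cball 0 (real k + 1)) x"
      using k c by (simp add: ennreal_leI)
    also have "\<dots> \<le> (\<Sum>k. ennreal (exp (- c * real k)) * indicator (cball 0 (real k + 1)) x)"
    proof -
      have "f k \<le> suminf f" for f :: "nat \<Rightarrow> ennreal"
        using sum_le_suminf[of f "{k}"] by simp
      then show ?thesis .
    qed
    finally show "ennreal (norm (exp (- c * norm x)))
        \<le> (\<Sum>k. ennreal (exp (- c * real k)) * indicator (cball 0 (real k + 1)) x)" .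
  qed
  also have "\<dots> = (\<Sum>k. \<integral>\<^sup>+ x. ennreal (exp (- c * real k)) * indicator (cball 0 (real k + 1)) (x::'a) \<partial>lborel)"
    by (rule nn_integral_suminf) (auto intro!: borel_measurable_times_ennreal borel_measurable_indicator borel_closed)
  also have "\<dots> = (\<Sum>k. ennreal (a k))"
  proof (rule suminf_cong)
    fix k
    have "(\<integral>\<^sup>+ x. ennreal (exp (- c * real k)) * indicator (cball 0 (real k + 1)) (x::'a) \<partial>lborel)
        = ennreal (exp (- c * real k)) * emeasure lborel (cball (0::'a) (real k + 1))"
      by (simp add: nn_integral_cmult_indicator)
    also have "\<dots> = ennreal (a k)"
      by (simp add: emeasure_cball a_def V_def n_def ennreal_mult')
    finally show "(\<integral>\<^sup>+ x. ennreal (exp (- c * real k)) * indicator (cball 0 (real k + 1)) (x::'a) \<partial>lborel) = ennreal (a k)" .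
  qed
  also have "\<dots> < \<infinity>"
    using suminf_ennreal2[OF a0 sum_a] by (simp add: less_top)
  finally show "(\<integral>\<^sup>+ x. ennreal (norm (exp (- c * norm (x::'a)))) \<partial>lborel) < \<infinity>" .
qed

lemma integrable_exp_norm_bound:
  fixes f :: "'a::euclidean_space \<Rightarrow> real"
  assumes "continuous_on UNIV f" "c > 0" "\<And>x. \<bar>f x\<bar> \<le> C * exp (- c * norm x)"
  shows "integrable lborel f"
proof (rule Bochner_Integration.integrable_bound)
  show "integrable lborel (\<lambda>x::'a. C * exp (- c * norm x))"
    using integrable_exp_norm[where 'a = 'a, OF assms(2)] by simp
  show "f \<in> borel_measurable lborel"
    using borel_measurable_continuous_onI[OF assms(1)] by simp
  show "AE x in lborel. norm (f x) \<le> norm (C * exp (- c * norm x))"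
    using assms(3) by (intro AE_I2) (metis abs_ge_self order_trans real_norm_def)
qed

section \<open>Slices of the ground state and the function \<open>Phi\<close>\<close>

locale ground_cyl = ground p U for p and U :: "real \<times> 'b::euclidean_space \<Rightarrow> real"
begin

definition "q L x' = (U (L, x'))\<^sup>2 + (\<Sum>b\<in>Basis. (partial_deriv (0, b) U (L, x'))\<^sup>2)"

definition "Phi L = (LINT x'|lborel. q L x')"

lemma q_ge: "(U (L, x'))\<^sup>2 \<le> q L x'" "0 \<le> q L x'"
  unfolding q_def by (auto intro!: sum_nonneg add_nonneg_nonneg)

lemma pd_cont: "b \<in> Basis \<Longrightarrow> continuous_on A (partial_deriv b U)"
proof -
  assume "b \<in> Basis"
  then have "partial_deriv b U differentiable_on UNIV"
    using gs by (auto simp: ground_state_def C2_def)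
  then show ?thesis using continuous_on_subset differentiable_imp_continuous_on by blast
qed

lemma cont_slice: "continuous_on UNIV f \<Longrightarrow> continuous_on UNIV (\<lambda>x'. f (L, x'))"
  by (rule continuous_on_compose2[where g = f and t = UNIV]) (auto intro!: continuous_intros)

lemma q_cont: "continuous_on UNIV (q L)"
  unfolding q_def
  by (intro continuous_intros cont_slice U_cont pd_cont) (auto simp: Basis_prod_def)

text \<open>A crude linear minorant, with a slope small enough to hold for every x'; it serves only
  the integrability on a slice.\<close>

lemma norm_slice_ge: "0 \<le> L \<Longrightarrow> L + (norm x' - L) / 3 \<le> norm (L, x')"
proof -
  assume L: "0 \<le> L"
  have "(L + (norm x' - L) / 3)\<^sup>2 \<le> (norm (L, x'))\<^sup>2"
  proof -
    have "(norm (L, x'))\<^sup>2 = L\<^sup>2 + (norm x')\<^sup>2" using L by (simp add: norm_Pair)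
    moreover have "L\<^sup>2 + (norm x')\<^sup>2 - (L + (norm x' - L) / 3)\<^sup>2 =
        (5 * L\<^sup>2 + 8 * (norm x')\<^sup>2 - 4 * L * norm x') / 9"
      by (simp add: power2_eq_square field_simps)
    moreover have "0 \<le> 5 * L\<^sup>2 + 8 * (norm x')\<^sup>2 - 4 * L * norm x'"
    proof -
      have "5 * L\<^sup>2 + 8 * (norm x')\<^sup>2 - 4 * L * norm x' = (L - 2 * norm x')\<^sup>2 + 4 * L\<^sup>2 + 4 * (norm x')\<^sup>2"
        by (simp add: power2_eq_square algebra_simps)
      then show ?thesis by (simp only:) (intro add_nonneg_nonneg; simp)
    qed
    ultimately show ?thesis by simp
  qed
  then show ?thesis by (rule power2_le_imp_le) simp
qed

text \<open>The two decay bounds have different uses: the first holds on the whole slice but loses a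
  factor exp(L / 6), harmless for integrability; the second has no such loss and controls the part
  beyond \<open>norm x' = L\<close> uniformly in \<open>L\<close>. The last fact, the strict form of
  monotonicity, is confined to \<open>norm x' \<le> L\<close> because far out on the slice a shift
  in x1 hardly changes the norm.\<close>

lemma slice_facts:
  obtains R C c where "R \<ge> 1" "C > 0" "0 < c" "c < 1"
    "\<And>L x'. R \<le> L \<Longrightarrow> U (L, x') \<le> U (L, 0) * exp (- (norm x' - L) / 6)"
    "\<And>L x'. R \<le> L \<Longrightarrow> L \<le> norm x' \<Longrightarrow> U (L, x') \<le> U (L, 0) * exp (- norm x' / 6)"
    "\<And>L x'. R \<le> L \<Longrightarrow> norm x' \<le> 1 \<Longrightarrow> c * U (L, 0) \<le> U (L, x')"
    "\<And>L x'. R \<le> L \<Longrightarrow> q L x' \<le> C * (U (L, x'))\<^sup>2"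
    "\<And>L L' x'. R \<le> L \<Longrightarrow> L \<le> L' \<Longrightarrow> q L' x' \<le> q L x'"
    "\<And>L d x'. R \<le> L \<Longrightarrow> 0 < d \<Longrightarrow> norm x' \<le> L \<Longrightarrow>
        q (L + d) x' \<le> q L x' - (1 - exp (- d / 4)) * (U (L, x'))\<^sup>2"
proof -
  obtain R1 where R1: "R1 > 0"
    "\<And>x y. R1 \<le> norm x \<Longrightarrow> norm x \<le> norm y \<Longrightarrow> U y \<le> exp (- (norm y - norm x) / 2) * U x"
    using U_decay by blast
  obtain c where c: "0 < c" "c < 1" "\<And>x y. 1 \<le> norm y \<Longrightarrow> norm x \<le> norm y + 1 \<Longrightarrow> c * U y \<le> U x"
    using U_harnack by blast
  obtain R2 C0 where R2: "R2 > 0" "C0 > 0"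
    "\<And>x b. b \<in> Basis \<Longrightarrow> R2 \<le> norm x \<Longrightarrow> \<bar>partial_deriv b U x\<bar> \<le> C0 * U x"
    using U_gradient by blast
  obtain R3 where R3: "R3 > 0"
    "\<And>x y B. B \<subseteq> Basis \<Longrightarrow> R3 \<le> norm x \<Longrightarrow> norm x \<le> norm y \<Longrightarrow> (\<And>b. b \<in> B \<Longrightarrow> x \<bullet> b = y \<bullet> b) \<Longrightarrow>
       (\<Sum>b\<in>B. (partial_deriv b U y)\<^sup>2) \<le> (\<Sum>b\<in>B. (partial_deriv b U x)\<^sup>2)"
    using U_transversal_gradient_mono by blast
  define R where "R = Max {1, R1, R2, R3}"
  have R: "R \<ge> 1" "R \<ge> R1" "R \<ge> R2" "R \<ge> R3" by (simp_all add: R_def)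
  have n0: "norm (L, 0::'b) = L" if "R \<le> L" for L using that R(1) by (simp add: norm_Pair)
  have nL: "L \<le> norm (L, x')" if "R \<le> L" for L and x' :: 'b
    using norm_fst_le[of L x'] that R(1) by simp
  have 1: "U (L, x') \<le> U (L, 0) * exp (- (norm x' - L) / 6)" if "R \<le> L" for L x'
  proof -
    have "U (L, x') \<le> exp (- (norm (L, x') - norm (L, 0::'b)) / 2) * U (L, 0)"
      by (rule R1(2)) (use nL[OF that] n0[OF that] R that in auto)
    also have "\<dots> \<le> exp (- (norm x' - L) / 6) * U (L, 0)"
      using norm_slice_ge[of L x'] n0[OF that] that R(1) by (intro mult_right_mono U_nonneg) (simp add: field_simps)
    finally show ?thesis by (simp add: mult.commute)
  qed
  have 2: "U (L, x') \<le> U (L, 0) * exp (- norm x' / 6)" if "R \<le> L" "L \<le> norm x'" for L x'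
  proof -
    have "(L + norm x' / 3)\<^sup>2 \<le> (norm (L, x'))\<^sup>2"
    proof -
      have "L * norm x' \<le> norm x' * norm x'" using that(2) by (intro mult_right_mono) auto
      moreover have "0 \<le> norm x' * norm x'" by simp
      ultimately have "L * norm x' * (2 / 3) + norm x' * norm x' / 9 \<le> norm x' * norm x'" by linarith
      then show ?thesis by (simp add: norm_Pair power2_eq_square algebra_simps)
    qed
    then have *: "L + norm x' / 3 \<le> norm (L, x')" by (rule power2_le_imp_le) simp
    have "U (L, x') \<le> exp (- (norm (L, x') - norm (L, 0::'b)) / 2) * U (L, 0)"
      by (rule R1(2)) (use nL[OF that(1)] n0[OF that(1)] R that in auto)
    also have "\<dots> \<le> exp (- norm x' / 6) * U (L, 0)"
      using * n0[OF that(1)] by (intro mult_right_mono U_nonneg) (simp add: field_simps)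
    finally show ?thesis by (simp add: mult.commute)
  qed
  have 3: "c * U (L, 0) \<le> U (L, x')" if "R \<le> L" "norm x' \<le> 1" for L x'
  proof (rule c(3))
    have "norm (L, x') \<le> norm L + norm x'" by (rule norm_Pair_le)
    then show "norm (L, x') \<le> norm (L, 0::'b) + 1" using that n0[OF that(1)] R(1) by simp
  qed (use n0 that R in auto)
  have 4: "q L x' \<le> (1 + DIM('b) * C0\<^sup>2) * (U (L, x'))\<^sup>2" if "R \<le> L" for L x'
  proof -
    have "(\<Sum>b\<in>(Basis::'b set). (partial_deriv (0, b) U (L, x'))\<^sup>2) \<le> (\<Sum>b\<in>(Basis::'b set). C0\<^sup>2 * (U (L, x'))\<^sup>2)"
    proof (rule sum_mono)
      fix b :: 'b assume "b \<in> Basis"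
      then have "\<bar>partial_deriv (0, b) U (L, x')\<bar> \<le> C0 * U (L, x')"
        using nL[OF that, of x'] R that by (intro R2(3)) (auto simp: Basis_prod_def)
      then have "\<bar>partial_deriv (0, b) U (L, x')\<bar>\<^sup>2 \<le> (C0 * U (L, x'))\<^sup>2" by (intro power_mono) auto
      then show "(partial_deriv (0, b) U (L, x'))\<^sup>2 \<le> C0\<^sup>2 * (U (L, x'))\<^sup>2" by (simp add: power_mult_distrib)
    qed
    then show ?thesis by (simp add: q_def algebra_simps)
  qed
  have nmono: "norm (L, x') \<le> norm (L', x')" if "R \<le> L" "L \<le> L'" for L L' and x' :: 'b
    using that R(1) by (simp add: norm_Pair power_mono)
  have 5: "(\<Sum>b\<in>Basis. (partial_deriv (0, b) U (L', x'))\<^sup>2) \<le> (\<Sum>b\<in>Basis. (partial_deriv (0, b) U (L, x'))\<^sup>2)"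
    if "R \<le> L" "L \<le> L'" for L L' x'
  proof -
    have "(\<Sum>b\<in>Pair 0 ` Basis. (partial_deriv b U (L', x'))\<^sup>2) \<le> (\<Sum>b\<in>Pair 0 ` Basis. (partial_deriv b U (L, x'))\<^sup>2)"
      by (rule R3(2)) (use nL[OF that(1), of x'] nmono[OF that] R that in \<open>auto simp: Basis_prod_def\<close>)
    moreover have "inj_on (Pair (0::real)) (Basis :: 'b set)" by (auto simp: inj_on_def)
    ultimately show ?thesis by (simp add: sum.reindex)
  qed
  have 6: "q L' x' \<le> q L x'" if "R \<le> L" "L \<le> L'" for L L' x'
    using 5[OF that, of x'] power_mono[OF U_mono[OF nmono[OF that, of x']] U_nonneg, of 2]
    by (simp add: q_def)
  have 7: "q (L + d) x' \<le> q L x' - (1 - exp (- d / 4)) * (U (L, x'))\<^sup>2"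
    if "R \<le> L" "0 < d" "norm x' \<le> L" for L d x'
  proof -
    define r where "r = norm (L, x')"
    have r: "r \<le> 2 * L" using norm_Pair_le[of L x'] that R(1) by (simp add: r_def)
    \<comment> \<open>As \<open>norm x' \<le> L\<close> gives r \<le> 2 L, a shift of x1 by
      \<open>d\<close> lengthens the vector by at least d / 4; the decay rate 1/2 turns this into a
      factor exp(- d / 8) for \<open>U\<close>.\<close>
    have "(r + d / 4)\<^sup>2 \<le> (norm (L + d, x'))\<^sup>2"
    proof -
      have "r\<^sup>2 = L\<^sup>2 + (norm x')\<^sup>2" by (simp add: r_def norm_Pair)
      moreover have "(norm (L + d, x'))\<^sup>2 = (L + d)\<^sup>2 + (norm x')\<^sup>2" by (simp add: norm_Pair)
      moreover have "(r + d / 4)\<^sup>2 = r\<^sup>2 + d * r / 2 + d * d / 16" "(L + d)\<^sup>2 = L\<^sup>2 + 2 * (d * L) + d * d"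
        by (simp_all add: power2_eq_square algebra_simps)
      moreover have "d * r \<le> d * (2 * L)" using r that by (intro mult_left_mono) auto
      moreover have "0 \<le> d * d" "0 \<le> d * L" using that R(1) by simp_all
      ultimately show ?thesis by linarith
    qed
    then have *: "r + d / 4 \<le> norm (L + d, x')" by (rule power2_le_imp_le) simp
    have "U (L + d, x') \<le> exp (- (norm (L + d, x') - norm (L, x')) / 2) * U (L, x')"
      by (rule R1(2)) (use nL[OF that(1), of x'] * r_def R that in auto)
    also have "\<dots> \<le> exp (- d / 8) * U (L, x')"
      using * by (intro mult_right_mono U_nonneg) (simp add: r_def field_simps)
    finally have "(U (L + d, x'))\<^sup>2 \<le> (exp (- d / 8) * U (L, x'))\<^sup>2"
      by (rule power_mono) (rule U_nonneg)
    also have "\<dots> = exp (- d / 4) * (U (L, x'))\<^sup>2"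
      by (simp add: power_mult_distrib exp_double[symmetric])
    finally show ?thesis using 5[OF that(1), of "L + d" x'] that(2) by (simp add: q_def algebra_simps)
  qed
  show thesis
  proof (rule that[of R "1 + DIM('b) * C0\<^sup>2" c])
    show "1 + DIM('b) * C0\<^sup>2 > 0" by (simp add: add_pos_nonneg)
  qed (fact R(1) c(1) c(2) 1 2 3 4 6 7)+
qed

text \<open>A fixed fraction of \<open>Phi L\<close> comes from \<open>I L\<close>, the integral of
  U^2 over \<open>norm x' \<le> L\<close>, where the decrease is strict: the tail is at most a
  constant times \<open>(U (L, 0))\<^sup>2\<close>, and Harnack's inequality on the unit ball bounds
  \<open>I L\<close> from below by such a term. Hence the loss factor depends on \<open>d\<close>
  but not on \<open>L\<close>.\<close>

lemma Phi_facts: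
  obtains R k where "R \<ge> 1" "k > 0" "\<And>L. R \<le> L \<Longrightarrow> integrable lborel (q L)"
    "\<And>L. R \<le> L \<Longrightarrow> k * (U (L, 0))\<^sup>2 \<le> Phi L"
    "\<And>d. d > 0 \<Longrightarrow> \<exists>\<kappa>>0. \<forall>L L'. R \<le> L \<longrightarrow> L + d \<le> L' \<longrightarrow> Phi L' \<le> (1 - \<kappa>) * Phi L"
proof -
  obtain R C c where R: "R \<ge> 1" "C > 0" "0 < c" "c < 1"
    and decay: "\<And>L x'. R \<le> L \<Longrightarrow> U (L, x') \<le> U (L, 0) * exp (- (norm x' - L) / 6)"
    and decay': "\<And>L x'. R \<le> L \<Longrightarrow> L \<le> norm x' \<Longrightarrow> U (L, x') \<le> U (L, 0) * exp (- norm x' / 6)"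
    and harnack: "\<And>L x'. R \<le> L \<Longrightarrow> norm x' \<le> 1 \<Longrightarrow> c * U (L, 0) \<le> U (L, x')"
    and q_le: "\<And>L x'. R \<le> L \<Longrightarrow> q L x' \<le> C * (U (L, x'))\<^sup>2"
    and mono: "\<And>L L' x'. R \<le> L \<Longrightarrow> L \<le> L' \<Longrightarrow> q L' x' \<le> q L x'"
    and strict: "\<And>L d x'. R \<le> L \<Longrightarrow> 0 < d \<Longrightarrow> norm x' \<le> L \<Longrightarrow>
        q (L + d) x' \<le> q L x' - (1 - exp (- d / 4)) * (U (L, x'))\<^sup>2"
    using slice_facts by blast
  have int_q: "integrable lborel (q L)" if L: "R \<le> L" for L
  proof (rule integrable_exp_norm_bound[OF q_cont])
    show "(1::real) / 3 > 0" by simp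
    fix x'
    have "q L x' \<le> C * (U (L, x'))\<^sup>2" by (rule q_le[OF L])
    also have "\<dots> \<le> C * (U (L, 0) * exp (- (norm x' - L) / 6))\<^sup>2"
      using R(2) decay[OF L] by (intro mult_left_mono power_mono U_nonneg) auto
    also have "\<dots> = C * (U (L, 0))\<^sup>2 * (exp (L / 3) * exp (- (1 / 3) * norm x'))"
      by (simp add: power_mult_distrib exp_double[symmetric] exp_add[symmetric] diff_divide_distrib)
    finally show "\<bar>q L x'\<bar> \<le> C * (U (L, 0))\<^sup>2 * exp (L / 3) * exp (- (1 / 3) * norm x')"
      using q_ge(2)[of L x'] by simp
  qed
  define I where "I = (\<lambda>L. LINT x'|lborel. indicator (cball 0 L) x' * (U (L, x'))\<^sup>2)"
  have int_I: "integrable lborel (\<lambda>x'. indicator (cball 0 r) x' * (U (L, x'))\<^sup>2)" if "R \<le> L" for r L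
  proof (rule Bochner_Integration.integrable_bound[OF int_q[OF that]])
    have "(\<lambda>x'. (U (L, x'))\<^sup>2) \<in> borel_measurable borel"
      by (intro borel_measurable_continuous_onI continuous_intros cont_slice U_cont)
    then show "(\<lambda>x'. indicator (cball 0 r) x' * (U (L, x'))\<^sup>2) \<in> borel_measurable lborel"
      by (intro borel_measurable_times borel_measurable_indicator) simp_all
    show "AE x' in lborel. norm (indicator (cball 0 r) x' * (U (L, x'))\<^sup>2) \<le> norm (q L x')"
      using q_ge by (intro AE_I2) (auto simp: indicator_def abs_of_nonneg)
  qed
  define v where "v = measure lborel (cball (0::'b) 1)"
  have v: "v > 0"
    using unit_ball_vol_pos[of "real DIM('b)"] by (simp add: v_def content_cball)
  have I_ge: "c\<^sup>2 * v * (U (L, 0))\<^sup>2 \<le> I L" if L: "R \<le> L" for L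
  proof -
    have "(LINT x'|lborel. indicator (cball 0 1) (x'::'b) * (c * U (L, 0))\<^sup>2) \<le> I L"
      unfolding I_def
    proof (rule Bochner_Integration.integral_mono)
      show "integrable lborel (\<lambda>x'. indicator (cball 0 L) x' * (U (L, x'))\<^sup>2)" by (rule int_I[OF L])
      show "integrable lborel (\<lambda>x'::'b. indicator (cball 0 1) x' * (c * U (L, 0))\<^sup>2)"
        by (intro integrable_mult_left integrable_real_indicator) (use emeasure_bounded_finite[OF bounded_cball[of "0::'b" 1]] in auto)
      fix x' :: 'b
      show "indicator (cball 0 1) x' * (c * U (L, 0))\<^sup>2 \<le> indicator (cball 0 L) x' * (U (L, x'))\<^sup>2"
      proof (cases "norm x' \<le> 1")
        case True
        then have "(c * U (L, 0))\<^sup>2 \<le> (U (L, x'))\<^sup>2"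
          using harnack[OF L True] R(3) U_nonneg by (intro power_mono) auto
        then show ?thesis using True L R(1) by (simp add: indicator_def)
      qed (simp add: indicator_def)
    qed
    then show ?thesis by (simp add: v_def power_mult_distrib mult_ac)
  qed
  have Phi_ge: "c\<^sup>2 * v * (U (L, 0))\<^sup>2 \<le> Phi L" if L: "R \<le> L" for L
  proof -
    have "I L \<le> Phi L" unfolding I_def Phi_def
      by (rule Bochner_Integration.integral_mono[OF int_I[OF L, of L] int_q[OF L]]) (use q_ge in \<open>auto simp: indicator_def\<close>)
    then show ?thesis using I_ge[OF L] by simp
  qed
  define K where "K = (LINT x'|lborel. exp (- (1 / 3) * norm (x'::'b)))"
  have K0: "K \<ge> 0" unfolding K_def by (rule integral_nonneg_AE) simp
  define k where "k = c\<^sup>2 * v"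
  have k: "k > 0" using R(3) v by (simp add: k_def)
  have Phi_le: "Phi L \<le> C * (1 + K / k) * I L" if L: "R \<le> L" for L
  proof -
    have "Phi L \<le> (LINT x'|lborel. C * (indicator (cball 0 L) x' * (U (L, x'))\<^sup>2 + (U (L, 0))\<^sup>2 * exp (- (1 / 3) * norm x')))"
      unfolding Phi_def
    proof (rule Bochner_Integration.integral_mono[OF int_q[OF L]])
      show "integrable lborel (\<lambda>x'::'b. C * (indicator (cball 0 L) x' * (U (L, x'))\<^sup>2 + (U (L, 0))\<^sup>2 * exp (- (1 / 3) * norm x')))"
        using integrable_exp_norm[where 'a = 'b, of "1 / 3"]
        by (intro integrable_mult_right Bochner_Integration.integrable_add int_I[OF L]) auto
      fix x' :: 'b
      show "q L x' \<le> C * (indicator (cball 0 L) x' * (U (L, x'))\<^sup>2 + (U (L, 0))\<^sup>2 * exp (- (1 / 3) * norm x'))"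
      proof (rule order_trans[OF q_le[OF L] mult_left_mono])
        show "(U (L, x'))\<^sup>2 \<le> indicator (cball 0 L) x' * (U (L, x'))\<^sup>2 + (U (L, 0))\<^sup>2 * exp (- (1 / 3) * norm x')"
        proof (cases "norm x' \<le> L")
          case False
          then have "(U (L, x'))\<^sup>2 \<le> (U (L, 0) * exp (- norm x' / 6))\<^sup>2"
            using decay'[OF L] U_nonneg by (intro power_mono) auto
          also have "\<dots> = (U (L, 0))\<^sup>2 * exp (- (1 / 3) * norm x')"
            by (simp add: power_mult_distrib exp_double[symmetric])
          finally show ?thesis by (simp add: indicator_def)
        qed (simp add: indicator_def)
      qed (use R(2) in simp)
    qed
    also have "\<dots> = C * (I L + (U (L, 0))\<^sup>2 * K)"
      using integrable_exp_norm[where 'a = 'b, of "1 / 3"] int_I[OF L] by (simp add: I_def K_def)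
    also have "\<dots> \<le> C * (I L + I L / k * K)"
    proof -
      have "(U (L, 0))\<^sup>2 \<le> I L / k" using I_ge[OF L] k by (simp add: k_def field_simps)
      then show ?thesis using R(2) K0 by (intro mult_left_mono add_left_mono mult_right_mono) auto
    qed
    finally show ?thesis by (simp add: algebra_simps)
  qed
  define D where "D = C * (1 + K / k)"
  have D: "D > 0" using R(2) K0 k by (simp add: D_def add_pos_nonneg)
  have gap: "\<exists>\<kappa>>0. \<forall>L L'. R \<le> L \<longrightarrow> L + d \<le> L' \<longrightarrow> Phi L' \<le> (1 - \<kappa>) * Phi L" if d: "d > 0" for d
  \<comment> \<open>The loss is (1 - exp(- d / 4)) times \<open>I L\<close>, and \<open>I L\<close>
    is at least \<open>Phi L / D\<close>.\<close>
  proof (intro exI[of _ "(1 - exp (- d / 4)) / D"] conjI allI impI)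
    show "0 < (1 - exp (- d / 4)) / D" using d D by simp
    fix L L' assume L: "R \<le> L" "L + d \<le> L'"
    have "Phi L' \<le> (LINT x'|lborel. q L x' - (1 - exp (- d / 4)) * (indicator (cball 0 L) x' * (U (L, x'))\<^sup>2))"
      unfolding Phi_def
    proof (rule Bochner_Integration.integral_mono)
      show "integrable lborel (q L')" using L d by (intro int_q) simp
      show "integrable lborel (\<lambda>x'. q L x' - (1 - exp (- d / 4)) * (indicator (cball 0 L) x' * (U (L, x'))\<^sup>2))"
        by (intro Bochner_Integration.integrable_diff integrable_mult_right int_I int_q L)
      fix x' :: 'b
      show "q L' x' \<le> q L x' - (1 - exp (- d / 4)) * (indicator (cball 0 L) x' * (U (L, x'))\<^sup>2)"
        using order_trans[OF mono[of "L + d" L' x'] strict[of L d x']] mono[of L L' x'] L d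
        by (auto simp: indicator_def)
    qed
    also have "\<dots> = Phi L - (1 - exp (- d / 4)) * I L"
      using int_I[OF L(1)] int_q[OF L(1)] by (simp add: Phi_def I_def)
    also have "\<dots> \<le> Phi L - (1 - exp (- d / 4)) * (Phi L / D)"
    proof -
      have "Phi L / D \<le> I L" using Phi_le[OF L(1)] D by (simp add: D_def[symmetric] field_simps)
      then show ?thesis using d by (intro diff_left_mono mult_left_mono) auto
    qed
    finally show "Phi L' \<le> (1 - (1 - exp (- d / 4)) / D) * Phi L" by (simp add: algebra_simps diff_divide_distrib)
  qed
  show thesis
    by (rule that[OF R(1) k int_q]) (use Phi_ge gap in \<open>simp_all add: k_def\<close>)
qed

end

section \<open>The Hamiltonian identity\<close>

lemma DERIV_zero_quadratic:
  fixes f :: "real \<Rightarrow> real"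
  assumes "\<And>h. \<bar>h\<bar> < 1 \<Longrightarrow> \<bar>f h\<bar> \<le> h\<^sup>2"
  shows "(f has_real_derivative 0) (at 0)"
proof -
  have f0: "f 0 = 0" using assms[of 0] by simp
  have "((\<lambda>h. (f (0 + h) - f 0) / h) \<longlongrightarrow> 0) (at 0)"
  proof (rule Lim_null_comparison)
    show "eventually (\<lambda>h. norm ((f (0 + h) - f 0) / h) \<le> \<bar>h\<bar>) (at 0)"
      unfolding eventually_at
    proof (intro exI[of _ 1] conjI ballI impI)
      fix h :: real assume "h \<noteq> 0 \<and> dist h 0 < 1"
      then show "norm ((f (0 + h) - f 0) / h) \<le> \<bar>h\<bar>"
        using assms[of h] by (simp add: f0 abs_divide divide_le_eq power2_eq_square abs_mult[symmetric])
    qed simp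
    show "((\<lambda>h::real. \<bar>h\<bar>) \<longlongrightarrow> 0) (at 0)"
      by (rule tendsto_rabs_zero) (rule tendsto_ident_at)
  qed
  then show ?thesis by (simp add: DERIV_def)
qed

text \<open>At 0, the only delicate point, the function is O(h^2) because p \<ge> 2.\<close>

lemma DERIV_pos_part_powr:
  fixes p :: real
  assumes "2 \<le> p"
  shows "((\<lambda>s. (max s 0) powr p) has_real_derivative p * (max s 0) powr (p - 1)) (at s)"
proof -
  consider "s > 0" | "s < 0" | "s = 0" by linarith
  then show ?thesis
  proof cases
    case 1
    have "((\<lambda>s. s powr p) has_real_derivative p * s powr (p - 1)) (at s)"
      using 1 by (rule has_real_derivative_powr)
    then have "((\<lambda>s. (max s 0) powr p) has_real_derivative p * s powr (p - 1)) (at s)"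
      by (rule has_field_derivative_transform_within_open[where S = "{0<..}"]) (use 1 in auto)
    then show ?thesis using 1 by simp
  next
    case 2
    have "((\<lambda>s. 0) has_real_derivative 0) (at s)" by simp
    then have "((\<lambda>s. (max s 0) powr p) has_real_derivative 0) (at s)"
      by (rule has_field_derivative_transform_within_open[where S = "{..<0}"]) (use 2 assms in auto)
    then show ?thesis using 2 assms by simp
  next
    case 3
    have "((\<lambda>s. (max s 0) powr p) has_real_derivative 0) (at 0)"
    proof (rule DERIV_zero_quadratic)
      fix h :: real assume h: "\<bar>h\<bar> < 1"
      show "\<bar>(max h 0) powr p\<bar> \<le> h\<^sup>2"
        using powr_le_sq[of h p] h assms by (cases "h \<ge> 0") (auto simp: max_def)
    qed
    then show ?thesis using 3 assms by simp
  qed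
qed

text \<open>Symmetry of second derivatives: differentiate \<open>\<integral> \<partial>\<^sub>b u (x + s c + \<tau> b) d\<tau>\<close> in \<open>s\<close>.\<close>

lemma C2_mixed:
  fixes u :: "'a::euclidean_space \<Rightarrow> real"
  assumes C2: "C2 u" and b: "b \<in> Basis" and c: "c \<in> Basis"
  shows "partial_deriv c (partial_deriv b u) x = partial_deriv b (partial_deriv c u) x"
proof -
  define ub uc ubc where "ub = partial_deriv b u" and "uc = partial_deriv c u"
    and "ubc = partial_deriv c (partial_deriv b u)"
  have D: "dird u b ub" "dird u c uc" "dird ub c ubc" "dird uc b (partial_deriv b uc)"
    using C2 b c by (auto simp: C2_def ub_def uc_def ubc_def intro!: dird_partial_deriv)
  have cont: "continuous_on UNIV ub" "continuous_on UNIV ubc"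
    using C2 b c by (auto simp: C2_def ub_def ubc_def intro: differentiable_imp_continuous_on)
  have ftc: "integral {-1..t} (\<lambda>\<tau>. ub (x + s *\<^sub>R c + \<tau> *\<^sub>R b)) = u (x + s *\<^sub>R c + t *\<^sub>R b) - u (x + s *\<^sub>R c + (-1) *\<^sub>R b)"
    if "-1 \<le> t" for s t
  proof (rule integral_unique, rule fundamental_theorem_of_calculus[OF that])
    fix \<tau> assume "\<tau> \<in> {-1..t}"
    show "((\<lambda>\<tau>. u (x + s *\<^sub>R c + \<tau> *\<^sub>R b)) has_vector_derivative ub (x + s *\<^sub>R c + \<tau> *\<^sub>R b)) (at \<tau> within {-1..t})"
      unfolding has_real_derivative_iff_has_vector_derivative[symmetric]
      using dird_at[OF D(1), of "x + s *\<^sub>R c" \<tau>] has_field_derivative_at_within by blast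
  qed
  have eq: "integral {-1..t} (\<lambda>\<tau>. ubc (x + \<tau> *\<^sub>R b)) = uc (x + t *\<^sub>R b) - uc (x + (-1) *\<^sub>R b)"
    if t: "-1 \<le> t" for t
  proof -
    have sw: "x + s *\<^sub>R c + \<tau> *\<^sub>R b = (x + \<tau> *\<^sub>R b) + s *\<^sub>R c" for s \<tau> by (simp add: algebra_simps)
    have "((\<lambda>s. integral (cbox (-1) t) (\<lambda>\<tau>. ub (x + s *\<^sub>R c + \<tau> *\<^sub>R b))) has_field_derivative
        integral (cbox (-1) t) (\<lambda>\<tau>. ubc (x + 0 *\<^sub>R c + \<tau> *\<^sub>R b))) (at 0 within UNIV)"
    proof (rule leibniz_rule_field_derivative[where f = "\<lambda>s \<tau>. ub (x + s *\<^sub>R c + \<tau> *\<^sub>R b)" and fx = "\<lambda>s \<tau>. ubc (x + s *\<^sub>R c + \<tau> *\<^sub>R b)"])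
      show "((\<lambda>s. ub (x + s *\<^sub>R c + \<tau> *\<^sub>R b)) has_field_derivative ubc (x + s *\<^sub>R c + \<tau> *\<^sub>R b)) (at s within UNIV)" for s \<tau>
        using dird_at[OF D(3), of "x + \<tau> *\<^sub>R b" s] by (simp add: sw)
      show "(\<lambda>\<tau>. ub (x + s *\<^sub>R c + \<tau> *\<^sub>R b)) integrable_on cbox (-1) t" for s
        by (intro integrable_continuous continuous_on_compose2[OF cont(1)] continuous_intros) auto
      show "continuous_on (UNIV \<times> cbox (-1) t) (\<lambda>(s, \<tau>). ubc (x + s *\<^sub>R c + \<tau> *\<^sub>R b))"
        unfolding split_beta by (intro continuous_on_compose2[OF cont(2)] continuous_intros) auto
    qed auto
    then have "((\<lambda>s. u (x + s *\<^sub>R c + t *\<^sub>R b) - u (x + s *\<^sub>R c + (-1) *\<^sub>R b)) has_field_derivative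
        integral {-1..t} (\<lambda>\<tau>. ubc (x + \<tau> *\<^sub>R b))) (at 0)"
      by (simp add: ftc[OF t])
    moreover have "((\<lambda>s. u (x + s *\<^sub>R c + t *\<^sub>R b) - u (x + s *\<^sub>R c + (-1) *\<^sub>R b)) has_field_derivative
        uc (x + t *\<^sub>R b) - uc (x + (-1) *\<^sub>R b)) (at 0)"
      unfolding sw using D(2) unfolding dird_def by (intro DERIV_diff) blast+
    ultimately show ?thesis by (rule DERIV_unique)
  qed
  have int: "(0::real) \<in> interior {-1..1}" by simp
  have "((\<lambda>t. integral {-1..t} (\<lambda>\<tau>. ubc (x + \<tau> *\<^sub>R b))) has_real_derivative ubc (x + 0 *\<^sub>R b)) (at 0 within {-1..1})"
    by (rule integral_has_real_derivative) (auto intro!: continuous_on_compose2[OF cont(2)] continuous_intros)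
  then have "((\<lambda>t. integral {-1..t} (\<lambda>\<tau>. ubc (x + \<tau> *\<^sub>R b))) has_real_derivative ubc x) (at 0)"
    using at_within_interior[OF int] by simp
  then have "((\<lambda>t. uc (x + t *\<^sub>R b) - uc (x + (-1) *\<^sub>R b)) has_real_derivative ubc x) (at 0)"
    by (rule has_field_derivative_transform_within_open[where S = "{-1<..<1}"]) (auto simp: eq)
  moreover have "((\<lambda>t. uc (x + t *\<^sub>R b) - uc (x + (-1) *\<^sub>R b)) has_real_derivative partial_deriv b uc x - 0) (at 0)"
    using D(4) by (intro DERIV_diff DERIV_const) (simp add: dird_def)
  ultimately have "ubc x = partial_deriv b uc x - 0" by (rule DERIV_unique)
  then show ?thesis by (simp add: ubc_def uc_def)
qed

section \<open>Differentiation under the integral and integration by parts\<close>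

lemma integrable_compact_support:
  fixes g :: "'b::euclidean_space \<Rightarrow> real"
  assumes cont: "continuous_on UNIV g" and supp: "\<And>x. x \<notin> cbox a b \<Longrightarrow> g x = 0"
  shows "integrable lborel g" "integral (cbox a b) g = (LINT x|lborel. g x)"
proof -
  have eq: "(\<lambda>x. indicator (cbox a b) x *\<^sub>R g x) = g"
    using supp by (auto simp: indicator_def fun_eq_iff)
  show i: "integrable lborel g"
    using borel_integrable_compact[OF compact_cbox continuous_on_subset[OF cont subset_UNIV], of a b] by (simp only: eq)
  have "(\<lambda>x. if x \<in> cbox a b then g x else 0) = g" using supp by auto
  then show "integral (cbox a b) g = (LINT x|lborel. g x)"
    using integral_restrict_UNIV[of "cbox a b" g] integral_lborel[OF i] by simp
qed

text \<open>The Leibniz rule is applied to gauge integrals over one fixed box; compact support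
  identifies these with Lebesgue integrals over the whole space.\<close>

lemma DERIV_integral_compact_support:
  fixes F F' :: "real \<Rightarrow> 'b::euclidean_space \<Rightarrow> real"
  assumes der: "\<And>t x. t \<in> T \<Longrightarrow> ((\<lambda>t. F t x) has_real_derivative F' t x) (at t)"
    and cont: "\<And>t. t \<in> T \<Longrightarrow> continuous_on UNIV (F t)"
    and cont': "continuous_on (T \<times> UNIV) (\<lambda>(t, x). F' t x)"
    and supp: "\<And>t x. t \<in> T \<Longrightarrow> norm x > r \<Longrightarrow> F t x = 0 \<and> F' t x = 0"
    and T: "open T" "convex T" "t \<in> T"
  shows "((\<lambda>t. LINT x|lborel. F t x) has_real_derivative (LINT x|lborel. F' t x)) (at t)"
proof -
  obtain a where a: "cball (0::'b) r \<subseteq> cbox (- a) a"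
    using bounded_subset_cbox_symmetric[OF bounded_cball] by blast
  have out: "norm x > r" if "x \<notin> cbox (- a) a" for x using a that by (metis mem_cball_0 not_le subsetD)
  have c': "continuous_on UNIV (F' s)" if "s \<in> T" for s
  proof -
    have "continuous_on UNIV (\<lambda>x. case (s, x) of (t, x) \<Rightarrow> F' t x)"
      by (rule continuous_on_compose2[OF cont']) (use that in \<open>auto intro!: continuous_intros\<close>)
    then show ?thesis by simp
  qed
  have "((\<lambda>t. integral (cbox (- a) a) (F t)) has_field_derivative integral (cbox (- a) a) (F' t)) (at t within T)"
    by (rule leibniz_rule_field_derivative)
      (auto intro: has_field_derivative_at_within der integrable_continuous continuous_on_subset[OF cont]
        continuous_on_subset[OF cont'] T)
  then have "((\<lambda>t. integral (cbox (- a) a) (F t)) has_field_derivative integral (cbox (- a) a) (F' t)) (at t)"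
    using at_within_open[OF T(3,1)] by simp
  then have "((\<lambda>t. LINT x|lborel. F t x) has_field_derivative integral (cbox (- a) a) (F' t)) (at t)"
  proof (rule has_field_derivative_transform_within_open[OF _ T(1,3)])
    fix s assume s: "s \<in> T"
    show "integral (cbox (- a) a) (F s) = (LINT x|lborel. F s x)"
      by (rule integrable_compact_support(2)[OF cont[OF s]]) (use supp[OF s] out in blast)
  qed
  moreover have "integral (cbox (- a) a) (F' t) = (LINT x|lborel. F' t x)"
    by (rule integrable_compact_support(2)[OF c'[OF T(3)]]) (use supp[OF T(3)] out in blast)
  ultimately show ?thesis by simp
qed

lemma lborel_integral_translate:
  fixes g :: "'b::euclidean_space \<Rightarrow> real"
  assumes "g \<in> borel_measurable borel"
  shows "(LINT x|lborel. g (x + c)) = (LINT x|lborel. g x)"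
proof -
  have "(LINT x|lborel. g x) = (LINT x|distr lborel borel ((+) c). g x)"
    by (simp add: lborel_distr_plus)
  also have "\<dots> = (LINT x|lborel. g (c + x))"
    by (rule integral_distr) (use assms in simp_all)
  finally show ?thesis by (simp add: add.commute)
qed

text \<open>By translation invariance the integral of g(x + t b) over x does not depend on t, and
  its derivative at t = 0 is the integral in question. This takes the place of Fubini's theorem and
  the fundamental theorem of calculus.\<close>

lemma integral_partial_zero:
  fixes g :: "'b::euclidean_space \<Rightarrow> real"
  assumes d: "dird g b g'" and b: "b \<in> Basis" and cont: "continuous_on UNIV g" "continuous_on UNIV g'"
    and supp: "\<And>x. norm x > r \<Longrightarrow> g x = 0 \<and> g' x = 0"
  shows "(LINT x|lborel. g' x) = 0"
proof -
  have "((\<lambda>t. LINT x|lborel. g (x + t *\<^sub>R b)) has_real_derivative (LINT x|lborel. g' (x + 0 *\<^sub>R b))) (at 0)"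
  proof (rule DERIV_integral_compact_support[where T = "{-1<..<1}" and r = "r + 1"])
    show "((\<lambda>t. g (x + t *\<^sub>R b)) has_real_derivative g' (x + t *\<^sub>R b)) (at t)" for x t
      by (rule dird_at[OF d])
    show "continuous_on UNIV (\<lambda>x. g (x + t *\<^sub>R b))" for t
      by (intro continuous_on_compose2[OF cont(1)] continuous_intros) auto
    show "continuous_on ({-1<..<1} \<times> UNIV) (\<lambda>(t, x). g' (x + t *\<^sub>R b))"
      unfolding split_beta by (intro continuous_on_compose2[OF cont(2)] continuous_intros) auto
    fix t :: real and x :: 'b assume t: "t \<in> {-1<..<1}" and x: "norm x > r + 1"
    have "norm x \<le> norm (x + t *\<^sub>R b) + norm (t *\<^sub>R b)"
      using norm_triangle_ineq4[of "x + t *\<^sub>R b" "t *\<^sub>R b"] by simp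
    moreover have "norm (t *\<^sub>R b) < 1" using t b by auto
    ultimately show "g (x + t *\<^sub>R b) = 0 \<and> g' (x + t *\<^sub>R b) = 0"
      using x by (intro supp) linarith
  qed auto
  moreover have "(LINT x|lborel. g (x + t *\<^sub>R b)) = (LINT x|lborel. g x)" for t
    by (rule lborel_integral_translate) (rule borel_measurable_continuous_onI[OF cont(1)])
  ultimately have "((\<lambda>t. LINT x|lborel. g x) has_real_derivative (LINT x|lborel. g' x)) (at 0)" by simp
  then show ?thesis using DERIV_unique[OF _ DERIV_const] by blast
qed

lemma sum_Basis_real_prod:
  fixes f :: "real \<times> 'b::euclidean_space \<Rightarrow> real"
  shows "(\<Sum>b\<in>Basis. f b) = f (1, 0) + (\<Sum>b\<in>Basis. f (0, b))"
proof -
  have "(\<Sum>b\<in>Basis. f b) = (\<Sum>b\<in>insert (1, 0) (Pair 0 ` Basis). f b)"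
    by (rule sum.cong) (auto simp: Basis_prod_def)
  also have "\<dots> = f (1, 0) + (\<Sum>b\<in>Pair 0 ` Basis. f b)"
    by (rule sum.insert) auto
  also have "(\<Sum>b\<in>Pair 0 ` Basis. f b) = (\<Sum>b\<in>Basis. f (0, b))"
    by (simp add: sum.reindex inj_on_def)
  finally show ?thesis .
qed

section \<open>The conserved quantity\<close>

definition ham :: "real \<Rightarrow> (real \<times> 'b::euclidean_space \<Rightarrow> real) \<Rightarrow> real \<times> 'b \<Rightarrow> real" where
  "ham p u x = (partial_deriv (1, 0) u x)\<^sup>2 - (\<Sum>b\<in>Basis. (partial_deriv (0, b) u x)\<^sup>2) - (u x)\<^sup>2
     + 2 / (p + 1) * (max (u x) 0) powr (p + 1)"

text \<open>The bound is quadratic in \<open>K\<close>, so exponential decay of \<open>u\<close> and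
  its gradient passes to \<open>ham\<close> at twice the rate; the cap \<open>C\<close> only tames
  the term of order p + 1.\<close>

lemma ham_bound:
  fixes u :: "real \<times> 'b::euclidean_space \<Rightarrow> real"
  assumes p: "2 \<le> p" and u: "0 \<le> u x" "u x \<le> K" "\<And>b. b \<in> Basis \<Longrightarrow> \<bar>partial_deriv b u x\<bar> \<le> K" and K: "K \<le> C"
  shows "\<bar>ham p u x\<bar> \<le> (DIM('b) + 2 + C powr (p - 1)) * K\<^sup>2"
proof -
  have K0: "0 \<le> K" using u by linarith
  have sq: "(partial_deriv b u x)\<^sup>2 \<le> K\<^sup>2" if "b \<in> Basis" for b
    using u(3)[OF that] K0 by (simp add: abs_le_square_iff[symmetric])
  have 1: "(partial_deriv (1, 0) u x)\<^sup>2 \<le> K\<^sup>2" by (rule sq) (simp add: Basis_prod_def)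
  have "(\<Sum>b\<in>(Basis::'b set). (partial_deriv (0, b) u x)\<^sup>2) \<le> (\<Sum>b\<in>(Basis::'b set). K\<^sup>2)"
    by (rule sum_mono, rule sq) (simp add: Basis_prod_def)
  then have 2: "(\<Sum>b\<in>(Basis::'b set). (partial_deriv (0, b) u x)\<^sup>2) \<le> DIM('b) * K\<^sup>2" by simp
  have 3: "(u x)\<^sup>2 \<le> K\<^sup>2" using u by (simp add: power_mono)
  have "u x powr (p + 1) = u x powr (p - 1) * (u x)\<^sup>2"
    using u(1) powr_add[of "u x" "p - 1" 2] by (simp add: powr_numeral add.commute)
  also have "\<dots> \<le> C powr (p - 1) * K\<^sup>2"
    using u K p 3 by (intro mult_mono powr_mono2) auto
  finally have "u x powr (p + 1) \<le> C powr (p - 1) * K\<^sup>2" .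
  moreover have "2 / (p + 1) \<le> 1" "0 \<le> 2 / (p + 1)" using p by simp_all
  ultimately have 4: "2 / (p + 1) * u x powr (p + 1) \<le> 1 * (C powr (p - 1) * K\<^sup>2)"
    by (intro mult_mono) auto
  have 5: "0 \<le> 2 / (p + 1) * u x powr (p + 1)" using p by simp
  have 6: "0 \<le> (\<Sum>b\<in>(Basis::'b set). (partial_deriv (0, b) u x)\<^sup>2)" by (intro sum_nonneg) simp
  have arith: "\<bar>a - s - w + v\<bar> \<le> (n + 2 + c) * k"
    if "v \<le> 1 * (c * k)" "0 \<le> v" "0 \<le> s" "a \<le> k" "s \<le> n * k" "w \<le> k" "0 \<le> a" "0 \<le> w" for a s w v n c k :: real
  proof -
    have "(n + 2 + c) * k = n * k + 2 * k + c * k" by (simp add: algebra_simps)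
    then show ?thesis using that by linarith
  qed
  have "max (u x) 0 = u x" using u(1) by simp
  then show ?thesis
    using arith[OF 4 5 6 1 2 3 zero_le_power2 zero_le_power2] by (simp add: ham_def add.commute)
qed

lemma ham_continuous:
  fixes u :: "real \<times> 'b::euclidean_space \<Rightarrow> real"
  assumes C2: "C2 u" and p: "2 \<le> p"
  shows "continuous_on UNIV (ham p u)"
proof -
  have u: "continuous_on UNIV u" using C2 by (auto simp: C2_def intro: differentiable_imp_continuous_on)
  have pd: "continuous_on UNIV (partial_deriv b u)" if "b \<in> Basis" for b
    using C2 that by (auto simp: C2_def intro: differentiable_imp_continuous_on)
  have B: "(1, 0) \<in> (Basis :: (real \<times> 'b) set)" "\<And>b. b \<in> Basis \<Longrightarrow> (0::real, b::'b) \<in> Basis"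
    by (auto simp: Basis_prod_def)
  have "continuous_on UNIV (\<lambda>x. (max (u x) 0) powr (p + 1))"
    by (rule continuous_on_powr') (use p in \<open>auto intro!: continuous_intros u\<close>)
  from continuous_on_mult_left[OF this] show ?thesis unfolding ham_def
    by (intro continuous_on_add continuous_on_diff continuous_on_sum continuous_on_power u pd B)
qed

text \<open>The equation replaces u_11, the terms in u u_1 and u^p u_1 cancel, and by symmetry of
  the mixed derivatives -2 div'(u_1 grad' u) remains. Being a divergence in x', it integrates to 0
  over a slice.\<close>

lemma ham_dird:
  fixes u :: "real \<times> 'b::euclidean_space \<Rightarrow> real"
  assumes C2: "C2 u" and p: "2 \<le> p" and u0: "\<And>x. 0 \<le> u x"
    and pde: "\<And>x. laplacian u x = u x - u x powr p"
  shows "dird (ham p u) (1, 0) (\<lambda>x. - 2 * (\<Sum>b\<in>Basis.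
    partial_deriv (0, b) (partial_deriv (1, 0) u) x * partial_deriv (0, b) u x +
    partial_deriv (1, 0) u x * partial_deriv (0, b) (partial_deriv (0, b) u) x))"
proof -
  let ?e = "(1, 0) :: real \<times> 'b"
  have B: "?e \<in> Basis" "\<And>b. b \<in> Basis \<Longrightarrow> (0::real, b::'b) \<in> Basis" by (auto simp: Basis_prod_def)
  have D: "dird u ?e (partial_deriv ?e u)" "\<And>b. b \<in> Basis \<Longrightarrow> dird (partial_deriv b u) ?e (partial_deriv ?e (partial_deriv b u))"
    using C2 by (auto simp: C2_def intro!: dird_partial_deriv)
  have sq: "((\<lambda>s. s\<^sup>2) has_real_derivative 2 * s) (at s)" for s :: real
    by (auto intro!: derivative_eq_intros)
  have pw: "((\<lambda>s. 2 / (p + 1) * (max s 0) powr (p + 1)) has_real_derivative 2 * (max s 0) powr p) (at s)" for s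
    using DERIV_cmult[OF DERIV_pos_part_powr[of "p + 1" s], of "2 / (p + 1)"] p by simp
  have "dird (ham p u) ?e (\<lambda>x. 2 * partial_deriv ?e u x * partial_deriv ?e (partial_deriv ?e u) x
      - (\<Sum>b\<in>Basis. 2 * partial_deriv (0, b) u x * partial_deriv ?e (partial_deriv (0, b) u) x)
      - 2 * u x * partial_deriv ?e u x + 2 * (max (u x) 0) powr p * partial_deriv ?e u x)"
    unfolding ham_def
  proof (intro dird_add dird_diff dird_sum)
    show "dird (\<lambda>x. (partial_deriv ?e u x)\<^sup>2) ?e (\<lambda>x. 2 * partial_deriv ?e u x * partial_deriv ?e (partial_deriv ?e u) x)"
      using dird_compose[where g' = "\<lambda>x. 2 * partial_deriv ?e u x", OF D(2)[OF B(1)] sq] .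
    show "dird (\<lambda>x. (partial_deriv (0, b) u x)\<^sup>2) ?e (\<lambda>x. 2 * partial_deriv (0, b) u x * partial_deriv ?e (partial_deriv (0, b) u) x)"
      if "b \<in> Basis" for b :: 'b
      using dird_compose[where g' = "\<lambda>x. 2 * partial_deriv (0, b) u x", OF D(2)[OF B(2)[OF that]] sq] .
    show "dird (\<lambda>x. (u x)\<^sup>2) ?e (\<lambda>x. 2 * u x * partial_deriv ?e u x)"
      using dird_compose[where g' = "\<lambda>x. 2 * u x", OF D(1) sq] .
    show "dird (\<lambda>x. 2 / (p + 1) * (max (u x) 0) powr (p + 1)) ?e (\<lambda>x. 2 * (max (u x) 0) powr p * partial_deriv ?e u x)"
      using dird_compose[where g' = "\<lambda>x. 2 * (max (u x) 0) powr p", OF D(1) pw] .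
  qed simp
  moreover have "2 * partial_deriv ?e u x * partial_deriv ?e (partial_deriv ?e u) x
      - (\<Sum>b\<in>Basis. 2 * partial_deriv (0, b) u x * partial_deriv ?e (partial_deriv (0, b) u) x)
      - 2 * u x * partial_deriv ?e u x + 2 * (max (u x) 0) powr p * partial_deriv ?e u x =
      - 2 * (\<Sum>b\<in>Basis. partial_deriv (0, b) (partial_deriv ?e u) x * partial_deriv (0, b) u x +
        partial_deriv ?e u x * partial_deriv (0, b) (partial_deriv (0, b) u) x)" for x
  proof -
    have f1: "partial_deriv ?e (partial_deriv ?e u) x = u x - u x powr p - (\<Sum>b\<in>Basis. partial_deriv (0, b) (partial_deriv (0, b) u) x)"
      using pde[of x] unfolding laplacian_def sum_Basis_real_prod by simp
    have f2: "(\<Sum>b\<in>Basis. 2 * partial_deriv (0, b) u x * partial_deriv ?e (partial_deriv (0, b) u) x)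
        = 2 * (\<Sum>b\<in>Basis. partial_deriv (0, b) (partial_deriv ?e u) x * partial_deriv (0, b) u x)"
      unfolding sum_distrib_left
      by (rule sum.cong) (simp_all add: C2_mixed[OF C2 B(2) B(1)] mult_ac)
    have f3: "max (u x) 0 = u x" using u0 by simp
    have f4: "(\<Sum>b\<in>Basis. partial_deriv (0, b) (partial_deriv ?e u) x * partial_deriv (0, b) u x +
        partial_deriv ?e u x * partial_deriv (0, b) (partial_deriv (0, b) u) x)
      = (\<Sum>b\<in>Basis. partial_deriv (0, b) (partial_deriv ?e u) x * partial_deriv (0, b) u x) +
        partial_deriv ?e u x * (\<Sum>b\<in>Basis. partial_deriv (0, b) (partial_deriv (0, b) u) x)"
      by (simp add: sum.distrib sum_distrib_left)
    show ?thesis unfolding f1 f2 f3 f4 by (simp add: algebra_simps)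
  qed
  ultimately show ?thesis by simp
qed

text \<open>The squared positive part of 1 - |x|^2 / r^2 is C1, which suffices for one integration
  by parts; its gradient is O(1 / r), and the closed form makes the limit of large r
  explicit.\<close>

lemma cutoff:
  fixes r :: real
  assumes r: "r > 0"
  obtains \<psi> :: "'b::euclidean_space \<Rightarrow> real" and \<psi>' where
    "continuous_on UNIV \<psi>" "\<And>b. continuous_on UNIV (\<psi>' b)" "\<And>b. b \<in> Basis \<Longrightarrow> dird \<psi> b (\<psi>' b)"
    "\<And>x. 0 \<le> \<psi> x \<and> \<psi> x \<le> 1" "\<And>x. norm x > r \<Longrightarrow> \<psi> x = 0" "\<And>b x. norm x > r \<Longrightarrow> \<psi>' b x = 0"
    "\<And>b x. b \<in> Basis \<Longrightarrow> \<bar>\<psi>' b x\<bar> \<le> 4 / r" "\<And>x. \<psi> x = (max (1 - (norm x)\<^sup>2 / r\<^sup>2) 0)\<^sup>2"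
proof
  define m where "m = (\<lambda>x::'b. max (1 - (norm x)\<^sup>2 / r\<^sup>2) 0)"
  define \<psi>' where "\<psi>' = (\<lambda>b x. 2 * m x * (- (2 * (x \<bullet> b)) / r\<^sup>2))"
  have m: "0 \<le> m x" "m x \<le> 1" for x by (auto simp: m_def)
  have m0: "m x = 0" if "norm x > r" for x
  proof -
    have "r\<^sup>2 \<le> (norm x)\<^sup>2" using that r by (intro power_mono) auto
    then show ?thesis using r by (simp add: m_def)
  qed
  have cm: "continuous_on UNIV m" unfolding m_def using r by (intro continuous_intros) auto
  show "continuous_on UNIV (\<lambda>x::'b. (max (1 - (norm x)\<^sup>2 / r\<^sup>2) 0)\<^sup>2)"
    using cm unfolding m_def by (rule continuous_on_power)
  show "continuous_on UNIV (\<psi>' b)" for b unfolding \<psi>'_def using r by (intro continuous_intros cm) auto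
  show  "dird (\<lambda>x::'b. (max (1 - (norm x)\<^sup>2 / r\<^sup>2) 0)\<^sup>2) b (\<psi>' b)" if b: "b \<in> Basis" for b
  proof -
    have "dird (\<lambda>x::'b. (norm (x - 0))\<^sup>2) b (\<lambda>x. 2 * ((x - 0) \<bullet> b))"
      using has_lap_norm_sq[of "0::'b"] b unfolding has_lap_def by blast
    then have 1: "dird (\<lambda>x. 1 - (norm x)\<^sup>2 / r\<^sup>2) b (\<lambda>x. - (2 * (x \<bullet> b)) / r\<^sup>2)"
      using dird_diff[OF dird_const[of 1 b] dird_cmult[of "\<lambda>x. (norm x)\<^sup>2" b _ "1 / r\<^sup>2"]] by simp
    have "((\<lambda>s::real. (max s 0)\<^sup>2) has_real_derivative 2 * max s 0) (at s)" for s
      using DERIV_pos_part_powr[of 2 s] by (simp add: powr_numeral)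
    from dird_compose[where g' = "\<lambda>x. 2 * max (1 - (norm x)\<^sup>2 / r\<^sup>2) 0", OF 1 this]
    show ?thesis unfolding \<psi>'_def m_def .
  qed
  show "0 \<le> (max (1 - (norm x)\<^sup>2 / r\<^sup>2) 0)\<^sup>2 \<and> (max (1 - (norm x)\<^sup>2 / r\<^sup>2) 0)\<^sup>2 \<le> 1" for x :: 'b
    using m[of x] by (simp add: m_def power_le_one)
  show "(max (1 - (norm x)\<^sup>2 / r\<^sup>2) 0)\<^sup>2 = 0" if "norm x > r" for x :: 'b
    using m0[OF that] by (simp add: m_def)
  show "\<psi>' b x = 0" if "norm x > r" for b x using m0[OF that] by (simp add: \<psi>'_def)
  show "\<bar>\<psi>' b x\<bar> \<le> 4 / r" if b: "b \<in> Basis" for b x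
  proof (cases "norm x > r")
    case False
    have "\<bar>x \<bullet> b\<bar> \<le> r" using Basis_le_norm[OF b, of x] False by simp
    then have "m x * \<bar>x \<bullet> b\<bar> \<le> 1 * r" using m[of x] by (intro mult_mono) auto
    then have "4 * (m x * \<bar>x \<bullet> b\<bar>) / r\<^sup>2 \<le> 4 * r / r\<^sup>2" by (intro divide_right_mono) auto
    also have "4 * r / r\<^sup>2 = 4 / r" using r by (simp add: power2_eq_square)
    also have "4 * (m x * \<bar>x \<bullet> b\<bar>) / r\<^sup>2 = \<bar>\<psi>' b x\<bar>"
      using m[of x] by (simp add: \<psi>'_def abs_mult)
    finally show ?thesis .
  qed (use m0 r in \<open>simp add: \<psi>'_def\<close>)
qed simp

text \<open>With a cutoff \<psi> of radius \<open>r\<close>, the derivative of the slice integral in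
  t is twice the integral of u_1 (grad' \<psi> \<bullet> grad' u), which the decay of the gradient
  bounds by a constant over r. The mean value theorem on \<open>t1\<close>, \<open>t2\<close> and
  dominated convergence then let r tend to infinity.\<close>

lemma ham_integral_const:
  fixes u :: "real \<times> 'b::euclidean_space \<Rightarrow> real"
  assumes C2: "C2 u" and p: "2 \<le> p" and u0: "\<And>x. 0 \<le> u x"
    and pde: "\<And>x. laplacian u x = u x - u x powr p" and c: "c > 0" and t12: "t1 < t2"
    and decay: "\<And>t x. t \<in> {t1..t2} \<Longrightarrow> u (t, x) \<le> C * exp (- c * norm x)"
      "\<And>t x b. t \<in> {t1..t2} \<Longrightarrow> b \<in> Basis \<Longrightarrow> \<bar>partial_deriv b u (t, x)\<bar> \<le> C * exp (- c * norm x)"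
  shows "(LINT x|lborel. ham p u (t1, x)) = (LINT x|lborel. ham p u (t2, x))"
proof -
  let ?e = "(1, 0) :: real \<times> 'b"
  have B: "?e \<in> Basis" "\<And>b. b \<in> Basis \<Longrightarrow> (0::real, b::'b) \<in> Basis" by (auto simp: Basis_prod_def)
  have C0: "C \<ge> 0" using order_trans[OF u0 decay(1)[of t1 0]] t12 by simp
  have cont1: "continuous_on UNIV (partial_deriv b u)" if "b \<in> Basis" for b
    using C2 that by (auto simp: C2_def intro: differentiable_imp_continuous_on)
  have cont2: "continuous_on UNIV (partial_deriv b' (partial_deriv b u))" if "b \<in> Basis" "b' \<in> Basis" for b b'
    using C2 that by (auto simp: C2_def)
  note cont_ham = ham_continuous[OF C2 p]
  define h1 where "h1 = (\<lambda>x. - 2 * (\<Sum>b\<in>Basis.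
    partial_deriv (0, b) (partial_deriv ?e u) x * partial_deriv (0, b) u x +
    partial_deriv ?e u x * partial_deriv (0, b) (partial_deriv (0, b) u) x))"
  have dham: "dird (ham p u) ?e h1" unfolding h1_def by (rule ham_dird[OF C2 p u0 pde])
  have cont_h1: "continuous_on UNIV h1" unfolding h1_def
    by (intro continuous_intros cont1 cont2 B) auto
  have slice: "continuous_on UNIV (\<lambda>x. f (t, x))" if "continuous_on UNIV f" for f :: "real \<times> 'b \<Rightarrow> real" and t
    by (rule continuous_on_compose2[OF that]) (auto intro!: continuous_intros)
  define A where "A = (DIM('b) + 2 + C powr (p - 1)) * C\<^sup>2"
  have ham_le: "\<bar>ham p u (t, x)\<bar> \<le> A * exp (- (2 * c) * norm x)" if t: "t \<in> {t1..t2}" for t x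
  proof -
    have "C * exp (- c * norm x) \<le> C * 1" using C0 c by (intro mult_left_mono) auto
    then have "\<bar>ham p u (t, x)\<bar> \<le> (DIM('b) + 2 + C powr (p - 1)) * (C * exp (- c * norm x))\<^sup>2"
      by (intro ham_bound[OF p u0 decay(1)[OF t] decay(2)[OF t]]) auto
    also have "\<dots> = A * exp (- (2 * c) * norm x)"
      by (simp add: A_def power_mult_distrib exp_double[symmetric] mult.assoc)
    finally show ?thesis .
  qed
  define M where "M = C\<^sup>2 * (LINT x|lborel. exp (- (2 * c) * norm (x::'b)))"
  have key: "\<bar>(LINT x|lborel. (max (1 - (norm x)\<^sup>2 / r\<^sup>2) 0)\<^sup>2 * ham p u (t2, x)) -
      (LINT x|lborel. (max (1 - (norm x)\<^sup>2 / r\<^sup>2) 0)\<^sup>2 * ham p u (t1, x))\<bar> \<le> (t2 - t1) * (2 * DIM('b) * (4 / r * M))"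
    if r: "r > 0" for r
  proof -
    obtain \<psi> :: "'b \<Rightarrow> real" and \<psi>' where \<psi>: "continuous_on UNIV \<psi>" "\<And>b. continuous_on UNIV (\<psi>' b)"
      "\<And>b. b \<in> Basis \<Longrightarrow> dird \<psi> b (\<psi>' b)"
      "\<And>x. 0 \<le> \<psi> x \<and> \<psi> x \<le> 1" "\<And>x. norm x > r \<Longrightarrow> \<psi> x = 0" "\<And>b x. norm x > r \<Longrightarrow> \<psi>' b x = 0"
      "\<And>b x. b \<in> Basis \<Longrightarrow> \<bar>\<psi>' b x\<bar> \<le> 4 / r" "\<And>x. \<psi> x = (max (1 - (norm x)\<^sup>2 / r\<^sup>2) 0)\<^sup>2"
      using cutoff[OF r] by blast
    define F where "F = (\<lambda>t. LINT x|lborel. \<psi> x * ham p u (t, x))"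
    define F' where "F' = (\<lambda>t. LINT x|lborel. \<psi> x * h1 (t, x))"
    have DF: "(F has_real_derivative F' t) (at t)" for t
      unfolding F_def F'_def
    proof (rule DERIV_integral_compact_support[where T = UNIV and r = r])
      show "((\<lambda>t. \<psi> x * ham p u (t, x)) has_real_derivative \<psi> x * h1 (t, x)) (at t)" for t x
        using dird_at[OF dham, of "(0, x)" t] by (intro DERIV_cmult) simp
      show "continuous_on UNIV (\<lambda>x. \<psi> x * ham p u (t, x))" for t
        by (intro continuous_intros \<psi>(1) slice cont_ham)
      show "continuous_on (UNIV \<times> UNIV) (\<lambda>(t, x). \<psi> x * h1 (t, x))"
        unfolding split_beta
        by (intro continuous_intros continuous_on_compose2[OF \<psi>(1)] continuous_on_compose2[OF cont_h1]) auto
    qed (use \<psi>(5) in auto)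
    have F'_le: "\<bar>F' t\<bar> \<le> 2 * DIM('b) * (4 / r * M)" if t: "t \<in> {t1..t2}" for t
    proof -
      define f where "f = (\<lambda>b x. partial_deriv ?e u (t, x) * partial_deriv (0, b) u (t, x))"
      define f' where "f' = (\<lambda>b x. partial_deriv (0, b) (partial_deriv ?e u) (t, x) * partial_deriv (0, b) u (t, x) +
        partial_deriv ?e u (t, x) * partial_deriv (0, b) (partial_deriv (0, b) u) (t, x))"
      have cf: "continuous_on UNIV (f b)" "continuous_on UNIV (f' b)" if "b \<in> Basis" for b
        unfolding f_def f'_def by (intro continuous_intros slice cont1 cont2 B that)+
      have df: "dird (f b) b (f' b)" if b: "b \<in> Basis" for b
      proof -
        have sl: "dird (\<lambda>x. g (t, x)) b (\<lambda>x. g' (t, x))" if "dird g (0, b) g'" for g g'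
          unfolding dird_def
        proof
          fix x
          have "((\<lambda>s. g ((t, x) + s *\<^sub>R (0, b))) has_real_derivative g' (t, x)) (at 0)"
            using that unfolding dird_def by blast
          then show "((\<lambda>s. g (t, x + s *\<^sub>R b)) has_real_derivative g' (t, x)) (at 0)" by simp
        qed
        have "dird (partial_deriv b' u) (0, b) (partial_deriv (0, b) (partial_deriv b' u))" if "b' \<in> Basis" for b'
          using C2 that by (auto simp: C2_def intro!: dird_partial_deriv)
        then show ?thesis unfolding f_def f'_def
          by (intro dird_mult sl) (use B b in auto)
      qed
      have int: "integrable lborel (\<lambda>x. g x * k x)"
        if g: "continuous_on UNIV g" "\<And>x. norm x > r \<Longrightarrow> g x = 0" and k: "continuous_on UNIV k" for g k :: "'b \<Rightarrow> real"
      proof -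
        obtain a where a: "cball (0::'b) r \<subseteq> cbox (- a) a"
          using bounded_subset_cbox_symmetric[OF bounded_cball] by blast
        have "g x * k x = 0" if "x \<notin> cbox (- a) a" for x
          using a that g(2)[of x] by (metis mem_cball_0 mult_zero_left not_le subsetD)
        then show ?thesis by (intro integrable_compact_support(1)[of _ "- a" a] continuous_intros g k)
      qed
      have zero: "(LINT x|lborel. \<psi> x * f' b x) = - (LINT x|lborel. \<psi>' b x * f b x)" if b: "b \<in> Basis" for b
      proof -
        have "(LINT x|lborel. \<psi>' b x * f b x + \<psi> x * f' b x) = 0"
          by (rule integral_partial_zero[where g = "\<lambda>x. \<psi> x * f b x" and b = b and r = r])
            (use b \<psi>(5,6) in \<open>auto intro!: dird_mult df \<psi>(3) continuous_intros \<psi>(1,2) cf\<close>)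
        moreover have "(LINT x|lborel. \<psi>' b x * f b x + \<psi> x * f' b x) = (LINT x|lborel. \<psi>' b x * f b x) + (LINT x|lborel. \<psi> x * f' b x)"
          by (rule Bochner_Integration.integral_add) (intro int \<psi>(1,2,5,6) cf b; simp)+
        ultimately show ?thesis by simp
      qed
      have le: "\<bar>LINT x|lborel. \<psi>' b x * f b x\<bar> \<le> 4 / r * M" if b: "b \<in> Basis" for b
      proof -
        have "\<bar>LINT x|lborel. \<psi>' b x * f b x\<bar> \<le> (LINT x|lborel. \<bar>\<psi>' b x * f b x\<bar>)"
          by (rule integral_abs_bound)
        also have "\<dots> \<le> (LINT x|lborel. 4 / r * (C\<^sup>2 * exp (- (2 * c) * norm (x::'b))))"
        proof (rule Bochner_Integration.integral_mono)
          show "integrable lborel (\<lambda>x. \<bar>\<psi>' b x * f b x\<bar>)"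
            by (intro integrable_abs int \<psi>(2,6) cf b) simp
          show "integrable lborel (\<lambda>x::'b. 4 / r * (C\<^sup>2 * exp (- (2 * c) * norm x)))"
            using integrable_exp_norm[where 'a = 'b, of "2 * c"] c by (intro integrable_mult_right) auto
          fix x
          have "\<bar>f b x\<bar> \<le> (C * exp (- c * norm x)) * (C * exp (- c * norm x))"
            unfolding f_def abs_mult using b by (intro mult_mono decay(2)[OF t] B) (auto simp: C0)
          also have "\<dots> = C\<^sup>2 * exp (- (2 * c) * norm x)"
            by (simp add: power2_eq_square exp_add[symmetric])
          finally show "\<bar>\<psi>' b x * f b x\<bar> \<le> 4 / r * (C\<^sup>2 * exp (- (2 * c) * norm x))"
            unfolding abs_mult using \<psi>(7)[OF b, of x] r by (intro mult_mono) auto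
        qed
        also have "\<dots> = 4 / r * M" by (simp add: M_def)
        finally show ?thesis .
      qed
      have "F' t = (LINT x|lborel. (\<Sum>b\<in>Basis. -2 * (\<psi> x * f' b x)))"
        unfolding F'_def h1_def f'_def by (simp add: sum_distrib_left mult_ac)
      also have "\<dots> = (\<Sum>b\<in>Basis. LINT x|lborel. -2 * (\<psi> x * f' b x))"
        by (rule Bochner_Integration.integral_sum) (intro integrable_mult_right int \<psi>(1,5) cf)
      also have "\<dots> = (\<Sum>b\<in>Basis. 2 * (LINT x|lborel. \<psi>' b x * f b x))"
        by (rule sum.cong) (simp_all add: zero)
      finally have "\<bar>F' t\<bar> \<le> (\<Sum>b\<in>(Basis::'b set). \<bar>2 * (LINT x|lborel. \<psi>' b x * f b x)\<bar>)"
        using sum_abs by simp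
      also have "\<dots> \<le> (\<Sum>b\<in>(Basis::'b set). 2 * (4 / r * M))"
      proof (rule sum_mono)
        fix b :: 'b assume "b \<in> Basis"
        from le[OF this] show "\<bar>2 * (LINT x|lborel. \<psi>' b x * f b x)\<bar> \<le> 2 * (4 / r * M)"
          unfolding abs_mult by (simp only: abs_numeral)
      qed
      finally show ?thesis by (simp add: mult_ac)
    qed
    obtain z where z: "t1 < z" "z < t2" "F t2 - F t1 = (t2 - t1) * F' z"
      using MVT2[OF t12, of F F'] DF by blast
    then have "\<bar>F t2 - F t1\<bar> \<le> (t2 - t1) * (2 * DIM('b) * (4 / r * M))"
      unfolding z(3) abs_mult using F'_le[of z] z(1,2) t12 by (intro mult_mono) auto
    then show ?thesis by (simp add: F_def \<psi>(8))
  qed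
  define H where "H = (\<lambda>k::nat. \<lambda>t. LINT x|lborel. (max (1 - (norm x)\<^sup>2 / (real (Suc k))\<^sup>2) 0)\<^sup>2 * ham p u (t, x))"
  have lim: "(\<lambda>k. H k t) \<longlonglongrightarrow> (LINT x|lborel. ham p u (t, x))" if t: "t \<in> {t1..t2}" for t
    unfolding H_def
  proof (rule integral_dominated_convergence[where w = "\<lambda>x. A * exp (- (2 * c) * norm x)"])
    show "(\<lambda>x. ham p u (t, x)) \<in> borel_measurable lborel"
      using borel_measurable_continuous_onI[OF slice[OF cont_ham]] by simp
    show "(\<lambda>x. (max (1 - (norm x)\<^sup>2 / (real (Suc k))\<^sup>2) 0)\<^sup>2 * ham p u (t, x)) \<in> borel_measurable lborel" for k
    proof -
      have "continuous_on UNIV (\<lambda>x. (max (1 - (norm x)\<^sup>2 / (real (Suc k))\<^sup>2) 0)\<^sup>2 * ham p u (t, x))"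
        by (intro continuous_intros slice cont_ham) auto
      from borel_measurable_continuous_onI[OF this] show ?thesis by simp
    qed
    show "integrable lborel (\<lambda>x::'b. A * exp (- (2 * c) * norm x))"
      using integrable_exp_norm[where 'a = 'b, of "2 * c"] c by (intro integrable_mult_right) auto
    show "AE x in lborel. (\<lambda>k. (max (1 - (norm x)\<^sup>2 / (real (Suc k))\<^sup>2) 0)\<^sup>2 * ham p u (t, x)) \<longlonglongrightarrow> ham p u (t, x)"
    proof (rule AE_I2)
      fix x :: 'b
      have "(\<lambda>k. (max (1 - (norm x)\<^sup>2 * (inverse (real (Suc k)))\<^sup>2) 0)\<^sup>2 * ham p u (t, x)) \<longlonglongrightarrow> (max (1 - (norm x)\<^sup>2 * 0\<^sup>2) 0)\<^sup>2 * ham p u (t, x)"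
        by (intro tendsto_intros LIMSEQ_inverse_real_of_nat)
      then show "(\<lambda>k. (max (1 - (norm x)\<^sup>2 / (real (Suc k))\<^sup>2) 0)\<^sup>2 * ham p u (t, x)) \<longlonglongrightarrow> ham p u (t, x)"
        by (simp add: divide_inverse power_inverse)
    qed
    show "AE x in lborel. norm ((max (1 - (norm x)\<^sup>2 / (real (Suc k))\<^sup>2) 0)\<^sup>2 * ham p u (t, x)) \<le> A * exp (- (2 * c) * norm x)" for k
    proof (rule AE_I2)
      fix x :: 'b
      have "(max (1 - (norm x)\<^sup>2 / (real (Suc k))\<^sup>2) 0)\<^sup>2 \<le> 1" by (rule power_le_one) auto
      then have "(max (1 - (norm x)\<^sup>2 / (real (Suc k))\<^sup>2) 0)\<^sup>2 * \<bar>ham p u (t, x)\<bar> \<le> 1 * \<bar>ham p u (t, x)\<bar>"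
        by (rule mult_right_mono) simp
      then show "norm ((max (1 - (norm x)\<^sup>2 / (real (Suc k))\<^sup>2) 0)\<^sup>2 * ham p u (t, x)) \<le> A * exp (- (2 * c) * norm x)"
        using ham_le[OF t, of x] by (simp add: abs_mult)
    qed
  qed
  have "(\<lambda>k. \<bar>H k t2 - H k t1\<bar>) \<longlonglongrightarrow> \<bar>(LINT x|lborel. ham p u (t2, x)) - (LINT x|lborel. ham p u (t1, x))\<bar>"
    by (intro tendsto_intros lim) (use t12 in auto)
  moreover have "(\<lambda>k. (t2 - t1) * (2 * DIM('b) * (4 * inverse (real (Suc k)) * M))) \<longlonglongrightarrow> (t2 - t1) * (2 * DIM('b) * (4 * 0 * M))"
    by (intro tendsto_intros LIMSEQ_inverse_real_of_nat)
  moreover have "\<bar>H k t2 - H k t1\<bar> \<le> (t2 - t1) * (2 * DIM('b) * (4 * inverse (real (Suc k)) * M))" for k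
    using key[of "real (Suc k)"] by (simp add: H_def divide_inverse)
  ultimately have "\<bar>(LINT x|lborel. ham p u (t2, x)) - (LINT x|lborel. ham p u (t1, x))\<bar> \<le> (t2 - t1) * (2 * DIM('b) * (4 * 0 * M))"
    by (intro LIMSEQ_le) auto
  then show ?thesis by simp
qed

section \<open>Decay of solutions and constancy of the slice integral\<close>

context solution
begin

text \<open>The unit ball about the point stays in the region \<open>R \<le> norm x'\<close> of
  decay; on it \<open>norm x'\<close> drops by at most 1, hence the shifted exponent.\<close>

lemma gradient_decay:
  assumes small: "\<And>x1 x'. R \<le> norm x' \<Longrightarrow> u (x1, x') \<le> \<eta>" and \<eta>: "0 < \<eta>" "\<eta> \<le> 1 / 2" and R: "R > 0"
    and x': "R + 1 \<le> norm x'" and b: "b \<in> Basis"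
  shows "\<bar>partial_deriv b u (x1, x')\<bar> \<le>
    (DIM(real \<times> (real ^ 'n)) * DIM(real \<times> (real ^ 'n)) + 1) * (\<eta> * exp (- (norm x' - 1 - R) / 2))"
proof (rule gradient_bound_ball[OF u_lap b])
  show "0 < \<eta> * exp (- (norm x' - 1 - R) / 2)" using \<eta> by simp
  fix y :: "real \<times> (real ^ 'n)" assume y: "norm (y - (x1, x')) \<le> 1"
  obtain y1 y' where y_eq: "y = (y1, y')" by (cases y)
  have "norm (y' - x') \<le> norm (y - (x1, x'))"
    using norm_snd_le[of "y' - x'" "y1 - x1"] by (simp add: y_eq)
  then have "norm x' - 1 \<le> norm y'" using y norm_triangle_sub[of x' y'] by (simp add: norm_minus_commute)
  then have 1: "R \<le> norm y'" "y' \<noteq> 0" "norm x' - 1 - R \<le> norm y' - R" using x' R by auto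
  have "u y \<le> \<eta> * exp (- (norm y' - R) / 2)"
    unfolding y_eq by (rule u_decay[OF small \<eta>(2) 1(1,2)])
  also have "\<dots> \<le> \<eta> * exp (- (norm x' - 1 - R) / 2)"
    using 1(3) \<eta>(1) by (intro mult_left_mono) auto
  finally have uy: "u y \<le> \<eta> * exp (- (norm x' - 1 - R) / 2)" .
  have "u y \<le> \<eta>" using small[OF 1(1), of y1] by (simp add: y_eq)
  then have "u y powr p \<le> (u y)\<^sup>2" using u_nonneg \<eta>(2) p2 by (intro powr_le_sq) auto
  also have "\<dots> \<le> 1 * u y" unfolding power2_eq_square
    using u_nonneg[of y] \<open>u y \<le> \<eta>\<close> \<eta>(2) by (intro mult_right_mono) auto
  finally have "u y powr p \<le> u y" by simp
  then show "\<bar>u y\<bar> \<le> \<eta> * exp (- (norm x' - 1 - R) / 2) \<and> \<bar>u y - u y powr p\<bar> \<le> \<eta> * exp (- (norm x' - 1 - R) / 2)"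
    using uy u_nonneg[of y] powr_ge_zero[of "u y" p] by linarith
qed

text \<open>Here the constant may depend on \<open>u\<close>: near the axis it comes from continuity
  on a compact set. It is used for the integrability of \<open>ham\<close> and the constancy of its
  slice integral, not in any asymptotic estimate.\<close>

lemma decay_bound:
  "\<exists>C. \<forall>t\<in>{t1..t2}. \<forall>x. u (t, x) \<le> C * exp (- (1 / 2) * norm x) \<and>
     (\<forall>b\<in>Basis. \<bar>partial_deriv b u (t, x)\<bar> \<le> C * exp (- (1 / 2) * norm x))"
proof -
  obtain r where r: "\<And>x1 x'. r \<le> norm x' \<Longrightarrow> \<bar>u (x1, x')\<bar> < 1 / 2" using u_vanishes[of "1 / 2"] by auto
  define R where "R = max r 1"
  have R: "R > 0" by (simp add: R_def)
  have R2: "u (x1, x') \<le> 1 / 2" if "R \<le> norm x'" for x1 x'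
    using r[of x' x1] that by (simp add: R_def)
  define N where "N = real (DIM(real \<times> (real ^ 'n)) * DIM(real \<times> (real ^ 'n)) + 1)"
  have N1: "N \<ge> 1" by (simp add: N_def)
  define K where "K = {t1..t2} \<times> cball (0 :: real ^ 'n) (R + 1)"
  have "compact K" unfolding K_def by (intro compact_Times compact_Icc compact_cball)
  have bdd: "\<exists>B. \<forall>x\<in>K. \<bar>f x\<bar> \<le> B" if "continuous_on UNIV f" for f :: "real \<times> (real ^ 'n) \<Rightarrow> real"
  proof -
    have "bounded (f ` K)"
      using compact_imp_bounded[OF compact_continuous_image[OF continuous_on_subset[OF that subset_UNIV] \<open>compact K\<close>]] .
    then show ?thesis by (auto simp: bounded_iff)
  qed
  have "\<exists>B. \<forall>x\<in>K. \<bar>partial_deriv b u x\<bar> \<le> B" if "b \<in> Basis" for b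
    by (rule bdd) (use C2_u that in \<open>auto simp: C2_def intro: differentiable_imp_continuous_on\<close>)
  then obtain Bp where Bp: "\<And>b x. b \<in> Basis \<Longrightarrow> x \<in> K \<Longrightarrow> \<bar>partial_deriv b u x\<bar> \<le> Bp b" by metis
  obtain B0 where B0: "\<And>x. x \<in> K \<Longrightarrow> \<bar>u x\<bar> \<le> B0"
    using bdd[of u] u_lap unfolding has_lap_def by blast
  define B where "B = \<bar>B0\<bar> + (\<Sum>b\<in>(Basis :: (real \<times> (real ^ 'n)) set). \<bar>Bp b\<bar>)"
  have B: "\<bar>B0\<bar> \<le> B" "\<And>b. b \<in> Basis \<Longrightarrow> Bp b \<le> B" "0 \<le> B"
  proof -
    show "\<bar>B0\<bar> \<le> B" "0 \<le> B" by (auto simp: B_def intro!: sum_nonneg)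
    fix b :: "real \<times> (real ^ 'n)" assume "b \<in> Basis"
    then have "\<bar>Bp b\<bar> \<le> (\<Sum>b\<in>(Basis :: (real \<times> (real ^ 'n)) set). \<bar>Bp b\<bar>)" by (intro member_le_sum) auto
    then show "Bp b \<le> B" unfolding B_def by linarith
  qed
  define C where "C = (B + N) * exp ((R + 1) / 2)"
  have C_in: "B \<le> C * exp (- (1 / 2) * norm x)" if "norm x \<le> R + 1" for x :: "real ^ 'n"
  proof -
    have "B * 1 \<le> (B + N) * exp ((R + 1) / 2 - norm x / 2)"
      using that B(3) N1 by (intro mult_mono) auto
    then show ?thesis by (simp add: C_def mult.assoc exp_add[symmetric])
  qed
  have C_out: "N * exp (- (norm x - 1 - R) / 2) \<le> C * exp (- (1 / 2) * norm x)" for x :: "real ^ 'n"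
  proof -
    have "exp ((R + 1) / 2) * exp (- (1 / 2) * norm x) = exp (- (norm x - 1 - R) / 2)"
      unfolding exp_add[symmetric] by (simp add: field_simps)
    then have "C * exp (- (1 / 2) * norm x) = (B + N) * exp (- (norm x - 1 - R) / 2)"
      by (simp only: C_def mult.assoc)
    then show ?thesis using B(3) by (simp add: mult_right_mono)
  qed
  have u_le: "u (t, x) \<le> C * exp (- (1 / 2) * norm x)" if t: "t \<in> {t1..t2}" for t x
  proof (cases "norm x \<le> R + 1")
    case True
    then have "\<bar>u (t, x)\<bar> \<le> B0" using t by (intro B0) (auto simp: K_def)
    then show ?thesis using B(1) C_in[OF True] by linarith
  next
    case False
    then have "u (t, x) \<le> 1 / 2 * exp (- (norm x - R) / 2)"
      using R by (intro u_decay[OF R2]) auto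
    also have "\<dots> \<le> N * exp (- (norm x - 1 - R) / 2)" using N1 by (intro mult_mono) auto
    finally show ?thesis using C_out[of x] by linarith
  qed
  have p_le: "\<bar>partial_deriv b u (t, x)\<bar> \<le> C * exp (- (1 / 2) * norm x)"
    if t: "t \<in> {t1..t2}" and b: "b \<in> Basis" for t x b
  proof (cases "norm x \<le> R + 1")
    case True
    then have "\<bar>partial_deriv b u (t, x)\<bar> \<le> Bp b" using t b by (intro Bp) (auto simp: K_def)
    then show ?thesis using B(2)[OF b] C_in[OF True] by linarith
  next
    case False
    then have "\<bar>partial_deriv b u (t, x)\<bar> \<le> N * (1 / 2 * exp (- (norm x - 1 - R) / 2))"
      unfolding N_def using R by (intro gradient_decay[OF R2] b) auto
    also have "\<dots> \<le> N * exp (- (norm x - 1 - R) / 2)" using N1 by simp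
    finally show ?thesis using C_out[of x] by linarith
  qed
  show ?thesis using u_le p_le by blast
qed

lemma ham_const: "(LINT x|lborel. ham p u (s, x)) = (LINT x|lborel. ham p u (t, x))"
proof -
  have *: "(LINT x|lborel. ham p u (s, x)) = (LINT x|lborel. ham p u (t, x))" if "s < t" for s t
  proof -
    obtain C where C: "\<forall>r\<in>{s..t}. \<forall>x. u (r, x) \<le> C * exp (- (1 / 2) * norm x) \<and>
      (\<forall>b\<in>Basis. \<bar>partial_deriv b u (r, x)\<bar> \<le> C * exp (- (1 / 2) * norm x))"
      using decay_bound[of s t] by blast
    show ?thesis
    proof (rule ham_integral_const[OF C2_u p2 u_nonneg laplacian_u _ that])
      show "(0::real) < 1 / 2" by simp
      show "u (r, x) \<le> C * exp (- (1 / 2) * norm x)" if "r \<in> {s..t}" for r x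
        using C[rule_format, OF that] by (rule conjunct1)
      show "\<bar>partial_deriv b u (r, x)\<bar> \<le> C * exp (- (1 / 2) * norm x)" if "r \<in> {s..t}" "b \<in> Basis" for r x b
        using conjunct2[OF C[rule_format, OF that(1)]] that(2) by (rule bspec)
    qed
  qed
  consider "s < t" | "s = t" | "t < s" by linarith
  then show ?thesis by cases (simp_all add: *[of s t] *[of t s])
qed

lemma ham_cont: "continuous_on UNIV (\<lambda>x. ham p u (t, x))"
  by (rule continuous_on_compose2[OF ham_continuous[OF C2_u p2]]) (auto intro!: continuous_intros)

lemma ham_integrable: "integrable lborel (\<lambda>x. ham p u (t, x))"
proof -
  obtain C where C': "\<forall>r\<in>{t..t}. \<forall>x. u (r, x) \<le> C * exp (- (1 / 2) * norm x) \<and>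
    (\<forall>b\<in>Basis. \<bar>partial_deriv b u (r, x)\<bar> \<le> C * exp (- (1 / 2) * norm x))"
    using decay_bound[of t t] by blast
  have C: "u (t, x) \<le> C * exp (- (1 / 2) * norm x)"
    "b \<in> Basis \<Longrightarrow> \<bar>partial_deriv b u (t, x)\<bar> \<le> C * exp (- (1 / 2) * norm x)" for x b
    using C'[rule_format, of t x] by simp_all
  have C0: "C \<ge> 0" using order_trans[OF u_nonneg C(1)[of 0]] by simp
  show ?thesis
  proof (rule integrable_exp_norm_bound[OF ham_cont])
    show "(1::real) > 0" by simp
    fix x :: "real ^ 'n"
    have "C * exp (- (1 / 2) * norm x) \<le> C * 1" using C0 by (intro mult_left_mono) auto
    then have "\<bar>ham p u (t, x)\<bar> \<le> (DIM(real ^ 'n) + 2 + C powr (p - 1)) * (C * exp (- (1 / 2) * norm x))\<^sup>2"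
      by (intro ham_bound[OF p2 u_nonneg C]) auto
    then show "\<bar>ham p u (t, x)\<bar> \<le> (DIM(real ^ 'n) + 2 + C powr (p - 1)) * C\<^sup>2 * exp (- 1 * norm x)"
      by (simp add: power_mult_distrib exp_double[symmetric] mult.assoc)
  qed
qed

end

section \<open>Two adjacent peaks\<close>

lemma le_exp_if_ln_le: "ln y \<le> z \<Longrightarrow> y > 0 \<Longrightarrow> y \<le> exp z" for y z :: real
  by (metis exp_le_cancel_iff exp_ln)

section \<open>Trapping a solution between barriers in a finite window\<close>

locale ground_strip = ground_cyl p U for p and U :: "real \<times> (real ^ 'n) \<Rightarrow> real"
begin

text \<open>
  \<open>J\<close> is the set of first coordinates of the peaks in the window \<open>\<bar>x1\<bar> \<le> W\<close> of several periods, \<open>R\<close> the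
  radius of the balls excised around them, and \<open>D\<close> a lower bound for the gaps. The quantifiers
  below always occur in the order \<open>\<eta>\<close>, \<open>R\<close>, \<open>\<delta>\<close>, \<open>D\<close>, since \<open>u\<close> is close to a peak only on balls whose
  radius is chosen before \<open>\<epsilon>\<close>.
\<close>

definition far :: "real set \<Rightarrow> real \<Rightarrow> real \<Rightarrow> real \<times> (real ^ 'n) \<Rightarrow> bool" where
  "far J R W x \<longleftrightarrow> \<bar>fst x\<bar> \<le> W \<and> (\<forall>c\<in>J. R \<le> norm (x - (c, 0)))"

definition config ::
    "nat \<Rightarrow> real \<Rightarrow> real \<Rightarrow> real \<Rightarrow> real \<Rightarrow> real \<Rightarrow> real set \<Rightarrow> (real \<times> (real ^ 'n) \<Rightarrow> real) \<Rightarrow> bool" where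
  "config \<kappa> \<eta> R \<delta> D W J u \<longleftrightarrow> finite J \<and> card J \<le> \<kappa> \<and>
     (\<forall>c\<in>J. \<forall>c'\<in>J. c \<noteq> c' \<longrightarrow> D \<le> \<bar>c - c'\<bar>) \<and>
     (\<forall>x. far J R W x \<longrightarrow> u x \<le> \<eta>) \<and>
     (\<forall>c\<in>J. \<forall>x. norm (x - (c, 0)) = R \<longrightarrow> \<bar>u x - U (x - (c, 0))\<bar> \<le> \<delta>) \<and>
     (\<forall>x1 x'. R \<le> norm x' \<longrightarrow> u (x1, x') \<le> \<eta>)"

definition two_sided_bounds :: "nat \<Rightarrow> real \<Rightarrow> real \<Rightarrow> real \<Rightarrow> real \<Rightarrow> bool" where
  "two_sided_bounds \<kappa> \<eta> R \<delta> D \<longleftrightarrow> (\<forall>\<epsilon> u J W \<beta> \<beta>'. solution p \<epsilon> u \<longrightarrow> config \<kappa> \<eta> R \<delta> D W J u \<longrightarrow>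
    \<beta> \<in> J \<longrightarrow> \<beta>' \<in> J \<longrightarrow> \<beta> \<noteq> \<beta>' \<longrightarrow> (\<forall>x. far J R W x \<longrightarrow>
      (1 - \<eta>) * (U (x - (\<beta>, 0)) + U (x - (\<beta>', 0))) \<le> u x \<and>
      u x \<le> (1 + \<eta>) * (\<Sum>c\<in>J. U (x - (c, 0))) + \<eta> * (exp ((fst x - W) / 2) + exp ((- fst x - W) / 2))))"

text \<open>\<open>K\<close> times the half gap L is the transversal extent of the trap. The margin
  required of \<open>W\<close> is proportional to the gap because the wall terms compete with
  \<open>U\<close> at distances up to (K + 3) L, where \<open>U\<close> may be as small as exp(-
  \<mu> (K + 3) L) up to a constant. The factor 1 + 4 \<eta> collects (1 + \<eta>)^2 from the peaks
  and \<eta> from the walls.\<close>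

definition slab_bounds :: "nat \<Rightarrow> real \<Rightarrow> real \<Rightarrow> real \<Rightarrow> real \<Rightarrow> real \<Rightarrow> real \<Rightarrow> bool" where
  "slab_bounds \<kappa> \<eta> \<mu> K R \<delta> D \<longleftrightarrow> (\<forall>\<epsilon> u J W \<beta> \<beta>'. solution p \<epsilon> u \<longrightarrow> config \<kappa> \<eta> R \<delta> D W J u \<longrightarrow>
    \<beta> \<in> J \<longrightarrow> \<beta>' \<in> J \<longrightarrow> \<beta> < \<beta>' \<longrightarrow> (\<forall>c\<in>J - {\<beta>, \<beta>'}. c \<le> \<beta> - D \<or> \<beta>' + D \<le> c) \<longrightarrow>
    \<bar>\<beta> + \<beta>'\<bar> / 2 + 1 + (\<mu> * (K + 3) + 1) * (\<beta>' - \<beta>) \<le> W \<longrightarrow>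
    D \<le> \<beta>' - \<beta> \<and> R + 1 \<le> (\<beta>' - \<beta>) / 2 \<and>
    (\<forall>x. \<bar>fst x - (\<beta> + \<beta>') / 2\<bar> \<le> 1 \<longrightarrow> norm (snd x) \<le> K * ((\<beta>' - \<beta>) / 2) + 1 \<longrightarrow>
      far J R W x \<and> (1 - \<eta>) * (U (x - (\<beta>, 0)) + U (x - (\<beta>', 0))) \<le> u x \<and>
      u x \<le> (1 + 4 * \<eta>) * (U (x - (\<beta>, 0)) + U (x - (\<beta>', 0)))))"

text \<open>The comparison lemmas reduce the claim to the excised spheres, where \<open>U\<close>
  has the constant value \<open>m\<close>. There the correction is at most \<eta> / 4 * m, a second
  peak with its correction adds at most \<eta> / 4 * m, and a closeness of \<eta> / 2 * m fits in
  both directions.\<close>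

lemma two_sided:
  assumes \<eta>: "0 < \<eta>" "\<eta> \<le> 3 / 32"
  shows "\<exists>R0>0. \<forall>R\<ge>R0. \<exists>\<delta>>0. \<exists>D. two_sided_bounds \<kappa> \<eta> R \<delta> D"
proof -
  define s where "s = 1 / (64 * (real \<kappa> + 1))"
  have s: "s > 0" by (simp add: s_def)
  \<comment> \<open>The entries serve \<open>lower_comparison\<close>,
    \<open>upper_comparison\<close> and the bound \<open>Uq x \<le> \<eta> / 4 * U x\<close>, in
    this order; 1/16 also covers the threshold 1/6.\<close>
  define s0 where "s0 = Min {1 / 16, s\<^sup>2, (\<eta> / 4)\<^sup>2}"
  have s0: "s0 > 0" "s0 \<le> 1 / 16" "s0 \<le> s\<^sup>2" "s0 \<le> (\<eta> / 4)\<^sup>2"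
    using s \<eta> by (simp_all add: s0_def)
  obtain R0 where R0: "R0 > 0" "\<And>x. R0 \<le> norm x \<Longrightarrow> U x \<le> s0" using U_small[OF s0(1)] by blast
  have main: "\<exists>\<delta>>0. \<exists>D. two_sided_bounds \<kappa> \<eta> R \<delta> D"
    if R: "R0 \<le> R" for R
  proof -
    define m where "m = U (R, 0)"
    have m0: "m > 0" by (simp add: m_def U_pos)
    have mR: "U x = m" if "norm x = R" for x
      using U_mono[of x "(R, 0)"] U_mono[of "(R, 0)" x] that R R0(1) by (simp add: m_def norm_Pair)
    have "\<eta> / 8 * m > 0" using \<eta> m0 by simp
    then obtain R' where R': "R' > 0" "\<And>x. R' \<le> norm x \<Longrightarrow> U x \<le> \<eta> / 8 * m" using U_small by blast
    have Us: "U x \<le> s0" if "R \<le> norm x" for x using R0(2)[of x] R that by simp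
    have Uqs: "Uq x \<le> \<eta> / 4 * U x" if "R \<le> norm x" for x
      using Us[OF that] s0(4) \<eta>(1) by (intro Uq_le) auto
    have \<delta>0: "\<eta> / 2 * m > 0" using \<eta> m0 by simp
    show ?thesis
    \<comment> \<open>Centers that are \<open>R + R'\<close> apart leave a distance of at least
      \<open>R'\<close> from a sphere about one of them to every other center.\<close>
    proof (rule exI[of _ "\<eta> / 2 * m"], rule conjI[OF \<delta>0 exI[of _ "R + R'"]],
        unfold two_sided_bounds_def, intro conjI allI impI)
      fix \<epsilon> u J W \<beta> \<beta>' x
      assume "solution p \<epsilon> u" and config: "config \<kappa> \<eta> R (\<eta> / 2 * m) (R + R') W J u"
        and \<beta>: "\<beta> \<in> J" "\<beta>' \<in> J" "\<beta> \<noteq> \<beta>'" and far: "far J R W x"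
      interpret solution p \<epsilon> u by fact
      have J: "finite J" "card J \<le> \<kappa>" and sep: "\<And>c c'. c \<in> J \<Longrightarrow> c' \<in> J \<Longrightarrow> c \<noteq> c' \<Longrightarrow> R + R' \<le> \<bar>c - c'\<bar>"
        and small: "\<And>x. far J R W x \<Longrightarrow> u x \<le> \<eta>"
        and near: "\<And>c x. c \<in> J \<Longrightarrow> norm (x - (c, 0)) = R \<Longrightarrow> \<bar>u x - U (x - (c, 0))\<bar> \<le> \<eta> / 2 * m"
        using config by (auto simp: config_def)
      have far_R: "\<And>c. c \<in> J \<Longrightarrow> R \<le> norm (x - (c, 0))" using far by (simp add: far_def)
      have low: "(1 - \<eta>) * (U (y - (a, 0)) + Uq (y - (a, 0)) + (U (y - (b, 0)) + Uq (y - (b, 0)))) \<le> u y"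
        if ab: "a \<in> J" "b \<in> J" "a \<noteq> b" and y: "norm (y - (a, 0)) = R" for a b y
      proof -
        have "R + R' \<le> norm ((a, 0) - (b, 0 :: real ^ 'n))" using sep[OF ab] by (simp add: norm_Pair)
        also have "\<dots> \<le> norm (y - (a, 0)) + norm (y - (b, 0))"
          using norm_triangle_ineq4[of "y - (b, 0)" "y - (a, 0)"] by simp
        finally have "R' \<le> norm (y - (b, 0))" using y by simp
        then have Ub: "U (y - (b, 0)) \<le> \<eta> / 8 * m" by (rule R'(2))
        moreover have "Uq (y - (b, 0)) \<le> 1 * U (y - (b, 0))"
        proof (rule Uq_le)
          have "\<eta> / 8 * m \<le> 1 * m" using \<eta> m0 by (intro mult_right_mono) auto
          moreover have "m \<le> s0" using Us[of "(R, 0)"] R R0(1) by (simp add: m_def norm_Pair)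
          ultimately show "U (y - (b, 0)) \<le> 1\<^sup>2" using Ub s0(2) by simp
        qed simp
        moreover have "Uq (y - (a, 0)) \<le> \<eta> / 4 * m" "U (y - (a, 0)) = m"
          using Uqs[of "y - (a, 0)"] mR[OF y] y by simp_all
        ultimately have "U (y - (a, 0)) + Uq (y - (a, 0)) + (U (y - (b, 0)) + Uq (y - (b, 0))) \<le> (1 + \<eta> / 2) * m"
          by (simp add: algebra_simps)
        then have "(1 - \<eta>) * (U (y - (a, 0)) + Uq (y - (a, 0)) + (U (y - (b, 0)) + Uq (y - (b, 0)))) \<le> (1 - \<eta>) * ((1 + \<eta> / 2) * m)"
          using \<eta> by (intro mult_left_mono) auto
        also have "\<dots> = (1 - \<eta> / 2 - \<eta> * \<eta> / 2) * m" by (simp add: field_simps)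
        also have "\<dots> \<le> (1 - \<eta> / 2) * m" using m0 \<eta>(1) by (intro mult_right_mono) auto
        also have "(1 - \<eta> / 2) * m = m - \<eta> / 2 * m" by (simp add: algebra_simps)
        also have "\<dots> \<le> u y" using near[OF ab(1) y] mR[OF y] by linarith
        finally show ?thesis .
      qed
      show "(1 - \<eta>) * (U (x - (\<beta>, 0)) + U (x - (\<beta>', 0))) \<le> u x"
      proof (rule lower_comparison[OF u_lap u_nonneg, where R = R])
        show "U x \<le> 1 / 16" if "R \<le> norm x" for x using Us[OF that] s0(2) by simp
        show "0 < 1 - \<eta>" using \<eta> by simp
        fix y :: "real \<times> (real ^ 'n)" assume "norm (y - (\<beta>, 0)) = R \<or> norm (y - (\<beta>', 0)) = R"
        then show "(1 - \<eta>) * (U (y - (\<beta>, 0)) + Uq (y - (\<beta>, 0)) + (U (y - (\<beta>', 0)) + Uq (y - (\<beta>', 0)))) \<le> u y"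
          using low[of \<beta> \<beta>' y] low[of \<beta>' \<beta> y] \<beta> by (auto simp: add.commute)
      qed (use far_R \<beta> in auto)
      define J' where "J' = (\<lambda>c. (c, 0 :: real ^ 'n)) ` J"
      define S where "S = {x. \<bar>x \<bullet> (1, 0)\<bar> \<le> W \<and> (\<forall>c\<in>J'. R \<le> norm (x - c))}"
      have S: "y \<in> S \<longleftrightarrow> far J R W y" for y by (simp add: S_def far_def J'_def inner_prod_def)
      have cJ: "card J' = card J" unfolding J'_def by (rule card_image) (auto simp: inj_on_def)
      have "u x \<le> (1 + \<eta>) * (\<Sum>c\<in>J'. U (x - c)) + \<eta> * (exp ((x \<bullet> (1, 0) - W) / 2) + exp ((- (x \<bullet> (1, 0)) - W) / 2))"
      proof (rule upper_comparison[OF u_lap u_nonneg, where S = S and R = R and s = s])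
        show "finite J'" using J(1) by (simp add: J'_def)
        show "norm (1::real, 0 :: real ^ 'n) = 1" by (simp add: norm_Pair)
        show "0 < s" by (rule s)
        have "64 * real (card J') * s \<le> 64 * (real \<kappa> + 1) * s"
          using J(2) s cJ by (intro mult_right_mono) auto
        also have "\<dots> = 1" by (simp add: s_def)
        finally show "real (64 * card J') * s \<le> 1" by simp
        show "U x \<le> min (1 / 6) (s\<^sup>2)" if "R \<le> norm x" for x using Us[OF that] s0 by simp
        show "S = {x. \<bar>x \<bullet> (1, 0)\<bar> \<le> W \<and> (\<forall>c\<in>J'. R \<le> norm (x - c))}" by (rule S_def)
        show "x \<in> S" using far S by simp
        show "bounded {x \<in> S. d \<le> u x}" if "d > 0" for d
        proof -
          obtain \<rho> where \<rho>: "\<And>x1 x'. \<rho> \<le> norm x' \<Longrightarrow> \<bar>u (x1, x')\<bar> < d" using u_vanishes[OF \<open>d > 0\<close>] by blast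
          have "{x \<in> S. d \<le> u x} \<subseteq> {-W..W} \<times> cball 0 \<rho>"
          proof
            fix y assume y: "y \<in> {x \<in> S. d \<le> u x}"
            obtain y1 y' where eq: "y = (y1, y')" by (cases y)
            have "norm y' \<le> \<rho>" using \<rho>[of y' y1] y eq by force
            then show "y \<in> {-W..W} \<times> cball 0 \<rho>" using y eq by (simp add: S far_def abs_le_iff)
          qed
          then show ?thesis by (rule bounded_subset[rotated]) (intro bounded_Times bounded_cball bounded_closed_interval)
        qed
        show "u x \<le> \<eta>" if "x \<in> S" for x using small that S by simp
        fix y c assume y: "y \<in> S" "c \<in> J'" "norm (y - c) = R"
        then obtain c0 where c0: "c0 \<in> J" "c = (c0, 0)" by (auto simp: J'_def)
        have "\<bar>u y - m\<bar> \<le> \<eta> / 2 * m"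
          using near[of c0 y] y(3) c0 mR[of "y - (c0, 0)"] by simp
        then have "u y \<le> m + \<eta> / 2 * m" by linarith
        also have "\<dots> = (1 + \<eta> / 2) * m" by (simp add: algebra_simps)
        also have "\<dots> \<le> (1 + \<eta>) * ((1 - \<eta> / 4) * m)"
        proof -
          have "\<eta> * \<eta> \<le> \<eta> * 1" using \<eta> by (intro mult_left_mono) auto
          then have "1 + \<eta> / 2 \<le> (1 + \<eta>) * (1 - \<eta> / 4)" by (simp add: field_simps)
          then show ?thesis using m0 by (simp only: mult.assoc[symmetric] mult_right_mono less_imp_le)
        qed
        also have "\<dots> \<le> (1 + \<eta>) * (U (y - c) - Uq (y - c))"
          using Uqs[of "y - c"] mR[OF y(3)] y(3) \<eta> by (intro mult_left_mono) (auto simp: algebra_simps)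
        finally show "u y \<le> (1 + \<eta>) * (U (y - c) - Uq (y - c))" .
      qed (use \<eta> in auto)
      moreover have "(\<Sum>c\<in>J'. U (x - c)) = (\<Sum>c\<in>J. U (x - (c, 0)))"
        unfolding J'_def by (subst sum.reindex) (auto simp: inj_on_def)
      ultimately show "u x \<le> (1 + \<eta>) * (\<Sum>c\<in>J. U (x - (c, 0))) + \<eta> * (exp ((fst x - W) / 2) + exp ((- fst x - W) / 2))"
        by (simp add: inner_prod_def)
    qed
  qed
  show ?thesis using R0(1) main by blast
qed

lemma config_mono: "config \<kappa> \<eta> R \<delta> D W J u \<Longrightarrow> D' \<le> D \<Longrightarrow> config \<kappa> \<eta> R \<delta> D' W J u"
proof -
  assume c: "config \<kappa> \<eta> R \<delta> D W J u" and d: "D' \<le> D"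
  have "D' \<le> \<bar>a - b\<bar>" if "a \<in> J" "b \<in> J" "a \<noteq> b" for a b
  proof -
    have "D \<le> \<bar>a - b\<bar>" using c that unfolding config_def by blast
    then show ?thesis using d by simp
  qed
  then show ?thesis using c unfolding config_def by simp
qed

text \<open>At transversal distance of order K L it is not evident that the other peaks are much
  farther away than the two neighbours. The squared distances decide: they differ by at least D L,
  the nearer distance is at most (K + 3) L, so the distances differ by an amount of order D / K, and
  a large \<open>D\<close> makes the other peaks negligible.\<close>

lemma slab:
  assumes \<eta>: "0 < \<eta>" "\<eta> \<le> 3 / 32" and K: "1 \<le> K" and low: "c1 > 0" "\<mu> > 0" "\<And>x. c1 * exp (- \<mu> * norm x) \<le> U x"
  shows "\<exists>R0>0. \<forall>R\<ge>R0. \<exists>\<delta>>0. \<exists>D. slab_bounds \<kappa> \<eta> \<mu> K R \<delta> D"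
proof -
  obtain R1 where R1: "R1 > 0"
    "\<And>x y. R1 \<le> norm x \<Longrightarrow> norm x \<le> norm y \<Longrightarrow> U y \<le> exp (- (norm y - norm x) / 2) * U x"
    using U_decay by blast
  obtain R2 where R2: "R2 > 0" "\<forall>R\<ge>R2. \<exists>\<delta>>0. \<exists>D. two_sided_bounds \<kappa> \<eta> R \<delta> D"
    using two_sided[OF \<eta>, of \<kappa>] by blast
  define R0 where "R0 = max R1 R2"
  have main: "\<exists>\<delta>>0. \<exists>D. slab_bounds \<kappa> \<eta> \<mu> K R \<delta> D"
    if "R0 \<le> R" for R
  proof -
    have R: "R1 \<le> R" "R2 \<le> R" "R > 0" using that R1(1) R2(1) by (auto simp: R0_def)
    obtain \<delta> D1 where \<delta>: "\<delta> > 0" and D1: "two_sided_bounds \<kappa> \<eta> R \<delta> D1"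
      using R2(2) R(2) by blast
    have K3: "K + 3 > 0" using K by simp
    define a where "a = 1 / (8 * (K + 3))"
    have a: "a > 0" using K3 by (simp add: a_def)
    \<comment> \<open>The entries ensure, in this order: the validity of
      \<open>two_sided_bounds\<close>, L \<ge> R + 1 and L \<ge> 2 for the half gap L, a total of at
      most a fraction \<eta> from the other peaks, and the constant in the wall estimate.\<close>
    define D where "D = Max {D1, 2 * (R + 1), 4, ln ((real \<kappa> + 1) / \<eta>) / a, 2 * ln (2 / c1)}"
    have D: "D1 \<le> D" "2 * (R + 1) \<le> D" "4 \<le> D" "ln ((real \<kappa> + 1) / \<eta>) / a \<le> D" "2 * ln (2 / c1) \<le> D"
      by (simp_all add: D_def)
    have exp1: "real \<kappa> * exp (- a * D) \<le> \<eta>"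
    proof -
      have "ln ((real \<kappa> + 1) / \<eta>) \<le> a * D" using D(4) a by (simp add: field_simps)
      then have "(real \<kappa> + 1) / \<eta> \<le> exp (a * D)" using \<eta>(1) by (intro le_exp_if_ln_le) (simp_all add: add_nonneg_pos)
      then have "(real \<kappa> + 1) * exp (- a * D) \<le> \<eta>" using \<eta>(1) by (simp add: exp_minus field_simps)
      moreover have "real \<kappa> * exp (- a * D) \<le> (real \<kappa> + 1) * exp (- a * D)" by (rule mult_right_mono) simp_all
      ultimately show ?thesis by linarith
    qed
    show ?thesis
    proof (rule exI[of _ \<delta>], rule conjI[OF \<delta> exI[of _ D]], unfold slab_bounds_def, intro allI impI)
      fix \<epsilon> u J W \<beta> \<beta>'
      assume sol: "solution p \<epsilon> u" and config: "config \<kappa> \<eta> R \<delta> D W J u" and \<beta>: "\<beta> \<in> J" "\<beta>' \<in> J" "\<beta> < \<beta>'"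
        and gap: "\<forall>c\<in>J - {\<beta>, \<beta>'}. c \<le> \<beta> - D \<or> \<beta>' + D \<le> c"
        and W: "\<bar>\<beta> + \<beta>'\<bar> / 2 + 1 + (\<mu> * (K + 3) + 1) * (\<beta>' - \<beta>) \<le> W"
      define L m where "L = (\<beta>' - \<beta>) / 2" and "m = (\<beta> + \<beta>') / 2"
      have \<beta>_eq: "\<beta> = m - L" "\<beta>' = m + L" by (auto simp: L_def m_def field_simps)
      have J: "finite J" "card J \<le> \<kappa>" and sep: "\<forall>c\<in>J. \<forall>c'\<in>J. c \<noteq> c' \<longrightarrow> D \<le> \<bar>c - c'\<bar>"
        using config by (simp_all add: config_def)
      have "D \<le> \<bar>\<beta> - \<beta>'\<bar>" using sep[rule_format, OF \<beta>(1,2)] \<beta>(3) by simp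
      then have DL: "D \<le> 2 * L" using \<beta>(3) by (simp add: L_def)
      then have L: "R + 1 \<le> L" "2 \<le> L" using D(2,3) by auto
      have W': "\<bar>m\<bar> + 1 + 2 * (\<mu> * (K + 3) + 1) * L \<le> W"
      proof -
        have "2 * (\<mu> * (K + 3) + 1) * L = (\<mu> * (K + 3) + 1) * (\<beta>' - \<beta>)" by (simp add: L_def field_simps)
        moreover have "\<bar>m\<bar> = \<bar>\<beta> + \<beta>'\<bar> / 2" by (simp add: m_def)
        ultimately show ?thesis using W by linarith
      qed
      have \<mu>K: "\<mu> * (K + 3) * L \<ge> 0" using low(2) K3 L(2) by simp
      have slab: "far J R W x \<and> (1 - \<eta>) * (U (x - (\<beta>, 0)) + U (x - (\<beta>', 0))) \<le> u x \<and>
          u x \<le> (1 + 4 * \<eta>) * (U (x - (\<beta>, 0)) + U (x - (\<beta>', 0)))"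
        if x: "\<bar>fst x - m\<bar> \<le> 1" "norm (snd x) \<le> K * L + 1" for x
      proof -
        define V where "V = U (x - (\<beta>, 0)) + U (x - (\<beta>', 0))"
        have fst_le: "\<bar>fst x - c\<bar> \<le> norm (x - (c, 0))" for c
          using norm_fst_le[of "fst x - c" "snd x"] by (cases x) simp
        have Jc: "c \<le> \<beta> \<or> \<beta>' \<le> c" if "c \<in> J" for c 
        proof (cases "c = \<beta> \<or> c = \<beta>'")
          case False
          then have "c \<le> \<beta> - D \<or> \<beta>' + D \<le> c" using gap that by blast
          then show ?thesis using D(3) by linarith
        qed auto
        have far: "far J R W x"
        proof -
          have "R \<le> norm (x - (c, 0))" if "c \<in> J" for c
          proof -
            have "L - 1 \<le> \<bar>fst x - c\<bar>" using Jc[OF that] x(1) \<beta>_eq by linarith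
            then show ?thesis using fst_le[of c] L(1) by linarith
          qed
          moreover have "\<bar>fst x\<bar> \<le> W"
          proof -
            have "(\<mu> * (K + 3) + 1) * L = \<mu> * (K + 3) * L + L" by (simp add: algebra_simps)
            then show ?thesis using x(1) W' \<mu>K L(2) by linarith
          qed
          ultimately show ?thesis by (simp add: far_def)
        qed
        have nb: "norm (x - (b, 0)) \<le> (K + 3) * L" if "b = \<beta> \<or> b = \<beta>'" for b
        proof -
          have "norm (x - (b, 0)) \<le> norm (fst x - b) + norm (snd x)"
            using norm_Pair_le[of "fst x - b" "snd x"] by (cases x) simp
          also have "\<dots> \<le> (L + 1) + (K * L + 1)"
            using x that \<beta>_eq L(2) by (intro add_mono) (auto simp: abs_le_iff)
          finally show ?thesis using L(2) by (simp add: algebra_simps)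
        qed
        have far_b: "R \<le> norm (x - (c, 0))" if "c \<in> J" for c using far that by (simp add: far_def)
        \<comment> \<open>For t = D / (4 (K + 3)) the increment (r + t)^2 - r^2 = 2 r t + t^2 is at
          most D L / 2 + D L / 8, hence below D L; so \<open>c\<close> is at least \<open>t\<close>
          farther away than \<open>b\<close>.\<close>
        have other: "U (x - (c, 0)) \<le> exp (- a * D) * U (x - (b, 0))"
          if b: "b = \<beta> \<or> b = \<beta>'" and cb: "D \<le> \<bar>b - c\<bar>" "D * L \<le> (fst x - c)\<^sup>2 - (fst x - b)\<^sup>2" for b c
        proof -
          define r t where "r = norm (x - (b, 0))" and "t = D / (4 * (K + 3))"
          have t0: "t \<ge> 0" using D(3) K3 by (simp add: t_def)
          have r: "r \<le> (K + 3) * L" "R \<le> r" "0 \<le> r" using nb[OF b] far_b b \<beta> by (auto simp: r_def)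
          have "r * t \<le> (K + 3) * L * t" using r(1) t0 by (rule mult_right_mono)
          also have "\<dots> = D * L / 4" using K3 by (simp add: t_def field_simps)
          finally have 1: "r * t \<le> D * L / 4" .
          have "t \<le> D / 4" unfolding t_def using K D(3) by (intro divide_left_mono) auto
          then have "t * t \<le> D / 4 * (D / 4)" using t0 by (intro mult_mono) auto
          also have "\<dots> \<le> D * (2 * L) / 16" using DL D(3) by (simp add: mult_left_mono)
          finally have 2: "t * t \<le> D * L / 8" by simp
          have n2: "(norm (x - (c, 0)))\<^sup>2 = (fst x - c)\<^sup>2 + (norm (snd x))\<^sup>2" for c
            by (cases x) (simp add: norm_Pair)
          have "0 \<le> D * L" using D(3) L(2) by simp
          then have "r\<^sup>2 + 2 * (r * t) + t * t \<le> (norm (x - (c, 0)))\<^sup>2"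
            using 1 2 cb(2) n2[of c] n2[of b] unfolding r_def by linarith
          then have "(r + t)\<^sup>2 \<le> (norm (x - (c, 0)))\<^sup>2" by (simp add: power2_eq_square algebra_simps)
          then have rt: "r + t \<le> norm (x - (c, 0))" by (rule power2_le_imp_le) simp
          have "U (x - (c, 0)) \<le> exp (- (norm (x - (c, 0)) - norm (x - (b, 0))) / 2) * U (x - (b, 0))"
            by (rule R1(2)) (use r rt t0 R(1) in \<open>auto simp: r_def\<close>)
          also have "\<dots> \<le> exp (- a * D) * U (x - (b, 0))"
          proof (rule mult_right_mono[OF _ U_nonneg])
            have "a * D = t / 2" by (simp add: a_def t_def)
            then show "exp (- (norm (x - (c, 0)) - norm (x - (b, 0))) / 2) \<le> exp (- a * D)"
              using rt by (simp add: r_def)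
          qed
          finally show ?thesis .
        qed
        have others: "U (x - (c, 0)) \<le> exp (- a * D) * V" if c: "c \<in> J - {\<beta>, \<beta>'}" for c
        proof -
          \<comment> \<open>\<open>s\<close> is the distance from \<open>c\<close> to the nearer of
            the two peaks, and \<open>fst x\<close> is at least L - 1 away from that peak; the
            product is then a lower bound for the difference of squares below.\<close>
          have sq: "D * L \<le> s * (s + 2 * (L - 1))" if "D \<le> s" for s
          proof -
            have "4 \<le> s" using that D(3) by (rule order_trans[rotated])
            then have "L \<le> s + 2 * (L - 1)" using L(2) by simp
            then show ?thesis using that D(3) L(2) by (intro mult_mono) auto
          qed
          consider "c \<le> \<beta> - D" | "\<beta>' + D \<le> c" using gap c by blast
          then show ?thesis
          proof cases
            case 1
            have "(\<beta> - c) * (\<beta> - c + 2 * (L - 1)) \<le> (\<beta> - c) * (\<beta> - c + 2 * (fst x - \<beta>))"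
              using 1 D(3) x(1) \<beta>_eq by (intro mult_left_mono) (auto simp: abs_le_iff)
            also have "\<dots> = (fst x - c)\<^sup>2 - (fst x - \<beta>)\<^sup>2" by (simp add: power2_eq_square algebra_simps)
            finally have "U (x - (c, 0)) \<le> exp (- a * D) * U (x - (\<beta>, 0))"
              using sq[of "\<beta> - c"] 1 by (intro other) auto
            also have "\<dots> \<le> exp (- a * D) * V" by (simp add: V_def U_nonneg)
            finally show ?thesis .
          next
            case 2
            have "(c - \<beta>') * (c - \<beta>' + 2 * (L - 1)) \<le> (c - \<beta>') * (c - \<beta>' + 2 * (\<beta>' - fst x))"
              using 2 D(3) x(1) \<beta>_eq by (intro mult_left_mono) (auto simp: abs_le_iff)
            also have "\<dots> = (fst x - c)\<^sup>2 - (fst x - \<beta>')\<^sup>2" by (simp add: power2_eq_square algebra_simps)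
            finally have "U (x - (c, 0)) \<le> exp (- a * D) * U (x - (\<beta>', 0))"
              using sq[of "c - \<beta>'"] 2 by (intro other) auto
            also have "\<dots> \<le> exp (- a * D) * V" by (simp add: V_def U_nonneg)
            finally show ?thesis .
          qed
        qed
        have V0: "V > 0" using U_pos by (simp add: V_def add_pos_pos)
        have "(\<Sum>c\<in>J. U (x - (c, 0))) = V + (\<Sum>c\<in>J - {\<beta>, \<beta>'}. U (x - (c, 0)))"
          using sum.subset_diff[of "{\<beta>, \<beta>'}" J "\<lambda>c. U (x - (c, 0))"] J \<beta> by (simp add: V_def)
        also have "(\<Sum>c\<in>J - {\<beta>, \<beta>'}. U (x - (c, 0))) \<le> (\<Sum>c\<in>J - {\<beta>, \<beta>'}. exp (- a * D) * V)"
          by (rule sum_mono) (rule others)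
        also have "\<dots> = card (J - {\<beta>, \<beta>'}) * (exp (- a * D) * V)" by simp
        also have "\<dots> \<le> \<kappa> * (exp (- a * D) * V)"
          using J card_mono[of J "J - {\<beta>, \<beta>'}"] V0 by (intro mult_right_mono) auto
        also have "\<dots> \<le> \<eta> * V" using exp1 V0 by (simp only: mult.assoc[symmetric] mult_right_mono less_imp_le)
        finally have sum: "(\<Sum>c\<in>J. U (x - (c, 0))) \<le> (1 + \<eta>) * V" by (simp add: algebra_simps)
        \<comment> \<open>Both walls are at distance at least 2 X from \<open>x\<close>, which gives
          exp(- X) each. Of this, exp(- L) beats the constant 2 / c1, and the rest matches the lower
          bound of \<open>U\<close> at distance (K + 3) L.\<close>
        have wall: "exp ((fst x - W) / 2) + exp ((- fst x - W) / 2) \<le> V"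
        proof -
          define X where "X = (\<mu> * (K + 3) + 1) * L"
          have "2 * (\<mu> * (K + 3) + 1) * L = 2 * X" by (simp only: X_def mult.assoc)
          then have "\<bar>fst x\<bar> - W \<le> - 2 * X" using W' x(1) by linarith
          then have "(fst x - W) / 2 \<le> - X" "(- fst x - W) / 2 \<le> - X" by (simp_all add: abs_le_iff field_simps)
          then have "exp ((fst x - W) / 2) + exp ((- fst x - W) / 2) \<le> exp (- X) + exp (- X)"
            by (intro add_mono) auto
          also have "\<dots> = 2 * exp (- L) * exp (- \<mu> * ((K + 3) * L))"
            by (simp add: X_def exp_add[symmetric] algebra_simps)
          also have "\<dots> \<le> c1 * exp (- \<mu> * ((K + 3) * L))"
          proof (rule mult_right_mono)
            have "ln (2 / c1) \<le> L" using D(5) DL by simp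
            then have "2 / c1 \<le> exp L" using low(1) by (intro le_exp_if_ln_le) simp_all
            then show "2 * exp (- L) \<le> c1" using low(1) by (simp add: exp_minus field_simps)
          qed simp
          also have "\<dots> \<le> c1 * exp (- \<mu> * norm (x - (\<beta>, 0)))"
            using nb[of \<beta>] low(1,2) by (intro mult_left_mono) auto
          also have "\<dots> \<le> V" using low(3)[of "x - (\<beta>, 0)"] U_nonneg[of "x - (\<beta>', 0)"] by (simp add: V_def)
          finally show ?thesis .
        qed
        have both: "(1 - \<eta>) * V \<le> u x"
          "u x \<le> (1 + \<eta>) * (\<Sum>c\<in>J. U (x - (c, 0))) + \<eta> * (exp ((fst x - W) / 2) + exp ((- fst x - W) / 2))"
          using D1[unfolded two_sided_bounds_def, rule_format, OF sol config_mono[OF config D(1)] \<beta>(1,2) _ far] \<beta>(3)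
          by (auto simp: V_def)
        note both(2)
        also have "(1 + \<eta>) * (\<Sum>c\<in>J. U (x - (c, 0))) + \<eta> * (exp ((fst x - W) / 2) + exp ((- fst x - W) / 2))
            \<le> (1 + \<eta>) * ((1 + \<eta>) * V) + \<eta> * V"
          using sum wall \<eta>(1) by (intro add_mono mult_left_mono) auto
        also have "\<dots> = (1 + 3 * \<eta> + \<eta> * \<eta>) * V" by (simp add: algebra_simps)
        also have "\<dots> \<le> (1 + 4 * \<eta>) * V"
        proof (rule mult_right_mono)
          have "\<eta> * \<eta> \<le> \<eta> * 1" using \<eta> by (intro mult_left_mono) auto
          then show "1 + 3 * \<eta> + \<eta> * \<eta> \<le> 1 + 4 * \<eta>" by simp
        qed (use V0 in simp)
        finally show ?thesis using far both(1) by (simp add: V_def)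
      qed
      show "D \<le> \<beta>' - \<beta> \<and> R + 1 \<le> (\<beta>' - \<beta>) / 2 \<and>
        (\<forall>x. \<bar>fst x - (\<beta> + \<beta>') / 2\<bar> \<le> 1 \<longrightarrow> norm (snd x) \<le> K * ((\<beta>' - \<beta>) / 2) + 1 \<longrightarrow>
          far J R W x \<and> (1 - \<eta>) * (U (x - (\<beta>, 0)) + U (x - (\<beta>', 0))) \<le> u x \<and>
          u x \<le> (1 + 4 * \<eta>) * (U (x - (\<beta>, 0)) + U (x - (\<beta>', 0))))"
        using slab DL L(1) by (simp add: L_def m_def)
    qed
  qed
  moreover have "R0 > 0" using R1(1) by (simp add: R0_def)
  ultimately show ?thesis by blast
qed

end

text \<open>Factor 4 a^2 - v^2 into (2 a - v) (2 a + v). The 2 stands for the equal contributions of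
  two peaks on their midplane.\<close>

lemma sq_diff_bound:
  fixes v a w \<eta> c d :: real
  assumes "\<bar>v - 2 * a\<bar> \<le> d * \<eta> * w" "\<bar>a\<bar> \<le> c * w" "0 \<le> \<eta>" "\<eta> \<le> 1" "0 \<le> w" "0 \<le> d"
  shows "\<bar>4 * a\<^sup>2 - v\<^sup>2\<bar> \<le> d * (4 * c + d) * \<eta> * w\<^sup>2"
proof -
  have "d * w * \<eta> \<le> d * w * 1" using assms by (intro mult_left_mono) auto
  then have "\<bar>2 * a + v\<bar> \<le> (4 * c + d) * w" using assms(1,2) by (simp add: algebra_simps abs_le_iff)
  then have "\<bar>v - 2 * a\<bar> * \<bar>2 * a + v\<bar> \<le> d * \<eta> * w * ((4 * c + d) * w)"
    using assms by (intro mult_mono) auto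
  moreover have "\<bar>4 * a\<^sup>2 - v\<^sup>2\<bar> = \<bar>v - 2 * a\<bar> * \<bar>2 * a + v\<bar>"
  proof -
    have "4 * a\<^sup>2 - v\<^sup>2 = - ((v - 2 * a) * (2 * a + v))" by (simp add: power2_eq_square algebra_simps)
    then show ?thesis by (simp only: abs_minus abs_mult)
  qed
  ultimately show ?thesis by (simp add: power2_eq_square mult_ac)
qed

section \<open>The conserved quantity on a midplane\<close>

context ground_strip
begin

text \<open>Near the midplane between two adjacent peaks, \<open>u\<close> is \<open>C\<^sup>1\<close>-close to the sum of the two peaks,
  whose normal derivative vanishes on the midplane.\<close>

lemma ham_near:
  fixes x' :: "real ^ 'n"
  defines "N \<equiv> real (DIM(real \<times> (real ^ 'n)) * DIM(real \<times> (real ^ 'n)) + 1)"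
  assumes sol: "solution p \<epsilon> u" and \<eta>: "0 < \<eta>" "\<eta> \<le> 3 / 32"
    and c: "0 < c" "\<And>x y. 1 \<le> norm y \<Longrightarrow> norm x \<le> norm y + 1 \<Longrightarrow> c * U y \<le> U x"
    and grad: "0 < C0" "\<And>x b. b \<in> Basis \<Longrightarrow> R \<le> norm x \<Longrightarrow> \<bar>partial_deriv b U x\<bar> \<le> C0 * U x"
    and R: "1 \<le> R" "\<And>x. R \<le> norm x \<Longrightarrow> U x \<le> \<eta>"
    and slab: "\<And>y. norm (y - (m, x')) \<le> 1 \<Longrightarrow> R \<le> norm (y - (m - L, 0)) \<and> R \<le> norm (y - (m + L, 0)) \<and> u y \<le> \<eta> \<and>
      (1 - \<eta>) * (U (y - (m - L, 0)) + U (y - (m + L, 0))) \<le> u y \<and>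
      u y \<le> (1 + 4 * \<eta>) * (U (y - (m - L, 0)) + U (y - (m + L, 0)))"
  shows "\<bar>ham p u (m, x') + 4 * q L x'\<bar> \<le>
    ((14 * N / c)\<^sup>2 + CARD('n) * ((14 * N / c) * (4 * C0 + 14 * N / c)) + 112) * \<eta> * q L x'"
proof -
  interpret solution p \<epsilon> u by (rule sol)
  define V where "V = (\<lambda>y. U (y - (m - L, 0)) + U (y - (m + L, 0)))"
  define w where "w = U (L, x')"
  have w0: "w > 0" by (simp add: w_def U_pos)
  have N1: "N \<ge> 1" by (simp add: N_def)
  define d where "d = 14 * N / c"
  have d0: "d > 0" using N1 c(1) by (simp add: d_def)
  have n_eq: "norm (- L, x') = norm (L, x')" by (simp add: norm_Pair)
  have U_eq: "U (- L, x') = w"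
    using U_mono[of "(- L, x')" "(L, x')"] U_mono[of "(L, x')" "(- L, x')"] n_eq by (simp add: w_def)
  have Vx: "V (m, x') = 2 * w" using U_eq by (simp add: V_def w_def)
  have nR: "R \<le> norm (L, x')" using slab[of "(m, x')"] by simp
  obtain g where rad: "\<And>x b. b \<in> Basis \<Longrightarrow> x \<noteq> 0 \<Longrightarrow> partial_deriv b U x = (x \<bullet> b) / norm x * g (norm x)"
    using U_radial_gradient by metis
  have ne: "(L, x') \<noteq> 0" "(- L, x') \<noteq> 0" using nR R(1) n_eq by auto
  have B: "(1, 0) \<in> (Basis :: (real \<times> (real ^ 'n)) set)"
    "\<And>b. b \<in> Basis \<Longrightarrow> (0, b) \<in> (Basis :: (real \<times> (real ^ 'n)) set)" by (auto simp: Basis_prod_def)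
  \<comment> \<open>Reflection in the midplane: the normal derivatives of the two peaks cancel and
    the tangential ones agree, so the tangential gradient of the sum is exactly twice that of one
    peak.\<close>
  have pd1: "partial_deriv (1, 0) U (L, x') + partial_deriv (1, 0) U (- L, x') = 0"
    unfolding rad[OF B(1) ne(1)] rad[OF B(1) ne(2)] n_eq by (simp add: inner_prod_def)
  have pdb: "partial_deriv (0, b) U (- L, x') = partial_deriv (0, b) U (L, x')" if "b \<in> Basis" for b
    unfolding rad[OF B(2)[OF that] ne(1)] rad[OF B(2)[OF that] ne(2)] n_eq by (simp add: inner_prod_def)
  have lapV: "has_lap (\<lambda>y. u y - V y)
      (\<lambda>b y. partial_deriv b u y - (partial_deriv b U (y - (m - L, 0)) + partial_deriv b U (y - (m + L, 0))))
      (\<lambda>y. u y - u y powr p - ((U (y - (m - L, 0)) - U (y - (m - L, 0)) powr p) + (U (y - (m + L, 0)) - U (y - (m + L, 0)) powr p)))"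
    unfolding V_def by (rule has_lap_diff[OF u_lap has_lap_add[OF has_lap_translate[OF U_lap] has_lap_translate[OF U_lap]]])
  have close: "\<bar>u y - V y\<bar> \<le> 4 * \<eta> * V y" if "norm (y - (m, x')) \<le> 1" for y
  proof -
    have "(1 - \<eta>) * V y \<le> u y" "u y \<le> (1 + 4 * \<eta>) * V y" using slab[OF that] by (simp_all add: V_def)
    moreover have "0 \<le> \<eta> * V y" using \<eta> by (simp add: V_def U_nonneg)
    moreover have "(1 - \<eta>) * V y = V y - \<eta> * V y" "(1 + 4 * \<eta>) * V y = V y + 4 * (\<eta> * V y)"
      "4 * \<eta> * V y = 4 * (\<eta> * V y)" by (simp_all add: algebra_simps)
    ultimately show ?thesis by (smt (verit))
  qed
  have gr: "\<bar>partial_deriv b u (m, x') - (partial_deriv b U (L, x') + partial_deriv b U (- L, x'))\<bar> \<le> d * \<eta> * w"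
    if b: "b \<in> Basis" for b
  proof -
    have "\<bar>partial_deriv b u (m, x') - (partial_deriv b U ((m, x') - (m - L, 0)) + partial_deriv b U ((m, x') - (m + L, 0)))\<bar>
        \<le> (DIM(real \<times> (real ^ 'n)) * DIM(real \<times> (real ^ 'n)) + 1) * (7 * \<eta> * (V (m, x') / c))"
    \<comment> \<open>The 7 is 4 + 2 + 1: the error of \<open>u\<close> against \<open>V\<close>,
      the nonlinear term of \<open>u\<close>, and those of the two peaks, each in units of \<eta> V.
      Dividing by \<open>c\<close> passes from the unit ball to its center, and V(m, x') = 2 w
      there; hence \<open>d = 14 * N / c\<close>.\<close>
    proof (rule gradient_bound_ball[OF lapV b])
      show "0 < 7 * \<eta> * (V (m, x') / c)" using \<eta> c(1) w0 by (simp add: Vx)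
      fix y assume y: "norm (y - (m, x')) \<le> 1"
      have har: "c * U (y - (z, 0)) \<le> U ((m, x') - (z, 0))" if "R \<le> norm (y - (z, 0))" for z
      proof (rule c(2))
        have "norm ((m, x') - (z, 0)) \<le> norm (y - (z, 0)) + norm ((m, x') - y)"
          using norm_triangle_ineq[of "y - (z, 0)" "(m, x') - y"] by simp
        then show "norm ((m, x') - (z, 0)) \<le> norm (y - (z, 0)) + 1"
          using y by (simp add: norm_minus_commute)
      qed (use that R(1) in simp)
      have "c * V y \<le> V (m, x')"
        using har[of "m - L"] har[of "m + L"] slab[OF y] by (simp add: V_def distrib_left)
      then have Vy: "V y \<le> V (m, x') / c" using c(1) by (simp add: field_simps)
      have uV: "u y \<le> 2 * V y"
      proof -
        have "u y \<le> (1 + 4 * \<eta>) * V y" using slab[OF y] by (simp add: V_def)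
        also have "\<dots> \<le> 2 * V y" using \<eta> by (intro mult_right_mono) (auto simp: V_def U_nonneg)
        finally show ?thesis .
      qed
      have "u y powr p \<le> (u y)\<^sup>2" using u_nonneg[of y] slab[OF y] \<eta> p2 by (intro powr_le_sq) auto
      also have "\<dots> \<le> \<eta> * u y" unfolding power2_eq_square using u_nonneg[of y] slab[OF y] by (intro mult_right_mono) auto
      also have "\<dots> \<le> \<eta> * (2 * V y)" using uV \<eta> by (intro mult_left_mono) auto
      finally have 1: "u y powr p \<le> 2 * (\<eta> * V y)" by simp
      have "U (y - (m - L, 0)) powr p \<le> \<eta> * U (y - (m - L, 0))" "U (y - (m + L, 0)) powr p \<le> \<eta> * U (y - (m + L, 0))"
        using slab[OF y] R(2)[of "y - (m - L, 0)"] R(2)[of "y - (m + L, 0)"] \<eta> by (simp_all add: U_powr_le)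
      then have 2: "U (y - (m - L, 0)) powr p + U (y - (m + L, 0)) powr p \<le> \<eta> * V y"
        by (simp add: V_def distrib_left)
      have 3: "0 \<le> u y powr p" "0 \<le> U (y - (m - L, 0)) powr p" "0 \<le> U (y - (m + L, 0)) powr p" by simp_all
      have 4: "\<bar>u y - V y\<bar> \<le> 4 * (\<eta> * V y)" using close[OF y] by simp
      have 5: "0 \<le> \<eta> * V y" using \<eta> by (simp add: V_def U_nonneg)
      have 6: "7 * (\<eta> * V y) \<le> 7 * \<eta> * (V (m, x') / c)"
        using Vy \<eta> by (simp only: mult.assoc) (intro mult_left_mono; simp)
      have "\<bar>u y - V y\<bar> \<le> 7 * (\<eta> * V y)" using 4 5 by linarith
      moreover have "\<bar>u y - u y powr p - ((U (y - (m - L, 0)) - U (y - (m - L, 0)) powr p) + (U (y - (m + L, 0)) - U (y - (m + L, 0)) powr p))\<bar>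
          \<le> 7 * (\<eta> * V y)"
        using 1 2 3 4 5 unfolding V_def by (smt (verit))
      ultimately show "\<bar>u y - V y\<bar> \<le> 7 * \<eta> * (V (m, x') / c) \<and>
        \<bar>u y - u y powr p - ((U (y - (m - L, 0)) - U (y - (m - L, 0)) powr p) + (U (y - (m + L, 0)) - U (y - (m + L, 0)) powr p))\<bar>
          \<le> 7 * \<eta> * (V (m, x') / c)" using 6 by linarith
    qed
    also have "\<dots> = d * \<eta> * w" by (simp add: Vx d_def N_def)
    finally show ?thesis by simp
  qed
  have u1: "(partial_deriv (1, 0) u (m, x'))\<^sup>2 \<le> d\<^sup>2 * \<eta> * w\<^sup>2"
  proof -
    have "\<bar>partial_deriv (1, 0) u (m, x')\<bar> \<le> d * \<eta> * w" using gr[OF B(1)] pd1 by simp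
    then have "\<bar>partial_deriv (1, 0) u (m, x')\<bar>\<^sup>2 \<le> (d * \<eta> * w)\<^sup>2" by (intro power_mono) auto
    also have "\<dots> = d\<^sup>2 * (\<eta> * \<eta>) * w\<^sup>2" by (simp add: power2_eq_square mult_ac)
    also have "\<dots> \<le> d\<^sup>2 * (\<eta> * 1) * w\<^sup>2" using \<eta> by (intro mult_right_mono mult_left_mono) auto
    finally show ?thesis by simp
  qed
  have ub: "\<bar>4 * (partial_deriv (0, b) U (L, x'))\<^sup>2 - (partial_deriv (0, b) u (m, x'))\<^sup>2\<bar> \<le> d * (4 * C0 + d) * \<eta> * w\<^sup>2"
    if b: "b \<in> Basis" for b
    using gr[OF B(2)[OF b]] pdb[OF b] grad(2)[OF B(2)[OF b] nR] \<eta> w0 d0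
    by (intro sq_diff_bound) (auto simp: w_def)
  have u2: "\<bar>4 * w\<^sup>2 - (u (m, x'))\<^sup>2\<bar> \<le> 8 * (4 * 1 + 8) * \<eta> * w\<^sup>2"
    using close[of "(m, x')"] \<eta> w0 by (intro sq_diff_bound) (auto simp: Vx)
  \<comment> \<open>One of the three powers of \<open>u\<close> is spent on the small factor \<eta>,
    the other two on w^2.\<close>
  have up: "u (m, x') powr (p + 1) \<le> 16 * \<eta> * w\<^sup>2"
  proof -
    have uw: "u (m, x') \<le> 4 * w"
    proof -
      have "u (m, x') \<le> (1 + 4 * \<eta>) * (2 * w)" using slab[of "(m, x')"] U_eq by (simp add: w_def)
      also have "\<dots> \<le> 2 * (2 * w)" using \<eta> w0 by (intro mult_right_mono) auto
      finally show ?thesis by simp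
    qed
    have ue: "u (m, x') \<le> \<eta>" using slab[of "(m, x')"] by simp
    have "u (m, x') powr (p + 1) = u (m, x') powr p * u (m, x')"
      using u_nonneg[of "(m, x')"] by (simp add: powr_add)
    also have "\<dots> \<le> (u (m, x'))\<^sup>2 * u (m, x')"
      using u_nonneg[of "(m, x')"] ue \<eta> p2 by (intro mult_right_mono powr_le_sq) auto
    also have "\<dots> \<le> (4 * w)\<^sup>2 * \<eta>"
      using u_nonneg[of "(m, x')"] ue uw by (intro mult_mono power_mono) auto
    finally show ?thesis by (simp add: power2_eq_square mult_ac)
  qed
  have pp: "0 \<le> 2 / (p + 1) * u (m, x') powr (p + 1)" "2 / (p + 1) * u (m, x') powr (p + 1) \<le> 16 * \<eta> * w\<^sup>2"
  proof -
    show "0 \<le> 2 / (p + 1) * u (m, x') powr (p + 1)" using p2 by simp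
    have "2 / (p + 1) * u (m, x') powr (p + 1) \<le> 1 * u (m, x') powr (p + 1)"
      using p2 by (intro mult_right_mono) auto
    then show "2 / (p + 1) * u (m, x') powr (p + 1) \<le> 16 * \<eta> * w\<^sup>2" using up by linarith
  qed
  define s where "s = (\<Sum>b\<in>(Basis :: (real ^ 'n) set). 4 * (partial_deriv (0, b) U (L, x'))\<^sup>2 - (partial_deriv (0, b) u (m, x'))\<^sup>2)"
  have "\<bar>s\<bar> \<le> (\<Sum>b\<in>(Basis :: (real ^ 'n) set). d * (4 * C0 + d) * \<eta> * w\<^sup>2)"
    unfolding s_def by (rule order_trans[OF sum_abs sum_mono]) (rule ub)
  then have s: "\<bar>s\<bar> \<le> CARD('n) * (d * (4 * C0 + d)) * \<eta> * w\<^sup>2" by (simp add: mult.assoc)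
  have "ham p u (m, x') + 4 * q L x' = (partial_deriv (1, 0) u (m, x'))\<^sup>2 + s + (4 * w\<^sup>2 - (u (m, x'))\<^sup>2)
      + 2 / (p + 1) * u (m, x') powr (p + 1)"
    using u_nonneg[of "(m, x')"]
    by (simp add: ham_def q_def s_def w_def sum_subtractf sum_distrib_left max_def)
  moreover have "\<bar>a + s + b + e\<bar> \<le> X + Y + Z + T"
    if "0 \<le> a" "a \<le> X" "\<bar>s\<bar> \<le> Y" "\<bar>b\<bar> \<le> Z" "0 \<le> e" "e \<le> T" for a s b e X Y Z T :: real
    using that by linarith
  ultimately have "\<bar>ham p u (m, x') + 4 * q L x'\<bar> \<le> d\<^sup>2 * \<eta> * w\<^sup>2 + CARD('n) * (d * (4 * C0 + d)) * \<eta> * w\<^sup>2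
      + 8 * (4 * 1 + 8) * \<eta> * w\<^sup>2 + 16 * \<eta> * w\<^sup>2"
    using u1 s u2 pp by (simp only: zero_le_power2)
  also have "\<dots> = (d\<^sup>2 + CARD('n) * (d * (4 * C0 + d)) + 112) * \<eta> * w\<^sup>2" by (simp add: algebra_simps)
  also have "\<dots> \<le> (d\<^sup>2 + CARD('n) * (d * (4 * C0 + d)) + 112) * \<eta> * q L x'"
    using q_ge(1)[of L x'] d0 grad(1) \<eta> by (intro mult_left_mono) (auto simp: w_def)
  finally show ?thesis by (simp only: d_def)
qed

text \<open>No comparison with \<open>U\<close> enters, only the decay of \<open>u\<close> away from
  the tube. The bound knows nothing of the gap, so it is useful only where \<open>norm x'\<close> is
  a large multiple of it.\<close>

lemma ham_far:
  fixes x' :: "real ^ 'n"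
  defines "N \<equiv> real (DIM(real \<times> (real ^ 'n)) * DIM(real \<times> (real ^ 'n)) + 1)"
  assumes sol: "solution p \<epsilon> u" and small: "\<And>x1 x'. R \<le> norm x' \<Longrightarrow> u (x1, x') \<le> \<eta>"
    and \<eta>: "0 < \<eta>" "\<eta> \<le> 1 / 2" and R: "0 < R" and x': "R + 1 \<le> norm x'"
  shows "\<bar>ham p u (t, x')\<bar> \<le> (CARD('n) + 2 + N powr (p - 1)) * N\<^sup>2 * exp (R + 1) * exp (- norm x')"
proof -
  interpret solution p \<epsilon> u by (rule sol)
  have N1: "N \<ge> 1" by (simp add: N_def)
  define K where "K = N * exp (- (norm x' - 1 - R) / 2)"
  have K: "\<eta> * exp (- (norm x' - 1 - R) / 2) * N \<le> K" "K \<le> N"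
  proof -
    have "\<eta> * (exp (- (norm x' - 1 - R) / 2) * N) \<le> 1 * (exp (- (norm x' - 1 - R) / 2) * N)"
      using \<eta> N1 by (intro mult_right_mono) auto
    then show "\<eta> * exp (- (norm x' - 1 - R) / 2) * N \<le> K" by (simp add: K_def mult_ac)
    have "N * exp (- (norm x' - 1 - R) / 2) \<le> N * 1" using x' N1 by (intro mult_left_mono) auto
    then show "K \<le> N" by (simp add: K_def)
  qed
  have "u (t, x') \<le> \<eta> * exp (- (norm x' - R) / 2)"
    by (rule u_decay[OF small]) (use \<eta> R x' in auto)
  also have "\<dots> \<le> \<eta> * (exp (- (norm x' - 1 - R) / 2) * N)"
  proof (rule mult_left_mono)
    have "exp (- (norm x' - R) / 2) * 1 \<le> exp (- (norm x' - 1 - R) / 2) * N" using N1 by (intro mult_mono) auto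
    then show "exp (- (norm x' - R) / 2) \<le> exp (- (norm x' - 1 - R) / 2) * N" by simp
  qed (use \<eta> in simp)
  finally have uK: "u (t, x') \<le> K" using K(1) by (simp add: mult.assoc)
  have gK: "\<bar>partial_deriv b u (t, x')\<bar> \<le> K" if "b \<in> Basis" for b
    using gradient_decay[OF small \<eta> R x' that, of t] K(1) by (simp add: N_def mult_ac)
  have "\<bar>ham p u (t, x')\<bar> \<le> (DIM(real ^ 'n) + 2 + N powr (p - 1)) * K\<^sup>2"
    by (rule ham_bound[OF p2 u_nonneg uK gK K(2)])
  also have "K\<^sup>2 = N\<^sup>2 * (exp (R + 1) * exp (- norm x'))"
    by (simp add: K_def power_mult_distrib exp_double[symmetric] exp_add[symmetric])
  finally show ?thesis by (simp add: mult.assoc)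
qed

definition gap_bounds :: "nat \<Rightarrow> real \<Rightarrow> real \<Rightarrow> real \<Rightarrow> real \<Rightarrow> real \<Rightarrow> real \<Rightarrow> bool" where
  "gap_bounds \<kappa> \<eta> \<Lambda> C R \<delta> D \<longleftrightarrow> (\<forall>\<epsilon> u J W \<beta> \<beta>'. solution p \<epsilon> u \<longrightarrow> config \<kappa> \<eta> R \<delta> D W J u \<longrightarrow>
    \<beta> \<in> J \<longrightarrow> \<beta>' \<in> J \<longrightarrow> \<beta> < \<beta>' \<longrightarrow> (\<forall>c\<in>J - {\<beta>, \<beta>'}. c \<le> \<beta> - D \<or> \<beta>' + D \<le> c) \<longrightarrow>
    \<bar>\<beta> + \<beta>'\<bar> / 2 + 1 + \<Lambda> * (\<beta>' - \<beta>) \<le> W \<longrightarrow>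
    D \<le> \<beta>' - \<beta> \<and>
    \<bar>(LINT x|lborel. ham p u ((\<beta> + \<beta>') / 2, x)) + 4 * Phi ((\<beta>' - \<beta>) / 2)\<bar> \<le> C * \<eta> * Phi ((\<beta>' - \<beta>) / 2))"

text \<open>The order of the quantifiers matters: \<open>C\<close> and \<open>\<Lambda>\<close> come
  from \<open>U\<close> alone, so \<eta> can later be chosen against \<open>C\<close>, and the
  number of periods in the window, hence \<kappa>, from \<open>\<Lambda>\<close>. Each slice is
  split at norm x' = K L into a part governed by the two peaks and a tail.\<close>

lemma gap_estimate:
  "\<exists>C>0. \<exists>\<Lambda>>0. \<forall>\<kappa> \<eta>. 0 < \<eta> \<longrightarrow> \<eta> \<le> 3 / 32 \<longrightarrow> (\<exists>R0>0. \<forall>R\<ge>R0. \<exists>\<delta>>0. \<exists>D. gap_bounds \<kappa> \<eta> \<Lambda> C R \<delta> D)"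
proof -
  define N where "N = real (DIM(real \<times> (real ^ 'n)) * DIM(real \<times> (real ^ 'n)) + 1)"
  obtain R1 C1 where R1: "R1 \<ge> 1" "C1 > 0"
    and decay: "\<And>L x'. R1 \<le> L \<Longrightarrow> L \<le> norm x' \<Longrightarrow> U (L, x') \<le> U (L, 0) * exp (- norm x' / 6)"
    and q_le: "\<And>L x'. R1 \<le> L \<Longrightarrow> q L x' \<le> C1 * (U (L, x'))\<^sup>2"
    by (rule slice_facts) (rule that)
  obtain R2 k where R2: "R2 \<ge> 1" "k > 0"
    and int_q: "\<And>L. R2 \<le> L \<Longrightarrow> integrable lborel (q L)"
    and Phi_ge: "\<And>L. R2 \<le> L \<Longrightarrow> k * (U (L, 0))\<^sup>2 \<le> Phi L"
    by (rule Phi_facts) (rule that)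
  obtain c where c: "0 < c" "c < 1" "\<And>x y. 1 \<le> norm y \<Longrightarrow> norm x \<le> norm y + 1 \<Longrightarrow> c * U y \<le> U x"
    by (rule U_harnack) (rule that)
  obtain c1 \<mu> where low: "c1 > 0" "\<mu> > 0" "\<And>x. c1 * exp (- \<mu> * norm x) \<le> U x"
    by (rule U_lower) (rule that)
  obtain R3 C0 where R3: "R3 > 0" "C0 > 0"
    and grad: "\<And>x b. b \<in> Basis \<Longrightarrow> R3 \<le> norm x \<Longrightarrow> \<bar>partial_deriv b U x\<bar> \<le> C0 * U x"
    by (rule U_gradient) (rule that)
  \<comment> \<open>Makes 5/6 * norm x' at least 2 \<mu> L + L in the tail: exp(- norm x') then
    contains exp(- 2 \<mu> L), the size of the lower bound for \<open>(U (L, 0))\<^sup>2\<close>, a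
    spare exp(- L), and exp(- norm x' / 6) to be integrated.\<close>
  define K where "K = 4 * \<mu> + 2"
  have K: "1 \<le> K" "2 \<le> K" using low(2) by (auto simp: K_def)
  define \<Lambda> where "\<Lambda> = \<mu> * (K + 3) + 1"
  have \<Lambda>: "\<Lambda> > 0" using low(2) K by (simp add: \<Lambda>_def add_nonneg_pos)
  define C2 where "C2 = (14 * N / c)\<^sup>2 + CARD('n) * ((14 * N / c) * (4 * C0 + 14 * N / c)) + 112"
  have N0: "N \<ge> 0" "N > 0" by (simp_all add: N_def add_nonneg_pos)
  have C2: "C2 > 0" using c(1) N0 R3(2)
    unfolding C2_def by (intro add_nonneg_pos add_nonneg_nonneg mult_nonneg_nonneg) auto
  define E where "E = (LINT x|lborel. exp (- (1 / 6) * norm (x :: real ^ 'n)))"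
  have E0: "E \<ge> 0" unfolding E_def by (rule integral_nonneg_AE) simp
  define C where "C = C2 + 5 * E / k"
  have C: "C > 0" using C2 E0 R2(2) by (simp add: C_def add_pos_nonneg)
  have main: "\<exists>R0>0. \<forall>R\<ge>R0. \<exists>\<delta>>0. \<exists>D. gap_bounds \<kappa> \<eta> \<Lambda> C R \<delta> D" if \<eta>: "0 < \<eta>" "\<eta> \<le> 3 / 32" for \<eta> \<kappa>
  proof -
    obtain R4 where R4: "R4 > 0" "\<forall>R\<ge>R4. \<exists>\<delta>>0. \<exists>D. slab_bounds \<kappa> \<eta> \<mu> K R \<delta> D"
      using slab[OF \<eta> K(1) low, of \<kappa>] by blast
    obtain R5 where R5: "R5 > 0" "\<And>x. R5 \<le> norm x \<Longrightarrow> U x \<le> \<eta>"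
      by (rule U_small[OF \<eta>(1)]) (rule that)
    define R0 where "R0 = Max {R1, R2, R3, R4, R5}"
    have R0: "R1 \<le> R0" "R2 \<le> R0" "R3 \<le> R0" "R4 \<le> R0" "R5 \<le> R0" by (simp_all add: R0_def)
    have "\<exists>\<delta>>0. \<exists>D. gap_bounds \<kappa> \<eta> \<Lambda> C R \<delta> D" if "R0 \<le> R" for R
    proof -
      have R: "R1 \<le> R" "R2 \<le> R" "R3 \<le> R" "R4 \<le> R" "R5 \<le> R" "1 \<le> R" using that R0 R1(1) by linarith+
      obtain \<delta> D1 where \<delta>: "\<delta> > 0" and D1: "slab_bounds \<kappa> \<eta> \<mu> K R \<delta> D1"
        using R4(2) R(4) by blast
      define A where "A = (CARD('n) + 2 + N powr (p - 1)) * N\<^sup>2 * exp (R + 1)"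
      have A: "A > 0" unfolding A_def using N0(2) by (intro mult_pos_pos add_pos_nonneg) auto
      \<comment> \<open>The spare factors exp(- L) and exp(- L / 3) have to absorb \<open>A\<close>
        and \<open>C1\<close>; as D \<le> 2 L, this fixes the multiples 2 and 6.\<close>
      define D where "D = Max {D1, 2 * ln (A / (\<eta> * c1\<^sup>2)), 6 * ln (C1 / \<eta>)}"
      have D: "D1 \<le> D" "2 * ln (A / (\<eta> * c1\<^sup>2)) \<le> D" "6 * ln (C1 / \<eta>) \<le> D" by (simp_all add: D_def)
      show ?thesis
      proof (rule exI[of _ \<delta>], rule conjI[OF \<delta> exI[of _ D]], unfold gap_bounds_def, intro allI impI)
        fix \<epsilon> u J W \<beta> \<beta>'
        assume sol: "solution p \<epsilon> u" and config: "config \<kappa> \<eta> R \<delta> D W J u" and \<beta>: "\<beta> \<in> J" "\<beta>' \<in> J" "\<beta> < \<beta>'"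
          and gap: "\<forall>c\<in>J - {\<beta>, \<beta>'}. c \<le> \<beta> - D \<or> \<beta>' + D \<le> c"
          and W: "\<bar>\<beta> + \<beta>'\<bar> / 2 + 1 + \<Lambda> * (\<beta>' - \<beta>) \<le> W"
        interpret s: solution p \<epsilon> u by (rule sol)
        define L m where "L = (\<beta>' - \<beta>) / 2" and "m = (\<beta> + \<beta>') / 2"
        have \<beta>_eq: "\<beta> = m - L" "\<beta>' = m + L" by (auto simp: L_def m_def field_simps)
        have sep: "\<forall>c\<in>J. \<forall>c'\<in>J. c \<noteq> c' \<longrightarrow> D \<le> \<bar>c - c'\<bar>" and small: "\<forall>x. far J R W x \<longrightarrow> u x \<le> \<eta>"
          and small': "\<And>x1 x'. R \<le> norm x' \<Longrightarrow> u (x1, x') \<le> \<eta>"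
          using config by (simp_all add: config_def)
        have DL: "D \<le> 2 * L" using sep[rule_format, OF \<beta>(1,2)] \<beta>(3) by (simp add: L_def)
        have gap1: "\<forall>c\<in>J - {\<beta>, \<beta>'}. c \<le> \<beta> - D1 \<or> \<beta>' + D1 \<le> c" using gap D(1) by force
        have "R + 1 \<le> L \<and> (\<forall>x. \<bar>fst x - m\<bar> \<le> 1 \<longrightarrow> norm (snd x) \<le> K * L + 1 \<longrightarrow>
          far J R W x \<and> (1 - \<eta>) * (U (x - (\<beta>, 0)) + U (x - (\<beta>', 0))) \<le> u x \<and>
          u x \<le> (1 + 4 * \<eta>) * (U (x - (\<beta>, 0)) + U (x - (\<beta>', 0))))"
          unfolding L_def m_def
          by (rule conjunct2[OF D1[unfolded slab_bounds_def, THEN spec, THEN spec, THEN spec, THEN spec, THEN spec, THEN spec,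
              THEN mp, OF sol, THEN mp, OF config_mono[OF config D(1)], THEN mp, OF \<beta>(1), THEN mp, OF \<beta>(2), THEN mp, OF \<beta>(3),
              THEN mp, OF gap1, THEN mp, OF W[unfolded \<Lambda>_def]]])
        note sl' = this[unfolded \<beta>_eq]
        note sl = conjunct1[OF sl'] conjunct2[OF sl', rule_format]
        have L: "R1 \<le> L" "R2 \<le> L" "0 \<le> L" using sl(1) R by linarith+
        have U0: "U (L, 0) > 0" by (rule U_pos)
        have UL: "exp (- (2 * \<mu>) * L) \<le> (U (L, 0))\<^sup>2 / c1\<^sup>2"
        proof -
          have "c1 * exp (- \<mu> * L) \<le> U (L, 0)" using low(3)[of "(L, 0)"] L(3) by (simp add: norm_Pair)
          then have "(c1 * exp (- \<mu> * L))\<^sup>2 \<le> (U (L, 0))\<^sup>2" using low(1) by (intro power_mono) auto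
          then have "c1\<^sup>2 * exp (- (2 * \<mu>) * L) \<le> (U (L, 0))\<^sup>2"
            by (simp add: power_mult_distrib exp_double[symmetric] mult.assoc)
          then show ?thesis using low(1) by (simp add: field_simps)
        qed
        have AL: "A * exp (- L) \<le> \<eta> * c1\<^sup>2"
        proof -
          have "A / (\<eta> * c1\<^sup>2) \<le> exp L" using D(2) DL A \<eta>(1) low(1) by (intro le_exp_if_ln_le) auto
          then show ?thesis using \<eta>(1) low(1) by (simp add: exp_minus field_simps)
        qed
        have CL: "C1 * exp (- L / 3) \<le> \<eta>"
        proof -
          have "C1 / \<eta> \<le> exp (L / 3)" using D(3) DL R1(2) \<eta>(1) by (intro le_exp_if_ln_le) auto
          then show ?thesis using \<eta>(1) by (simp add: exp_minus field_simps)
        qed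
        \<comment> \<open>The first term suffices for norm x' \<le> K L, the second in the tail;
          there 5 = 1 + 4, from \<open>ham\<close> and from four times \<open>q\<close>.\<close>
        have point: "\<bar>ham p u (m, x') + 4 * q L x'\<bar> \<le> C2 * \<eta> * q L x' + 5 * \<eta> * (U (L, 0))\<^sup>2 * exp (- (1 / 6) * norm x')" for x'
        proof (cases "norm x' \<le> K * L")
          case True
          have "\<bar>ham p u (m, x') + 4 * q L x'\<bar> \<le> C2 * \<eta> * q L x'"
            unfolding C2_def N_def
          proof (rule ham_near[OF sol \<eta> c(1,3) R3(2), where R = R])
            show "\<bar>partial_deriv b U x\<bar> \<le> C0 * U x" if "b \<in> Basis" "R \<le> norm x" for x b
              using grad[OF that(1), of x] that(2) R(3) by simp
            show "1 \<le> R" by (rule R(6))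
            show "U x \<le> \<eta>" if "R \<le> norm x" for x using R5(2)[of x] R(5) that by simp
            fix y :: "real \<times> (real ^ 'n)" assume y: "norm (y - (m, x')) \<le> 1"
            obtain y1 y' where eq: "y = (y1, y')" by (cases y)
            have "\<bar>fst y - m\<bar> \<le> 1" using norm_fst_le[of "y1 - m" "y' - x'"] y eq by simp
            moreover have "norm (snd y) \<le> K * L + 1"
              using norm_snd_le[of "y' - x'" "y1 - m"] norm_triangle_sub[of y' x'] y eq True by simp
            ultimately have *: "far J R W y \<and> (1 - \<eta>) * (U (y - (m - L, 0)) + U (y - (m + L, 0))) \<le> u y \<and>
              u y \<le> (1 + 4 * \<eta>) * (U (y - (m - L, 0)) + U (y - (m + L, 0)))" by (rule sl(2))
            then have "R \<le> norm (y - (m - L, 0))" "R \<le> norm (y - (m + L, 0))"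
              using \<beta>(1,2) unfolding far_def \<beta>_eq by blast+
            then show "R \<le> norm (y - (m - L, 0)) \<and> R \<le> norm (y - (m + L, 0)) \<and> u y \<le> \<eta> \<and>
              (1 - \<eta>) * (U (y - (m - L, 0)) + U (y - (m + L, 0))) \<le> u y \<and>
              u y \<le> (1 + 4 * \<eta>) * (U (y - (m - L, 0)) + U (y - (m + L, 0)))"
              using * small by blast
          qed
          moreover have "0 \<le> 5 * \<eta> * (U (L, 0))\<^sup>2 * exp (- (1 / 6) * norm x')" using \<eta> by simp
          ultimately show ?thesis by linarith
        next
          case False
          have KL: "2 * L \<le> K * L" "1 * L \<le> K * L" using K L(3) by (intro mult_right_mono; simp)+
          then have x'L: "2 * L \<le> norm x'" "L \<le> norm x'" "R + 1 \<le> norm x'" using False sl(1) by linarith+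
          have "\<bar>ham p u (m, x')\<bar> \<le> A * exp (- norm x')"
            unfolding A_def N_def by (rule ham_far[OF sol small']) (use \<eta> R x'L in auto)
          also have "\<dots> \<le> A * (exp (- L) * exp (- (2 * \<mu>) * L) * exp (- (1 / 6) * norm x'))"
          proof (rule mult_left_mono)
            have "(4 * \<mu> + 2) * L \<le> norm x'" using False by (simp add: K_def)
            moreover have "(4 * \<mu> + 2) * L = 4 * (\<mu> * L) + 2 * L" "- (2 * \<mu>) * L = - 2 * (\<mu> * L)" by (simp_all add: algebra_simps)
            ultimately have "- norm x' \<le> - L + - (2 * \<mu>) * L + - (1 / 6) * norm x'"
              using norm_ge_zero[of x'] by linarith
            then show "exp (- norm x') \<le> exp (- L) * exp (- (2 * \<mu>) * L) * exp (- (1 / 6) * norm x')"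
              by (simp only: exp_add[symmetric] exp_le_cancel_iff)
          qed (use A in simp)
          also have "\<dots> = (A * exp (- L)) * exp (- (2 * \<mu>) * L) * exp (- (1 / 6) * norm x')" by (simp only: mult.assoc)
          also have "\<dots> \<le> (\<eta> * c1\<^sup>2) * ((U (L, 0))\<^sup>2 / c1\<^sup>2) * exp (- (1 / 6) * norm x')"
            by (rule mult_right_mono[OF mult_mono[OF AL UL]]) (use \<eta>(1) in auto)
          also have "\<dots> = \<eta> * (U (L, 0))\<^sup>2 * exp (- (1 / 6) * norm x')" using low(1) by simp
          finally have 1: "\<bar>ham p u (m, x')\<bar> \<le> \<eta> * (U (L, 0))\<^sup>2 * exp (- (1 / 6) * norm x')" .
          have "q L x' \<le> C1 * (U (L, x'))\<^sup>2" by (rule q_le[OF L(1)])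
          also have "\<dots> \<le> C1 * (U (L, 0) * exp (- norm x' / 6))\<^sup>2"
            using decay[OF L(1) x'L(2)] R1(2) by (intro mult_left_mono power_mono U_nonneg) auto
          also have "\<dots> = C1 * exp (- norm x' / 6) * ((U (L, 0))\<^sup>2 * exp (- norm x' / 6))"
            by (simp add: power2_eq_square mult_ac)
          also have "\<dots> \<le> C1 * exp (- L / 3) * ((U (L, 0))\<^sup>2 * exp (- norm x' / 6))"
            using x'L(1) R1(2) by (intro mult_right_mono mult_left_mono) auto
          also have "\<dots> \<le> \<eta> * ((U (L, 0))\<^sup>2 * exp (- norm x' / 6))" using CL by (intro mult_right_mono) auto
          finally have 2: "q L x' \<le> \<eta> * (U (L, 0))\<^sup>2 * exp (- (1 / 6) * norm x')" by (simp add: mult.assoc)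
          have "0 \<le> C2 * \<eta> * q L x'" using C2 \<eta> q_ge(2) by simp
          then show ?thesis using 1 2 q_ge(2)[of L x'] by linarith
        qed
        have intE: "integrable lborel (\<lambda>x'::real ^ 'n. exp (- (1 / 6) * norm x'))" by (rule integrable_exp_norm) simp
        have "(LINT x|lborel. ham p u (m, x)) + 4 * Phi L = (LINT x|lborel. ham p u (m, x) + 4 * q L x)"
          using s.ham_integrable int_q[OF L(2)] by (simp add: Phi_def)
        then have "\<bar>(LINT x|lborel. ham p u (m, x)) + 4 * Phi L\<bar> \<le> (LINT x|lborel. \<bar>ham p u (m, x) + 4 * q L x\<bar>)"
          by (simp only: integral_abs_bound)
        also have "\<dots> \<le> (LINT x|lborel. C2 * \<eta> * q L x + 5 * \<eta> * (U (L, 0))\<^sup>2 * exp (- (1 / 6) * norm x))"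
          by (rule Bochner_Integration.integral_mono)
            (intro integrable_abs Bochner_Integration.integrable_add integrable_mult_right s.ham_integrable int_q L intE point)+
        also have "\<dots> = C2 * \<eta> * Phi L + 5 * \<eta> * (U (L, 0))\<^sup>2 * E"
          using int_q[OF L(2)] intE by (simp add: Phi_def E_def)
        also have "\<dots> \<le> C2 * \<eta> * Phi L + 5 * \<eta> * (Phi L / k) * E"
        proof -
          have "(U (L, 0))\<^sup>2 \<le> Phi L / k" using Phi_ge[OF L(2)] R2(2) by (simp add: field_simps)
          then show ?thesis using \<eta> E0 by (intro add_left_mono mult_right_mono mult_left_mono) auto
        qed
        also have "\<dots> = C * \<eta> * Phi L" by (simp add: C_def field_simps)
        finally show "D \<le> \<beta>' - \<beta> \<and> \<bar>(LINT x|lborel. ham p u ((\<beta> + \<beta>') / 2, x)) + 4 * Phi ((\<beta>' - \<beta>) / 2)\<bar>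
            \<le> C * \<eta> * Phi ((\<beta>' - \<beta>) / 2)"
          using DL by (simp add: L_def m_def)
      qed
    qed
    moreover have "R0 > 0" using R0(1) R1(1) by linarith
    ultimately show ?thesis by blast
  qed
  show ?thesis using C \<Lambda> main by blast
qed

end

section \<open>All peaks in one period\<close>

text \<open>A continuous function exceeding \<open>d\<close> somewhere in \<open>S\<close> does so
  on a nonempty open set, which is not negligible; thus the essential bound holds at every
  point.\<close>

lemma Linf_norm_less:
  fixes f :: "'a::euclidean_space \<Rightarrow> real"
  assumes cont: "continuous_on UNIV f" and S: "open S" and less: "Linf_norm S f < ereal d" and x: "x \<in> S"
  shows "\<bar>f x\<bar> \<le> d"
proof (rule ccontr)
  assume "\<not> \<bar>f x\<bar> \<le> d"
  define T where "T = S \<inter> {y. d < \<bar>f y\<bar>}"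
  have "open T" unfolding T_def using S cont by (intro open_Int open_Collect_less continuous_intros)
  have "AE y in lebesgue_on S. ereal \<bar>f y\<bar> \<le> Linf_norm S f"
    unfolding Linf_norm_def by (rule esssup_AE)
  then have "AE y in lebesgue_on S. \<bar>f y\<bar> \<le> d"
  proof (rule eventually_mono)
    fix y assume "ereal \<bar>f y\<bar> \<le> Linf_norm S f"
    then have "ereal \<bar>f y\<bar> < ereal d" using less by (rule le_less_trans)
    then show "\<bar>f y\<bar> \<le> d" by simp
  qed
  then have "AE y in lebesgue. y \<in> S \<longrightarrow> \<bar>f y\<bar> \<le> d"
    using S by (subst (asm) AE_restrict_space_iff) auto
  then obtain Z where "{y. \<not> (y \<in> S \<longrightarrow> \<bar>f y\<bar> \<le> d)} \<subseteq> Z" "Z \<in> null_sets lebesgue"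
    unfolding eventually_ae_filter by auto
  moreover from this have "T \<subseteq> Z" unfolding T_def by (auto simp: not_le)
  ultimately have "negligible T"
    using negligible_subset[of Z T] by (simp add: negligible_iff_null_sets)
  moreover have "T \<noteq> {}" using x \<open>\<not> \<bar>f x\<bar> \<le> d\<close> by (auto simp: T_def)
  ultimately show False using open_not_negligible[OF \<open>open T\<close>] by blast
qed

text \<open>The second part keeps the translate within the 2 M + 1 periods for which copies of the
  peaks are present.\<close>

lemma nearest_period:
  fixes x P :: real
  assumes P: "P > 0"
  obtains n :: int where "\<bar>x - of_int n * P\<bar> \<le> P / 2"
    "\<And>M :: nat. \<bar>x\<bar> \<le> (real M + 1 / 2) * P \<Longrightarrow> \<exists>n' :: int. \<bar>n'\<bar> \<le> int M \<and> \<bar>x - of_int n' * P\<bar> \<le> P / 2"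
proof
  define n where "n = \<lceil>x / P - 1 / 2\<rceil>"
  have n: "x / P - 1 / 2 \<le> of_int n" "of_int n < x / P + 1 / 2" unfolding n_def by linarith+
  have conv: "\<bar>x - of_int m * P\<bar> \<le> P / 2 \<longleftrightarrow> \<bar>x / P - of_int m\<bar> \<le> 1 / 2" for m :: int
  proof -
    have "x - of_int m * P = (x / P - of_int m) * P" using P by (simp add: field_simps)
    then have "\<bar>x - of_int m * P\<bar> = \<bar>x / P - of_int m\<bar> * P" using P by (simp add: abs_mult)
    then have "\<bar>x - of_int m * P\<bar> \<le> P / 2 \<longleftrightarrow> \<bar>x / P - of_int m\<bar> * P \<le> 1 / 2 * P"
      by (simp only: times_divide_eq_left mult_1)
    also have "\<dots> \<longleftrightarrow> \<bar>x / P - of_int m\<bar> \<le> 1 / 2" using P by (rule mult_le_cancel_right_pos)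
    finally show ?thesis .
  qed
  show "\<bar>x - of_int n * P\<bar> \<le> P / 2" unfolding conv using n by linarith
  fix M :: nat assume M: "\<bar>x\<bar> \<le> (real M + 1 / 2) * P"
  then have M': "\<bar>x / P\<bar> \<le> real M + 1 / 2" using P by (simp add: abs_divide field_simps)
  show "\<exists>n' :: int. \<bar>n'\<bar> \<le> int M \<and> \<bar>x - of_int n' * P\<bar> \<le> P / 2"
  proof (intro exI conjI)
    have "of_int n < real M + 1" using n(2) M' by linarith
    then have "n \<le> int M" by linarith
    moreover have "of_int n \<ge> - real M - 1" using n(1) M' by linarith
    \<comment> \<open>At the left end x = - (M + 1/2) P the ceiling \<open>n\<close> is - M - 1; the
      maximum brings it back into the range.\<close>
    ultimately show "\<bar>max n (- int M)\<bar> \<le> int M" by linarith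
    show "\<bar>x - of_int (max n (- int M)) * P\<bar> \<le> P / 2"
      unfolding conv
    proof (cases "n \<le> - int M")
      case True
      then have "real_of_int n \<le> - real M" by linarith
      moreover have "real_of_int (max n (- int M)) = - real M" using True by simp
      ultimately show "\<bar>x / P - real_of_int (max n (- int M))\<bar> \<le> 1 / 2" using n M' by linarith
    next
      case False
      then have "max n (- int M) = n" by simp
      moreover have "\<bar>x / P - real_of_int n\<bar> \<le> 1 / 2" using n by linarith
      ultimately show "\<bar>x / P - real_of_int (max n (- int M))\<bar> \<le> 1 / 2" by simp
    qed
  qed
qed

section \<open>The peaks of one period and their translates\<close>

locale scale = ground_strip p U + solution p \<epsilon> u
  for p and U :: "real \<times> (real ^ 'n) \<Rightarrow> real" and \<epsilon> and u :: "real \<times> (real ^ 'n) \<Rightarrow> real" +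
  fixes k :: nat and b :: "nat \<Rightarrow> real" and G \<delta>0 :: real
  assumes k: "k \<ge> 1" and b_range: "\<And>i. i \<in> {1..k} \<Longrightarrow> \<bar>b i\<bar> \<le> P / 2"
    and gaps: "\<And>i. 1 \<le> i \<Longrightarrow> i < k \<Longrightarrow> G \<le> b (Suc i) - b i" and wrap: "G \<le> b 1 + P - b k"
    and G: "1 \<le> G"
    and near_sum: "\<And>x. \<bar>fst x\<bar> < P / 2 \<Longrightarrow> \<bar>u x - (\<Sum>i=1..k. U (x - (b i, 0)))\<bar> \<le> \<delta>0"
begin

lemma b_mono: "1 \<le> i \<Longrightarrow> i < j \<Longrightarrow> j \<le> k \<Longrightarrow> G \<le> b j - b i"
proof (induction j)
  case (Suc j)
  have step: "G \<le> b (Suc j) - b j" using Suc.prems by (intro gaps) auto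
  show ?case
  proof (cases "i = j")
    case False
    then have "G \<le> b j - b i" using Suc.prems by (intro Suc.IH) auto
    then show ?thesis using step G by linarith
  qed (use step in simp)
qed simp

lemma b_mono': "1 \<le> i \<Longrightarrow> i \<le> j \<Longrightarrow> j \<le> k \<Longrightarrow> b i \<le> b j"
  using b_mono[of i j] G by (cases "i = j") auto

lemma b_sep: "i \<in> {1..k} \<Longrightarrow> j \<in> {1..k} \<Longrightarrow> i \<noteq> j \<Longrightarrow> G \<le> \<bar>b i - b j\<bar>"
  using b_mono[of i j] b_mono[of j i] by (cases "i < j") auto

lemma b_diam: "i \<in> {1..k} \<Longrightarrow> j \<in> {1..k} \<Longrightarrow> \<bar>b i - b j\<bar> \<le> P - G"
  using b_mono'[of 1 i] b_mono'[of 1 j] b_mono'[of i k] b_mono'[of j k] wrap by (auto simp: abs_le_iff)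

lemma P_ge: "G \<le> P"
  using b_diam[of 1 1] k by simp

lemma copies_sep:
  assumes "i \<in> {1..k}" "j \<in> {1..k}" "b i + of_int n * P \<noteq> b j + of_int n' * P"
  shows "G \<le> \<bar>(b i + of_int n * P) - (b j + of_int n' * P)\<bar>"
proof (cases "n = n'")
  case True
  then show ?thesis using assms b_sep[of i j] by auto
next
  case False
  then have "1 \<le> \<bar>n - n'\<bar>" by simp
  then have "1 \<le> \<bar>of_int (n - n') :: real\<bar>" by linarith
  then have "1 * P \<le> \<bar>of_int (n - n')\<bar> * P" using P_pos by (intro mult_right_mono) auto
  then have "P \<le> \<bar>of_int (n - n') * P\<bar>" using P_pos by (simp add: abs_mult)
  moreover have "(b i + of_int n * P) - (b j + of_int n' * P) = (b i - b j) + of_int (n - n') * P"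
    by (simp add: algebra_simps)
  ultimately show ?thesis using b_diam[OF assms(1,2)] by linarith
qed

text \<open>Continuity adds the two boundary planes of the strip, on which \<open>edge_far\<close>
  compares the ends of the period.\<close>

lemma near_sum_closed:
  assumes "\<bar>fst x\<bar> \<le> P / 2"
  shows "\<bar>u x - (\<Sum>i=1..k. U (x - (b i, 0)))\<bar> \<le> \<delta>0"
proof (rule continuous_le_on_closure[where f = "\<lambda>x. \<bar>u x - (\<Sum>i=1..k. U (x - (b i, 0)))\<bar>"])
  have cu: "continuous_on UNIV u" using u_lap by (simp add: has_lap_def)
  show "continuous_on (closure ({-P / 2<..<P / 2} \<times> UNIV)) (\<lambda>x. \<bar>u x - (\<Sum>i=1..k. U (x - (b i, 0)))\<bar>)"
    by (intro continuous_intros continuous_on_subset[OF cu] continuous_on_compose2[OF U_cont[of UNIV]]) auto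
  show "x \<in> closure ({-P / 2<..<P / 2} \<times> UNIV)"
    using assms P_pos by (cases x) (auto simp: closure_Times abs_le_iff)
  show "\<bar>u y - (\<Sum>i=1..k. U (y - (b i, 0)))\<bar> \<le> \<delta>0" if "y \<in> {-P / 2<..<P / 2} \<times> UNIV" for y
    using that by (intro near_sum) (auto simp: abs_less_iff)
qed

text \<open>The sum over the \<open>k\<close> peaks in one period is not periodic; as \<open>u\<close> is, peaks cannot stay
  close to the ends of the period.\<close>

lemma edge_far:
  assumes r: "0 < r" and far: "\<And>x. G - r \<le> norm x \<Longrightarrow> U x \<le> e" and e: "real k * e + 2 * \<delta>0 < U (r, 0)"
    and i: "i \<in> {1..k}"
  shows "\<bar>b i\<bar> + r \<le> P / 2"
proof -
  define T where "T = (\<lambda>t. \<Sum>i=1..k. U ((t, 0) - (b i, 0)))"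
  have "u (P / 2, 0) = u (- P / 2, 0)" using u_periodic[of "- P / 2" 1 0] by (simp add: field_simps)
  then have T: "\<bar>T (P / 2) - T (- P / 2)\<bar> \<le> 2 * \<delta>0"
    using near_sum_closed[of "(P / 2, 0)"] near_sum_closed[of "(- P / 2, 0)"] P_pos by (simp add: T_def)
  have k1: "1 \<in> {1..k}" "k \<in> {1..k}" using k by auto
  have ge: "U (r, 0) \<le> T t" if "j \<in> {1..k}" "\<bar>t - b j\<bar> \<le> r" for t j
  proof -
    have "U (r, 0) \<le> U ((t, 0) - (b j, 0))"
      using that(2) r by (intro U_mono) (simp add: norm_Pair)
    also have "\<dots> \<le> T t" unfolding T_def using that(1) by (intro member_le_sum) (auto simp: U_nonneg)
    finally show ?thesis .
  qed
  have le: "T t \<le> real k * e" if "\<And>j. j \<in> {1..k} \<Longrightarrow> G - r \<le> \<bar>t - b j\<bar>" for t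
  proof -
    have "T t \<le> (\<Sum>i=1..k. e)" unfolding T_def
      by (rule sum_mono) (use that in \<open>auto intro!: far simp: norm_Pair\<close>)
    then show ?thesis by simp
  qed
  have left: "r \<le> P / 2 + b 1"
  proof (rule ccontr)
    assume "\<not> r \<le> P / 2 + b 1"
    then have *: "\<bar>- P / 2 - b 1\<bar> \<le> r" using b_range[OF k1(1)] by linarith
    \<comment> \<open>With \<open>b 1\<close> close to the left end, \<open>wrap\<close> keeps every
      peak at least G - r away from the right end. So \<open>T\<close> is at most
      \<open>k * e\<close> there but at least U(r, 0) at the left end, against the periodicity of
      \<open>u\<close>.\<close>
    have **: "G - r \<le> \<bar>P / 2 - b j\<bar>" if "j \<in> {1..k}" for j
      using b_mono'[of j k] that wrap * by (auto simp: abs_le_iff)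
    then show False using ge[OF k1(1) *] le[of "P / 2", OF **] T e by linarith
  qed
  have right: "r \<le> P / 2 - b k"
  proof (rule ccontr)
    assume "\<not> r \<le> P / 2 - b k"
    then have *: "\<bar>P / 2 - b k\<bar> \<le> r" using b_range[OF k1(2)] by linarith
    have **: "G - r \<le> \<bar>- P / 2 - b j\<bar>" if "j \<in> {1..k}" for j
      using b_mono'[of 1 j] that wrap * by (auto simp: abs_le_iff)
    then show False using ge[OF k1(2) *] le[of "- P / 2", OF **] T e by linarith
  qed
  show ?thesis using left right b_mono'[of 1 i] b_mono'[of i k] i by (auto simp: abs_le_iff)
qed

text \<open>A finite stock of translates, \<open>M\<close> periods on either side: the upper barrier
  is a finite sum, and its wall terms account for the remaining copies.\<close>

definition copies :: "nat \<Rightarrow> real set" where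
  "copies M = (\<lambda>(i, n). b i + of_int n * P) ` ({1..k} \<times> {- int M..int M})"

lemma copiesI: "i \<in> {1..k} \<Longrightarrow> \<bar>n\<bar> \<le> int M \<Longrightarrow> b i + of_int n * P \<in> copies M"
  by (force simp: copies_def abs_le_iff)

lemma copiesE:
  assumes "c \<in> copies M"
  obtains i n where "i \<in> {1..k}" "\<bar>n\<bar> \<le> int M" "c = b i + of_int n * P"
proof -
  obtain i n where "i \<in> {1..k}" "n \<in> {- int M..int M}" "c = b i + of_int n * P"
    using assms by (auto simp: copies_def)
  then show thesis using that[of i n] by (simp add: abs_le_iff)
qed

text \<open>Periodicity carries the estimates from one period to every copy. \<open>edge\<close>
  keeps the sphere about a peak inside the closed period, where the sum over the \<open>k\<close>
  peaks is the right comparison, and the other peaks contribute at most \<open>k * e\<close> on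
  it.\<close>

lemma config_copies:
  assumes R: "0 < R" "R \<le> r" and edge: "\<And>i. i \<in> {1..k} \<Longrightarrow> \<bar>b i\<bar> + r \<le> P / 2"
    and \<eta>: "\<delta>0 + real k * U (R, 0) \<le> \<eta>"
    and \<delta>: "\<delta>0 + real k * e \<le> \<delta>" and far: "\<And>x. G - R \<le> norm x \<Longrightarrow> U x \<le> e" and "D \<le> G"
  shows "config (k * (2 * M + 1)) \<eta> R \<delta> D ((real M + 1 / 2) * P) (copies M) u"
proof -
  have shift: "u (x1 - of_int n * P, x') = u (x1, x')" for x1 n x'
    using u_periodic[of "x1 - of_int n * P" n x'] by simp
  have strip_small: "u x \<le> \<eta>" if "\<bar>fst x\<bar> \<le> P / 2" "\<And>i. i \<in> {1..k} \<Longrightarrow> R \<le> norm (x - (b i, 0))" for x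
  proof -
    have "(\<Sum>i=1..k. U (x - (b i, 0))) \<le> (\<Sum>i=1..k. U (R, 0))"
      by (rule sum_mono) (use that(2) R(1) in \<open>auto intro!: U_mono simp: norm_Pair\<close>)
    then show ?thesis using near_sum_closed[OF that(1)] \<eta> by (simp add: abs_le_iff)
  qed
  have fin: "finite (copies M)" by (simp add: copies_def)
  have card: "card (copies M) \<le> k * (2 * M + 1)"
  proof -
    have "card (copies M) \<le> card ({1..k} \<times> {- int M..int M})" unfolding copies_def by (rule card_image_le) simp
    also have "\<dots> = k * nat (2 * int M + 1)" by (simp add: card_cartesian_product)
    also have "nat (2 * int M + 1) = 2 * M + 1" by simp
    finally show ?thesis .
  qed
  have sep: "D \<le> \<bar>c - c'\<bar>" if c: "c \<in> copies M" "c' \<in> copies M" "c \<noteq> c'" for c c'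
  proof -
    obtain i n i' n' where "i \<in> {1..k}" "c = b i + of_int n * P" "i' \<in> {1..k}" "c' = b i' + of_int n' * P"
      using c(1,2) by (elim copiesE)
    then have "G \<le> \<bar>c - c'\<bar>" using copies_sep[of i i' n n'] c(3) by simp
    then show ?thesis using \<open>D \<le> G\<close> by simp
  qed
  have small: "u x \<le> \<eta>" if x: "far (copies M) R ((real M + 1 / 2) * P) x" for x
  proof -
    obtain x1 x' where eq: "x = (x1, x')" by (cases x)
    have "\<bar>x1\<bar> \<le> (real M + 1 / 2) * P" using x eq by (simp add: far_def)
    then obtain n :: int where n: "\<bar>n\<bar> \<le> int M" "\<bar>x1 - of_int n * P\<bar> \<le> P / 2"
      using nearest_period[OF P_pos, of x1] by metis
    have "u (x1 - of_int n * P, x') \<le> \<eta>"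
    proof (rule strip_small)
      fix i assume i: "i \<in> {1..k}"
      have "R \<le> norm (x - (b i + of_int n * P, 0))" using x copiesI[OF i n(1)] unfolding far_def by blast
      then show "R \<le> norm ((x1 - of_int n * P, x') - (b i, 0))" by (simp add: eq algebra_simps)
    qed (use n in simp)
    then show ?thesis by (simp add: shift eq)
  qed
  have near: "\<bar>u x - U (x - (c, 0))\<bar> \<le> \<delta>" if c: "c \<in> copies M" and x: "norm (x - (c, 0)) = R" for c x
  proof -
    obtain i n where i: "i \<in> {1..k}" and cn: "c = b i + of_int n * P" using c by (elim copiesE)
    obtain x1 x' where eq: "x = (x1, x')" by (cases x)
    define y where "y = (x1 - of_int n * P, x')"
    have yc: "y - (b i, 0) = x - (c, 0)" by (simp add: y_def eq cn)
    have y1: "\<bar>fst y - b i\<bar> \<le> R"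
      using norm_fst_le[of "fst y - b i" "snd y"] yc x by (cases y) (simp add: y_def)
    have "\<bar>fst y\<bar> \<le> P / 2" using y1 edge[OF i] R(2) by linarith
    then have "\<bar>u y - (\<Sum>i=1..k. U (y - (b i, 0)))\<bar> \<le> \<delta>0" by (rule near_sum_closed)
    moreover have "(\<Sum>j=1..k. U (y - (b j, 0))) = U (y - (b i, 0)) + (\<Sum>j\<in>{1..k} - {i}. U (y - (b j, 0)))"
      using i by (simp add: sum.remove)
    moreover have "(\<Sum>j\<in>{1..k} - {i}. U (y - (b j, 0))) \<le> real k * e"
    proof -
      have "(\<Sum>j\<in>{1..k} - {i}. U (y - (b j, 0))) \<le> (\<Sum>j\<in>{1..k} - {i}. e)"
      proof (rule sum_mono, rule far)
        fix j assume j: "j \<in> {1..k} - {i}"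
        have "\<bar>b i - b j\<bar> = norm ((b i, 0) - (b j, 0 :: real ^ 'n))" by (simp add: norm_Pair)
        also have "\<dots> \<le> norm (y - (b j, 0)) + norm (y - (b i, 0))"
          using norm_triangle_ineq4[of "y - (b j, 0)" "y - (b i, 0)"] by simp
        finally show "G - R \<le> norm (y - (b j, 0))" using b_sep[OF i, of j] j x yc by auto
      qed
      also have "\<dots> = (real k - 1) * e" using i by (simp add: of_nat_diff)
      also have "\<dots> \<le> real k * e"
      proof -
        have "G - R \<le> norm (G, 0 :: real ^ 'n)" using G R by (simp add: norm_Pair)
        then have "0 \<le> e" using far[of "(G, 0)"] U_nonneg[of "(G, 0)"] by linarith
        then show ?thesis by (intro mult_right_mono) auto
      qed
      finally show ?thesis .
    qed
    moreover have "0 \<le> (\<Sum>j\<in>{1..k} - {i}. U (y - (b j, 0)))" by (intro sum_nonneg U_nonneg)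
    ultimately have "\<bar>u y - U (y - (b i, 0))\<bar> \<le> \<delta>" using \<delta> by linarith
    then show ?thesis by (simp add: yc) (simp add: y_def eq shift)
  qed
  have small': "u (x1, x') \<le> \<eta>" if "R \<le> norm x'" for x1 x'
  proof -
    obtain n :: int where n: "\<bar>x1 - of_int n * P\<bar> \<le> P / 2"
      using nearest_period[OF P_pos, of x1] by metis
    have "u (x1 - of_int n * P, x') \<le> \<eta>"
    proof (rule strip_small)
      fix i
      show "R \<le> norm ((x1 - of_int n * P, x') - (b i, 0))"
        using norm_snd_le[of x' "x1 - of_int n * P - b i"] that by simp
    qed (use n in simp)
    then show ?thesis by (simp add: shift)
  qed
  show ?thesis unfolding config_def using fin card sep small near small' by blast
qed

text \<open>The cyclic successor: the last peak is followed by the first one of the next period, a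
  member of \<open>copies M\<close> once M \<ge> 1.\<close>

definition next_peak :: "nat \<Rightarrow> real" where
  "next_peak i = (if i = k then b 1 + P else b (Suc i))"

lemma next_peak_gap: "i \<in> {1..k} \<Longrightarrow> G \<le> next_peak i - b i"
  using wrap gaps[of i] by (auto simp: next_peak_def)

lemma next_peak_copies: "i \<in> {1..k} \<Longrightarrow> 1 \<le> M \<Longrightarrow> b i \<in> copies M \<and> next_peak i \<in> copies M"
  using copiesI[of i 0 M] copiesI[of 1 1 M] copiesI[of "Suc i" 0 M] k by (auto simp: next_peak_def)

lemma next_peak_adjacent:
  assumes i: "i \<in> {1..k}" and c: "c \<in> copies M - {b i, next_peak i}" and M: "1 \<le> M" and D: "D \<le> G"
  shows "c \<le> b i - D \<or> next_peak i + D \<le> c"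
proof -
  obtain j n where j: "j \<in> {1..k}" and n: "\<bar>n\<bar> \<le> int M" and cn: "c = b j + of_int n * P" using c by (auto elim: copiesE)
  have s1: "G \<le> \<bar>c - b i\<bar>" using copies_sep[OF j i, of n 0] c cn by simp
  have s2: "G \<le> \<bar>c - next_peak i\<bar>"
  proof -
    obtain j' n' where "j' \<in> {1..k}" "next_peak i = b j' + of_int n' * P"
      using copiesE[OF conjunct2[OF next_peak_copies[OF i M]]] by metis
    then show ?thesis using copies_sep[OF j, of j' n n'] c cn by simp
  qed
  have "\<not> (b i < c \<and> c < next_peak i)"
  proof
    assume c: "b i < c \<and> c < next_peak i"
    show False
    proof (cases "i = k")
      case True
      have "b j \<le> b k" "b 1 \<le> b j" using j b_mono'[of j k] b_mono'[of 1 j] by auto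
      moreover have "next_peak i = b 1 + P" using True by (simp add: next_peak_def)
      ultimately have "0 < of_int n * P" "of_int n * P < 1 * P"
        using c cn unfolding True by linarith+
      then have "0 < (of_int n :: real)" "(of_int n :: real) < 1"
        using P_pos by (simp_all add: zero_less_mult_iff)
      then show False by simp
    next
      case False
      then have i': "Suc i \<in> {1..k}" using i by auto
      have c': "b i < b j + of_int n * P" "b j + of_int n * P < b (Suc i)" using c False cn by (auto simp: next_peak_def)
      have "\<bar>of_int n * P\<bar> < 1 * P"
        using c' b_diam[OF i j] b_diam[OF i' j] G unfolding abs_le_iff abs_less_iff by linarith
      then have "\<bar>of_int n :: real\<bar> < 1" using P_pos by (simp add: abs_mult)
      then have "n = 0" by linarith
      then have "b i < b j" "b j < b (Suc i)" using c' by simp_all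
      then show False using b_mono'[of j i] b_mono'[of "Suc i" j] j i i' by (cases "j \<le> i") auto
    qed
  qed
  then show ?thesis using s1 s2 D G by linarith
qed

text \<open>The midpoint and the constant 1 cost at most \<open>P\<close> each, the margin at most
  \<open>\<Lambda> * P\<close>; this is the origin of the bound
  \<open>\<Lambda> + 2\<close>.\<close>

lemma next_peak_room:
  assumes i: "i \<in> {1..k}" and \<Lambda>: "0 < \<Lambda>" "\<Lambda> + 2 \<le> real M"
  shows "\<bar>b i + next_peak i\<bar> / 2 + 1 + \<Lambda> * (next_peak i - b i) \<le> (real M + 1 / 2) * P"
proof -
  have k1: "1 \<in> {1..k}" "k \<in> {1..k}" using k by auto
  have np: "next_peak i - b i \<le> P" "\<bar>next_peak i\<bar> \<le> 3 / 2 * P"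
  proof -
    show "next_peak i - b i \<le> P"
    proof (cases "i = k")
      case True
      then show ?thesis using b_mono'[of 1 k] k by (simp add: next_peak_def)
    next
      case False
      then show ?thesis using b_diam[of "Suc i" i] i G by (auto simp: next_peak_def abs_le_iff)
    qed
    show "\<bar>next_peak i\<bar> \<le> 3 / 2 * P"
      using b_range[OF k1(1)] b_range[of "Suc i"] i P_pos by (auto simp: next_peak_def abs_le_iff)
  qed
  have "\<bar>b i + next_peak i\<bar> / 2 \<le> P"
    using np(2) b_range[OF i] abs_triangle_ineq[of "b i" "next_peak i"] by simp
  moreover have "\<Lambda> * (next_peak i - b i) \<le> \<Lambda> * P" using np(1) \<Lambda> by (intro mult_left_mono) auto
  moreover have "(\<Lambda> + 2) * P \<le> real M * P" using \<Lambda> P_pos by (intro mult_right_mono) auto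
  moreover have "1 \<le> P" using P_ge G by simp
  ultimately show ?thesis by (simp add: distrib_right)
qed

end

section \<open>From the conserved quantity to equal gaps\<close>

context ground_strip
begin

text \<open>Both multiples of \<open>Phi\<close> approximate the same number -E, so (4 - C \<eta>)
  Phi a \<le> (4 + C \<eta>) Phi b. A loss of \<kappa> would then force 4 \<kappa> < 2 C \<eta>
  \<le> 2 \<kappa>.\<close>

lemma ratio_gap:
  fixes a b :: real
  assumes "0 < Phi a" and e: "C * \<eta> \<le> \<kappa>" "0 < \<kappa>" "0 < C * \<eta>"
    and 1: "\<bar>E + 4 * Phi a\<bar> \<le> C * \<eta> * Phi a" "\<bar>E + 4 * Phi b\<bar> \<le> C * \<eta> * Phi b" and 2: "Phi b \<le> (1 - \<kappa>) * Phi a"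
  shows False
proof -
  have "(4 + C * \<eta>) * Phi b \<le> (4 + C * \<eta>) * ((1 - \<kappa>) * Phi a)" using 2 e by (intro mult_left_mono) auto
  moreover have "(4 - C * \<eta>) * Phi a \<le> (4 + C * \<eta>) * Phi b"
    using 1 by (simp add: algebra_simps abs_le_iff)
  ultimately have "(4 - C * \<eta>) * Phi a \<le> ((4 + C * \<eta>) * (1 - \<kappa>)) * Phi a" by (simp only: mult.assoc)
  then have "4 - C * \<eta> \<le> (4 + C * \<eta>) * (1 - \<kappa>)" using assms(1) by simp
  moreover have "0 < C * \<eta> * \<kappa>" using e by simp
  ultimately show False using e by (simp add: algebra_simps)
qed

text \<open>All constants are fixed before \<epsilon>: \<kappa> from \<open>d\<close>, then
  \<open>\<eta>\<close>, \<open>M\<close>, \<open>R\<close>, \<open>\<delta>\<close>,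
  \<open>D\<close>, and at last \<open>G\<close> and \<open>\<delta>0\<close>, which the peak
  hypothesis grants for all small \<epsilon>.\<close>

lemma peak_gaps_equalize:
  assumes k: "k \<ge> 1" and d: "d > 0"
    and sol: "\<forall>\<^sub>F \<epsilon> in at_right 0. solves_E p \<epsilon> (u \<epsilon>)" and peaks: "admits_peaks U u k a"
  shows "\<forall>\<^sub>F \<epsilon> in at_right 0. \<forall>i\<in>{1..k}. \<forall>j\<in>{1..k}.
    \<bar>(peak_ext k (a \<epsilon>) (i + 1) - peak_ext k (a \<epsilon>) i) / \<epsilon> - (peak_ext k (a \<epsilon>) (j + 1) - peak_ext k (a \<epsilon>) j) / \<epsilon>\<bar> \<le> d"
proof -
  obtain R1 c where R1: "R1 \<ge> 1" "c > 0" "\<And>L. R1 \<le> L \<Longrightarrow> c * (U (L, 0))\<^sup>2 \<le> Phi L"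
    "\<And>d. d > 0 \<Longrightarrow> \<exists>\<kappa>>0. \<forall>L L'. R1 \<le> L \<longrightarrow> L + d \<le> L' \<longrightarrow> Phi L' \<le> (1 - \<kappa>) * Phi L"
    by (rule Phi_facts) (rule that)
  \<comment> \<open>Half of \<open>d\<close>, since \<open>Phi\<close> is evaluated at half
    gaps.\<close>
  have "d / 2 > 0" using d by simp
  then obtain \<kappa> where \<kappa>: "\<kappa> > 0" "\<forall>L L'. R1 \<le> L \<longrightarrow> L + d / 2 \<le> L' \<longrightarrow> Phi L' \<le> (1 - \<kappa>) * Phi L"
    using R1(4) by blast
  obtain C \<Lambda> where C: "C > 0" and \<Lambda>: "\<Lambda> > 0" and
    gap: "\<forall>\<kappa> \<eta>. 0 < \<eta> \<longrightarrow> \<eta> \<le> 3 / 32 \<longrightarrow> (\<exists>R0>0. \<forall>R\<ge>R0. \<exists>\<delta>>0. \<exists>D. gap_bounds \<kappa> \<eta> \<Lambda> C R \<delta> D)"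
    using gap_estimate by blast
  define \<eta> where "\<eta> = min (3 / 32) (\<kappa> / C)"
  have \<eta>: "0 < \<eta>" "\<eta> \<le> 3 / 32" "C * \<eta> \<le> \<kappa>" using C \<kappa>(1) by (auto simp: \<eta>_def min_def field_simps)
  define M where "M = nat \<lceil>\<Lambda>\<rceil> + 2"
  have M: "\<Lambda> + 2 \<le> real M" "1 \<le> M" using \<Lambda> unfolding M_def by linarith+
  obtain R0 where R0: "R0 > 0" "\<forall>R\<ge>R0. \<exists>\<delta>>0. \<exists>D. gap_bounds (k * (2 * M + 1)) \<eta> \<Lambda> C R \<delta> D"
    using gap \<eta>(1,2) by blast
  have k0: "real k > 0" using k by simp
  have "\<eta> / (2 * k) > 0" using \<eta>(1) k0 by simp
  then obtain R2 where R2: "R2 > 0" "\<And>x. R2 \<le> norm x \<Longrightarrow> U x \<le> \<eta> / (2 * k)" using U_small by blast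
  define R where "R = max R0 R2"
  have R: "R0 \<le> R" "R2 \<le> R" "R > 0" using R0(1) by (auto simp: R_def)
  obtain \<delta> D where \<delta>: "\<delta> > 0" and gb: "gap_bounds (k * (2 * M + 1)) \<eta> \<Lambda> C R \<delta> D"
    using R0(2) R(1) by blast
  \<comment> \<open>Bounds a peak seen from distance \<open>G - R\<close>: \<open>k\<close> of them
    stay below \<delta> / 2, for closeness on the spheres, and below U(R, 0) / 2, for
    \<open>edge_far\<close>.\<close>
  define e where "e = min (\<delta> / (2 * k)) (U (R, 0) / (2 * k))"
  have e: "e > 0" using \<delta> U_pos k0 by (simp add: e_def)
  have ke: "k * e \<le> \<delta> / 2" "k * e \<le> U (R, 0) / 2"
  proof -
    have "k * e \<le> k * (\<delta> / (2 * k))" "k * e \<le> k * (U (R, 0) / (2 * k))"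
      using k0 by (intro mult_left_mono; simp add: e_def)+
    then show "k * e \<le> \<delta> / 2" "k * e \<le> U (R, 0) / 2" using k0 by simp_all
  qed
  obtain R3 where R3: "R3 > 0" "\<And>x. R3 \<le> norm x \<Longrightarrow> U x \<le> e" using U_small[OF e] by blast
  define G where "G = Max {1, D, R3 + R, 2 * R1}"
  have G_ge: "1 \<le> G" "D \<le> G" "R3 + R \<le> G" "2 * R1 \<le> G" by (simp_all add: G_def)
  \<comment> \<open>The last entry completes the premise of \<open>edge_far\<close>: U(R, 0) / 2 + 2
    * U(R, 0) / 8 < U(R, 0).\<close>
  define \<delta>0 where "\<delta>0 = Min {\<eta> / 2, \<delta> / 2, U (R, 0) / 8}"
  have \<delta>0: "\<delta>0 > 0" "\<delta>0 \<le> \<eta> / 2" "\<delta>0 \<le> \<delta> / 2" "\<delta>0 \<le> U (R, 0) / 8"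
    using \<eta>(1) \<delta> U_pos by (simp_all add: \<delta>0_def)
  have ev_gap: "\<forall>\<^sub>F \<epsilon> in at_right 0. \<forall>i\<in>{0..k}. G \<le> (peak_ext k (a \<epsilon>) (i + 1) - peak_ext k (a \<epsilon>) i) / \<epsilon>"
    using peaks unfolding admits_peaks_def filterlim_at_top by (intro eventually_ball_finite) auto
  have ev_range: "\<forall>\<^sub>F \<epsilon> in at_right 0. \<forall>i\<in>{1..k}. a \<epsilon> i \<in> {-pi..<pi}"
    using peaks unfolding admits_peaks_def by blast
  have ev_pos: "\<forall>\<^sub>F \<epsilon> in at_right 0. (0::real) < \<epsilon>" by (simp add: eventually_at_right_less)
  have ev_norm: "\<forall>\<^sub>F \<epsilon> in at_right 0. Linf_norm ({-pi / \<epsilon><..<pi / \<epsilon>} \<times> UNIV)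
              (\<lambda>x. u \<epsilon> x - (\<Sum>i=1..k. U (x - (a \<epsilon> i / \<epsilon>, 0)))) < ereal \<delta>0"
    using peaks \<delta>0(1) unfolding admits_peaks_def by (intro order_tendstoD(2)[where y = 0]) auto
  show ?thesis
    using ev_gap ev_range ev_pos ev_norm sol
  proof eventually_elim
    case (elim \<epsilon>)
    interpret s: solution p \<epsilon> "u \<epsilon>" by standard (use p2 elim in auto)
    define b where "b = (\<lambda>i. a \<epsilon> i / \<epsilon>)"
    have P2: "s.P / 2 = pi / \<epsilon>" by (simp add: s.P_def)
    have cu: "continuous_on UNIV (u \<epsilon>)" using s.u_lap by (simp add: has_lap_def)
    have ext: "(peak_ext k (a \<epsilon>) (i + 1) - peak_ext k (a \<epsilon>) i) / \<epsilon> = (if i = k then b 1 + s.P else b (Suc i)) - b i"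
      if "i \<in> {1..k}" for i
      using that by (auto simp: peak_ext_def b_def s.P_def diff_divide_distrib add_divide_distrib)
    interpret scale p U \<epsilon> "u \<epsilon>" k b G \<delta>0
    proof
      show "k \<ge> 1" by (rule k)
      show "1 \<le> G" by (rule G_ge)
      show "\<bar>b i\<bar> \<le> s.P / 2" if "i \<in> {1..k}" for i
      proof -
        have "\<bar>a \<epsilon> i\<bar> \<le> pi" using elim(2)[rule_format, OF that] by (auto simp: abs_le_iff)
        then show ?thesis unfolding P2 b_def using elim(3) by (simp add: abs_divide divide_right_mono)
      qed
      show "G \<le> b (Suc i) - b i" if "1 \<le> i" "i < k" for i
        using elim(1)[rule_format, of i] ext[of i] that by simp
      show "G \<le> b 1 + s.P - b k"
        using elim(1)[rule_format, of k] ext[of k] k by simp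
      show "\<bar>u \<epsilon> x - (\<Sum>i=1..k. U (x - (b i, 0)))\<bar> \<le> \<delta>0" if "\<bar>fst x\<bar> < s.P / 2" for x
      proof (rule Linf_norm_less[where S = "{-pi / \<epsilon><..<pi / \<epsilon>} \<times> UNIV"])
        show "continuous_on UNIV (\<lambda>x. u \<epsilon> x - (\<Sum>i=1..k. U (x - (b i, 0))))"
          by (intro continuous_intros cu continuous_on_compose2[OF U_cont[of UNIV]]) auto
        show "open ({-pi / \<epsilon><..<pi / \<epsilon>} \<times> (UNIV :: (real ^ 'n) set))" by (intro open_Times) auto
        show "Linf_norm ({-pi / \<epsilon><..<pi / \<epsilon>} \<times> UNIV) (\<lambda>x. u \<epsilon> x - (\<Sum>i=1..k. U (x - (b i, 0)))) < ereal \<delta>0"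
          using elim(4) by (simp add: b_def)
        show "x \<in> {-pi / \<epsilon><..<pi / \<epsilon>} \<times> UNIV" using that P2 by (cases x) (auto simp: abs_less_iff)
      qed
    qed
    have edge: "\<bar>b i\<bar> + R \<le> s.P / 2" if "i \<in> {1..k}" for i
    proof (rule edge_far[OF R(3) _ _ that])
      show "U x \<le> e" if "G - R \<le> norm x" for x using R3(2)[of x] that G_ge(3) by simp
      show "real k * e + 2 * \<delta>0 < U (R, 0)" using ke(2) \<delta>0(4) U_pos[of "(R, 0)"] by linarith
    qed
    have config: "config (k * (2 * M + 1)) \<eta> R \<delta> D ((real M + 1 / 2) * s.P) (copies M) (u \<epsilon>)"
    proof (rule config_copies[OF R(3) order_refl edge])
      have "U (R, 0) \<le> \<eta> / (2 * k)" using R2(2)[of "(R, 0)"] R by (simp add: norm_Pair)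
      then have "real k * U (R, 0) \<le> real k * (\<eta> / (2 * k))" by (intro mult_left_mono) auto
      then show "\<delta>0 + real k * U (R, 0) \<le> \<eta>" using \<delta>0(2) k0 by simp
      show "\<delta>0 + real k * e \<le> \<delta>" using \<delta>0(3) ke(1) by linarith
      show "U x \<le> e" if "G - R \<le> norm x" for x using R3(2)[of x] that G_ge(3) by simp
      show "D \<le> G" by (rule G_ge)
    qed
    \<comment> \<open>By \<open>ham_const\<close> the slice x1 = 0 stands for every
      midplane.\<close>
    define E where "E = (LINT x|lborel. ham p (u \<epsilon>) (0, x))"
    define L where "L = (\<lambda>i. (next_peak i - b i) / 2)"
    have est: "\<bar>E + 4 * Phi (L i)\<bar> \<le> C * \<eta> * Phi (L i)" if i: "i \<in> {1..k}" for i
    proof -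
      have lt: "b i < next_peak i" using next_peak_gap[OF i] G_ge(1) by linarith
      have adj: "\<forall>c\<in>copies M - {b i, next_peak i}. c \<le> b i - D \<or> next_peak i + D \<le> c"
        using next_peak_adjacent[OF i _ M(2) G_ge(2)] by blast
      have "\<bar>(LINT x|lborel. ham p (u \<epsilon>) ((b i + next_peak i) / 2, x)) + 4 * Phi ((next_peak i - b i) / 2)\<bar>
          \<le> C * \<eta> * Phi ((next_peak i - b i) / 2)"
        by (rule conjunct2[OF gb[unfolded gap_bounds_def, THEN spec, THEN spec, THEN spec, THEN spec, THEN spec, THEN spec,
          THEN mp, OF s.solution_axioms, THEN mp, OF config, THEN mp, OF conjunct1[OF next_peak_copies[OF i M(2)]],
          THEN mp, OF conjunct2[OF next_peak_copies[OF i M(2)]], THEN mp, OF lt, THEN mp, OF adj,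
          THEN mp, OF next_peak_room[OF i \<Lambda> M(1)]]])
      then show ?thesis unfolding E_def L_def using s.ham_const[of "(b i + next_peak i) / 2" 0] by simp
    qed
    have L_ge: "R1 \<le> L i" if "i \<in> {1..k}" for i using next_peak_gap[OF that] G_ge(4) by (simp add: L_def)
    have le: "L j \<le> L i + d / 2" if ij: "i \<in> {1..k}" "j \<in> {1..k}" for i j
    proof (rule ccontr)
      assume "\<not> L j \<le> L i + d / 2"
      then have "Phi (L j) \<le> (1 - \<kappa>) * Phi (L i)" using \<kappa>(2) L_ge[OF ij(1)] by simp
      moreover have "0 < c * (U (L i, 0))\<^sup>2" using R1(2) U_pos[of "(L i, 0)"] by simp
      then have "0 < Phi (L i)" using R1(3)[OF L_ge[OF ij(1)]] by linarith
      moreover have "0 < C * \<eta>" using C \<eta>(1) by simp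
      ultimately show False using ratio_gap[OF _ \<eta>(3) \<kappa>(1) _ est[OF ij(1)] est[OF ij(2)]] by blast
    qed
    show ?case
    proof (intro ballI)
      fix i j assume ij: "i \<in> {1..k}" "j \<in> {1..k}"
      have "(peak_ext k (a \<epsilon>) (i + 1) - peak_ext k (a \<epsilon>) i) / \<epsilon> = 2 * L i" if "i \<in> {1..k}" for i
        using ext[OF that] by (simp add: L_def next_peak_def)
      then show "\<bar>(peak_ext k (a \<epsilon>) (i + 1) - peak_ext k (a \<epsilon>) i) / \<epsilon> - (peak_ext k (a \<epsilon>) (j + 1) - peak_ext k (a \<epsilon>) j) / \<epsilon>\<bar> \<le> d"
        using le[OF ij] le[OF ij(2,1)] ij by (simp add: abs_le_iff)
    qed
  qed
qed

end

text \<open>Telescoping over one full turn; this identifies the common value of nearly equal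
  gaps.\<close>

lemma sum_peak_gaps:
  "k \<ge> 1 \<Longrightarrow> (\<Sum>i=1..k. peak_ext k a (i + 1) - peak_ext k a i) = 2 * pi"
proof -
  assume k: "k \<ge> 1"
  have "(\<Sum>i=1..k. peak_ext k a (i + 1) - peak_ext k a i) = peak_ext k a (k + 1) - peak_ext k a 1"
    using sum_Suc_diff[of 1 k "peak_ext k a"] k by simp
  then show ?thesis using k by (simp add: peak_ext_def)
qed

theorem proposition1:
  fixes p :: real and N k :: nat
    and U :: "real \<times> (real ^ 'n) \<Rightarrow> real"
    and u :: "real \<Rightarrow> real \<times> (real ^ 'n) \<Rightarrow> real"
    and a :: "real \<Rightarrow> nat \<Rightarrow> real"
  assumes "N \<ge> 2" and "CARD('n) = N - 1"
    and "2 \<le> p" and "N \<ge> 3 \<longrightarrow> p < (real N + 2) / (real N - 2)"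
    and "ground_state p U"
    and "k \<ge> 2"
    and "\<forall>\<^sub>F \<epsilon> in at_right 0. solves_E p \<epsilon> (u \<epsilon>)"
    and "admits_peaks U u k a"
  shows "\<forall>i\<in>{0..k}.
    ((\<lambda>\<epsilon>. (peak_ext k (a \<epsilon>) (i + 1) - peak_ext k (a \<epsilon>) i) / \<epsilon>
            - 2 * pi / (real k * \<epsilon>)) \<longlongrightarrow> 0) (at_right 0)"
proof
  fix i assume i: "i \<in> {0..k}"
  interpret ground_strip p U by standard (fact assms)+
  have k1: "k \<ge> 1" using assms(6) by simp
  define \<Delta> where "\<Delta> = (\<lambda>\<epsilon> i. (peak_ext k (a \<epsilon>) (i + 1) - peak_ext k (a \<epsilon>) i) / \<epsilon>)"
  \<comment> \<open>The gap with index 0 is the gap with index \<open>k\<close>, seen one period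
    earlier.\<close>
  define i' where "i' = (if i = 0 then k else i)"
  have i': "i' \<in> {1..k}" using i k1 by (auto simp: i'_def)
  have same: "\<Delta> \<epsilon> i = \<Delta> \<epsilon> i'" for \<epsilon> using k1 by (simp add: \<Delta>_def i'_def peak_ext_def)
  show "((\<lambda>\<epsilon>. (peak_ext k (a \<epsilon>) (i + 1) - peak_ext k (a \<epsilon>) i) / \<epsilon>
            - 2 * pi / (real k * \<epsilon>)) \<longlongrightarrow> 0) (at_right 0)"
  proof (rule tendstoI)
    fix d :: real assume d: "d > 0"
    have "\<forall>\<^sub>F \<epsilon> in at_right 0. \<forall>i\<in>{1..k}. \<forall>j\<in>{1..k}. \<bar>\<Delta> \<epsilon> i - \<Delta> \<epsilon> j\<bar> \<le> d / 2"
      unfolding \<Delta>_def by (rule peak_gaps_equalize[OF k1 _ assms(7,8)]) (use d in simp)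
    then show "\<forall>\<^sub>F \<epsilon> in at_right 0. dist ((peak_ext k (a \<epsilon>) (i + 1) - peak_ext k (a \<epsilon>) i) / \<epsilon>
            - 2 * pi / (real k * \<epsilon>)) 0 < d"
    proof (rule eventually_mono)
      fix \<epsilon> assume close: "\<forall>i\<in>{1..k}. \<forall>j\<in>{1..k}. \<bar>\<Delta> \<epsilon> i - \<Delta> \<epsilon> j\<bar> \<le> d / 2"
      have "(\<Sum>j=1..k. \<Delta> \<epsilon> j) = 2 * pi / \<epsilon>"
        using sum_peak_gaps[OF k1, of "a \<epsilon>"] by (simp add: \<Delta>_def flip: sum_divide_distrib)
      \<comment> \<open>The deviation of one gap from the mean is the mean of its deviations from
        all gaps.\<close>
      then have "real k * (\<Delta> \<epsilon> i' - 2 * pi / (real k * \<epsilon>)) = (\<Sum>j=1..k. \<Delta> \<epsilon> i' - \<Delta> \<epsilon> j)"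
        using k1 by (simp add: sum_subtractf right_diff_distrib)
      then have "real k * \<bar>\<Delta> \<epsilon> i' - 2 * pi / (real k * \<epsilon>)\<bar> = \<bar>\<Sum>j=1..k. \<Delta> \<epsilon> i' - \<Delta> \<epsilon> j\<bar>"
        using abs_mult[of "real k"] by (metis abs_of_nat)
      also have "\<dots> \<le> (\<Sum>j=1..k. d / 2)"
        by (rule order_trans[OF sum_abs sum_mono]) (use close i' in auto)
      also have "\<dots> = real k * (d / 2)" by simp
      finally have "\<bar>\<Delta> \<epsilon> i' - 2 * pi / (real k * \<epsilon>)\<bar> \<le> d / 2" using k1 by simp
      then have "\<bar>\<Delta> \<epsilon> i - 2 * pi / (real k * \<epsilon>)\<bar> < d" unfolding same by (rule le_less_trans) (use d in simp)
      then show "dist ((peak_ext k (a \<epsilon>) (i + 1) - peak_ext k (a \<epsilon>) i) / \<epsilon> - 2 * pi / (real k * \<epsilon>)) 0 < d"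
        by (simp add: \<Delta>_def)
    qed
  qed
qed

end
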